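(* Let $X$ be a Banach space and let $\tau:Z_3\to X$ be a bounded linear operator. Then either $\tau$ is strictly singular, or there is a complemented subspace of $Z_3$ isomorphic to $Z_3$ on which the restriction of $\tau$ is an isomorphism onto its image.
   Context: All spaces are complex. For the couple $(X_0,X_1)=(\ell_\infty,\ell_1)$ put $\Sigma=\ell_\infty+\ell_1$. The Calderón space $\mathcal C$ of the couple is the Banach space of bounded continuous functions $F:\{z\in\mathbb C:0\le \mathrm{Re}\,z\le 1\}\to\Sigma$, analytic on the open strip, such that for $j=0,1$ the map $t\mapsto F(j+it)$ is continuous from $\mathbb R$ into $X_j$ and tends to $0$ as $|t|\to\infty$, with norm $\|F\|=\max_{j=0,1}\sup_{t}\|F(j+it)\|_{X_j}$. For $k=0,1,2$ let $\Delta_k:\mathcal C\to\Sigma$, $\Delta_k(F)=F^{(k)}(1/2)/k!$. Put $Z_3=\{(\Delta_2F,\Delta_1F,\Delta_0F):F\in\mathcal C\}$ with the quotient norm $\|x\|=\inf\{\|F\|:F\in\mathcal C,\ (\Delta_2F,\Delta_1F,\Delta_0F)=x\}$ (the third Rochberg space of the couple at $1/2$). An operator is strictly singular if its restriction to any infinite dimensional closed subspace is not an isomorphism onto its image. *)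

theory Defs
  imports "HOL-Analysis.Analysis"
begin

section \<open>Complex vector spaces and complex Banach spaces\<close>

text \<open>HOL-Analysis only has real normed spaces; a complex structure is added on top of the
  real one by a scalar multiplication that extends \<^term>\<open>scaleR\<close>.\<close>

class scaleC =
  fixes scaleC :: "complex \<Rightarrow> 'a \<Rightarrow> 'a"  (infixr \<open>*\<^sub>C\<close> 75)

class complex_vector = real_vector + scaleC +
  assumes scaleC_add_right: "c *\<^sub>C (x + y) = c *\<^sub>C x + c *\<^sub>C y"
    and scaleC_add_left: "(c + d) *\<^sub>C x = c *\<^sub>C x + d *\<^sub>C x"
    and scaleC_scaleC: "c *\<^sub>C (d *\<^sub>C x) = (c * d) *\<^sub>C x"
    and scaleC_of_real: "complex_of_real r *\<^sub>C x = r *\<^sub>R x"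

class complex_normed_vector = complex_vector + real_normed_vector +
  assumes norm_scaleC: "norm (c *\<^sub>C x) = cmod c * norm x"

class complex_banach = complex_normed_vector + banach

global_interpretation complex_vector:
  vector_space "scaleC :: complex \<Rightarrow> 'a::complex_vector \<Rightarrow> 'a"
proof
  fix x :: 'a
  show "1 *\<^sub>C x = x"
    using scaleC_of_real[of 1 x] by simp
qed (rule scaleC_add_right scaleC_add_left scaleC_scaleC)+

instantiation complex :: complex_banach
begin

definition scaleC_complex :: "complex \<Rightarrow> complex \<Rightarrow> complex" where
  "scaleC_complex c z = c * z"

instance
  by standard (simp_all add: scaleC_complex_def algebra_simps norm_mult scaleR_conv_of_real)

end

instantiation prod :: (complex_vector, complex_vector) complex_vector
begin

definition scaleC_prod :: "complex \<Rightarrow> 'a \<times> 'b \<Rightarrow> 'a \<times> 'b" where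
  "scaleC_prod c p = (c *\<^sub>C fst p, c *\<^sub>C snd p)"

instance
  by standard
    (simp_all add: scaleC_prod_def scaleC_add_right scaleC_add_left scaleC_scaleC
      scaleC_of_real scaleR_prod_def)

end

lemma bounded_linear_scaleC:
  "bounded_linear ((*\<^sub>C) c :: 'a::complex_normed_vector \<Rightarrow> 'a)"
proof (rule bounded_linear_intro)
  fix r :: real and x :: 'a
  have "c *\<^sub>C r *\<^sub>R x = (c * complex_of_real r) *\<^sub>C x"
    by (simp only: scaleC_of_real[symmetric] scaleC_scaleC)
  also have "\<dots> = (complex_of_real r * c) *\<^sub>C x"
    by (simp only: mult.commute)
  also have "\<dots> = r *\<^sub>R c *\<^sub>C x"
    by (simp only: scaleC_of_real[symmetric] scaleC_scaleC)
  finally show "c *\<^sub>C r *\<^sub>R x = r *\<^sub>R c *\<^sub>C x" .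
next
  fix x :: 'a show "norm (c *\<^sub>C x) \<le> norm x * cmod c"
    by (simp add: norm_scaleC)
qed (rule scaleC_add_right)

instantiation bcontfun :: (topological_space, complex_normed_vector) complex_normed_vector
begin

definition scaleC_bcontfun :: "complex \<Rightarrow> ('a \<Rightarrow>\<^sub>C 'b) \<Rightarrow> 'a \<Rightarrow>\<^sub>C 'b" where
  "scaleC_bcontfun c f = Bcontfun (\<lambda>x. c *\<^sub>C apply_bcontfun f x)"

lemma apply_scaleC_bcontfun: "apply_bcontfun (c *\<^sub>C f) x = c *\<^sub>C apply_bcontfun f x"
  for f :: "'a \<Rightarrow>\<^sub>C 'b"
proof -
  have "(\<lambda>x. c *\<^sub>C apply_bcontfun f x) \<in> bcontfun"
  proof (rule bcontfun_normI)
    show "continuous_on UNIV (\<lambda>x. c *\<^sub>C apply_bcontfun f x)"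
      by (intro bounded_linear.continuous_on[OF bounded_linear_scaleC]) simp
    show "norm (c *\<^sub>C apply_bcontfun f x) \<le> cmod c * norm f" for x
      by (simp add: norm_scaleC norm_bounded mult_left_mono)
  qed
  then show ?thesis
    by (simp add: scaleC_bcontfun_def Bcontfun_inverse)
qed

lemma norm_scaleC_bcontfun_le: "norm (c *\<^sub>C f) \<le> cmod c * norm f" for f :: "'a \<Rightarrow>\<^sub>C 'b"
  by (rule norm_bound) (simp add: apply_scaleC_bcontfun norm_scaleC norm_bounded mult_left_mono)

instance
proof
  fix c d :: complex and r :: real and f g :: "'a \<Rightarrow>\<^sub>C 'b"
  show "c *\<^sub>C (f + g) = c *\<^sub>C f + c *\<^sub>C g"
    by (rule bcontfun_eqI) (simp add: apply_scaleC_bcontfun scaleC_add_right)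
  show "(c + d) *\<^sub>C f = c *\<^sub>C f + d *\<^sub>C f"
    by (rule bcontfun_eqI) (simp add: apply_scaleC_bcontfun scaleC_add_left)
  show assoc: "c *\<^sub>C d *\<^sub>C f = (c * d) *\<^sub>C f" for c d
    by (rule bcontfun_eqI) (simp add: apply_scaleC_bcontfun scaleC_scaleC)
  show real: "complex_of_real r *\<^sub>C f = r *\<^sub>R f" for r
    by (rule bcontfun_eqI) (simp add: apply_scaleC_bcontfun scaleC_of_real)
  show "norm (c *\<^sub>C f) = cmod c * norm f"
  proof (cases "c = 0")
    case True
    then show ?thesis using norm_scaleC_bcontfun_le[of 0 f] by simp
  next
    case False
    have "norm f = norm (inverse c *\<^sub>C c *\<^sub>C f)"
      using False real[of 1] by (simp add: assoc)
    also have "\<dots> \<le> cmod (inverse c) * norm (c *\<^sub>C f)"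
      by (rule norm_scaleC_bcontfun_le)
    finally have "cmod c * norm f \<le> cmod c * (cmod (inverse c) * norm (c *\<^sub>C f))"
      by (rule mult_left_mono) simp
    also have "\<dots> = norm (c *\<^sub>C f)"
      using False by (simp add: norm_inverse)
    finally have "cmod c * norm f \<le> norm (c *\<^sub>C f)" .
    with norm_scaleC_bcontfun_le[of c f] show ?thesis by simp
  qed
qed

end

instance bcontfun :: (metric_space, complex_banach) complex_banach ..


section \<open>Operators between normed spaces given by a carrier and a norm\<close>

text \<open>In this section a normed space is a pair of a linear subspace \<open>V\<close> of a complex vector
  space and a norm \<open>N\<close> on \<open>V\<close>, in general not the norm of the ambient type. Functions are only
  relevant on the carrier.\<close>

definition bounded_op ::
  "'a::complex_vector set \<Rightarrow> ('a \<Rightarrow> real) \<Rightarrow> 'b::complex_vector set \<Rightarrow> ('b \<Rightarrow> real) \<Rightarrow> ('a \<Rightarrow> 'b) \<Rightarrow> bool"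
  where "bounded_op V N W M T \<longleftrightarrow>
    T ` V \<subseteq> W \<and>
    (\<forall>x\<in>V. \<forall>y\<in>V. T (x + y) = T x + T y) \<and>
    (\<forall>c. \<forall>x\<in>V. T (c *\<^sub>C x) = c *\<^sub>C T x) \<and>
    (\<exists>K. \<forall>x\<in>V. M (T x) \<le> K * N x)"

definition isomorphism ::
  "'a::complex_vector set \<Rightarrow> ('a \<Rightarrow> real) \<Rightarrow> 'b::complex_vector set \<Rightarrow> ('b \<Rightarrow> real) \<Rightarrow> ('a \<Rightarrow> 'b) \<Rightarrow> bool"
  where "isomorphism V N W M T \<longleftrightarrow>
    bij_betw T V W \<and> bounded_op V N W M T \<and> bounded_op W M V N (inv_into V T)"

definition isomorphic_spaces ::
  "'a::complex_vector set \<Rightarrow> ('a \<Rightarrow> real) \<Rightarrow> 'b::complex_vector set \<Rightarrow> ('b \<Rightarrow> real) \<Rightarrow> bool"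
  where "isomorphic_spaces V N W M \<longleftrightarrow> (\<exists>T. isomorphism V N W M T)"

definition closed_subspace ::
  "'a::complex_vector set \<Rightarrow> ('a \<Rightarrow> real) \<Rightarrow> 'a set \<Rightarrow> bool"
  where "closed_subspace V N Y \<longleftrightarrow>
    complex_vector.subspace Y \<and> Y \<subseteq> V \<and>
    (\<forall>x\<in>V. (\<forall>e>0. \<exists>y\<in>Y. N (x - y) < e) \<longrightarrow> x \<in> Y)"

definition complemented_subspace ::
  "'a::complex_vector set \<Rightarrow> ('a \<Rightarrow> real) \<Rightarrow> 'a set \<Rightarrow> bool"
  where "complemented_subspace V N Y \<longleftrightarrow>
    closed_subspace V N Y \<and>
    (\<exists>P. bounded_op V N V N P \<and> P ` V = Y \<and> (\<forall>y\<in>Y. P y = y))"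

definition infinite_dimensional :: "'a::complex_vector set \<Rightarrow> bool"
  where "infinite_dimensional Y \<longleftrightarrow> \<not> (\<exists>B. finite B \<and> Y \<subseteq> complex_vector.span B)"

definition strictly_singular ::
  "'a::complex_vector set \<Rightarrow> ('a \<Rightarrow> real) \<Rightarrow> ('b::complex_vector \<Rightarrow> real) \<Rightarrow> ('a \<Rightarrow> 'b) \<Rightarrow> bool"
  where "strictly_singular V N M T \<longleftrightarrow>
    (\<forall>Y. closed_subspace V N Y \<and> infinite_dimensional Y \<longrightarrow> \<not> isomorphism Y N (T ` Y) M T)"


section \<open>The couple of bounded and of absolutely summable sequences\<close>

text \<open>Since \<^typ>\<open>nat\<close> is discrete, this is the space of all bounded complex sequences with the
  supremum norm. As a set, it is also the sum of the couple.\<close>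

type_synonym ell_inf = "nat \<Rightarrow>\<^sub>C complex"

definition ell1 :: "ell_inf set"
  where "ell1 = {x :: ell_inf. summable (\<lambda>n. cmod (x n))}"

definition ell1_norm :: "ell_inf \<Rightarrow> real"
  where "ell1_norm x = (\<Sum>n. cmod (x n))"

definition sum_norm :: "ell_inf \<Rightarrow> real"
  where "sum_norm x = Inf {norm a + ell1_norm b |a b. x = a + b \<and> b \<in> ell1}"

text \<open>The norm of the sum of the couple is the supremum norm, so the topology and the norm of
  \<^typ>\<open>ell_inf\<close> can be used for the sum space.\<close>

lemma norm_le_ell1_norm:
  assumes "b \<in> ell1"
  shows "norm b \<le> ell1_norm b"
proof (rule norm_bound)
  fix n
  have "(\<Sum>k\<in>{n}. cmod (b k)) \<le> (\<Sum>k. cmod (b k))"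
    using assms by (intro sum_le_suminf) (auto simp: ell1_def)
  then show "cmod (b n) \<le> ell1_norm b"
    by (simp add: ell1_norm_def)
qed

lemma sum_norm_eq_norm: "sum_norm x = norm x"
  unfolding sum_norm_def
proof (rule cInf_eq_minimum)
  have "norm x = norm x + ell1_norm 0 \<and> x = x + 0 \<and> 0 \<in> ell1"
    by (simp add: ell1_norm_def ell1_def)
  then show "norm x \<in> {norm a + ell1_norm b |a b. x = a + b \<and> b \<in> ell1}"
    by blast
next
  fix y assume "y \<in> {norm a + ell1_norm b |a b. x = a + b \<and> b \<in> ell1}"
  then obtain a b where "y = norm a + ell1_norm b" "x = a + b" "b \<in> ell1"
    by blast
  then show "norm x \<le> y"
    using norm_triangle_ineq[of a b] norm_le_ell1_norm[of b] by simp
qed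


section \<open>Analytic functions with values in a complex normed space\<close>

definition has_cderiv :: "(complex \<Rightarrow> 'a::complex_normed_vector) \<Rightarrow> 'a \<Rightarrow> complex \<Rightarrow> bool"
  where "has_cderiv F D z \<longleftrightarrow> (F has_derivative (\<lambda>h. h *\<^sub>C D)) (at z)"

definition cderiv :: "(complex \<Rightarrow> 'a::complex_normed_vector) \<Rightarrow> complex \<Rightarrow> 'a"
  where "cderiv F z = (SOME D. has_cderiv F D z)"

lemma cderiv_eqI:
  assumes "has_cderiv F D z"
  shows "cderiv F z = D"
proof -
  have "has_cderiv F (cderiv F z) z"
    unfolding cderiv_def by (rule someI[of "\<lambda>D. has_cderiv F D z", OF assms])
  then have "(\<lambda>h. h *\<^sub>C cderiv F z) = (\<lambda>h. h *\<^sub>C D)"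
    using assms has_derivative_unique unfolding has_cderiv_def by blast
  then have "1 *\<^sub>C cderiv F z = 1 *\<^sub>C D"
    by (rule fun_cong)
  then show ?thesis by simp
qed


section \<open>The Calderon space and the third Rochberg space at 1/2\<close>

definition C0_into :: "ell_inf set \<Rightarrow> (ell_inf \<Rightarrow> real) \<Rightarrow> (real \<Rightarrow> ell_inf) \<Rightarrow> bool"
  where "C0_into X N f \<longleftrightarrow>
    range f \<subseteq> X \<and>
    (\<forall>t. ((\<lambda>s. N (f s - f t)) \<longlongrightarrow> 0) (at t)) \<and>
    ((\<lambda>t. N (f t)) \<longlongrightarrow> 0) at_infinity"

text \<open>The elements are represented by functions on the whole plane whose values outside the
  closed strip are irrelevant.\<close>

definition calderon :: "(complex \<Rightarrow> ell_inf) set"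
  where "calderon = {F.
    continuous_on {z. 0 \<le> Re z \<and> Re z \<le> 1} F \<and>
    bounded (F ` {z. 0 \<le> Re z \<and> Re z \<le> 1}) \<and>
    (\<forall>z. 0 < Re z \<and> Re z < 1 \<longrightarrow> (\<exists>D. has_cderiv F D z)) \<and>
    C0_into UNIV norm (\<lambda>t. F (Complex 0 t)) \<and>
    C0_into ell1 ell1_norm (\<lambda>t. F (Complex 1 t))}"

definition calderon_norm :: "(complex \<Rightarrow> ell_inf) \<Rightarrow> real"
  where "calderon_norm F =
    max (SUP t. norm (F (Complex 0 t))) (SUP t. ell1_norm (F (Complex 1 t)))"

definition Delta :: "nat \<Rightarrow> (complex \<Rightarrow> ell_inf) \<Rightarrow> ell_inf"
  where "Delta k F = (1 / fact k) *\<^sub>C (cderiv ^^ k) F (1/2)"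

definition Z3 :: "(ell_inf \<times> ell_inf \<times> ell_inf) set"
  where "Z3 = {(Delta 2 F, Delta 1 F, Delta 0 F) |F. F \<in> calderon}"

definition Z3_norm :: "ell_inf \<times> ell_inf \<times> ell_inf \<Rightarrow> real"
  where "Z3_norm x =
    Inf {calderon_norm F |F. F \<in> calderon \<and> (Delta 2 F, Delta 1 F, Delta 0 F) = x}"

end

theory Submission
  imports Defs "HOL-Complex_Analysis.Complex_Analysis"
begin

text \<open>Truncations are dense in the Calderon space: the boundary values on the line \<open>Re z = 1\<close> lie
  in \<open>c\<^sub>0\<close>, hence by the three lines theorem so do all values of its elements. Everything can therefore
  be done with finitely supported blocks. If \<open>u\<^sub>n\<close> are disjoint blocks that are normalised in
  \<open>\<ell>\<^sub>2\<close>, the analytic family \<open>e\<^sub>n \<mapsto> sgn u\<^sub>n \<bar>u\<^sub>n\<bar>\<^sup>2\<^sup>z\<close> induces an isometry of \<open>Z\<^sub>3\<close> onto a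
  complemented copy of \<open>Z\<^sub>3\<close> which maps \<open>(e\<^sub>n, 0, 0)\<close> to \<open>(u\<^sub>n, 0, 0)\<close>.

  The quotient map of \<open>Z\<^sub>3\<close> that kills the copy of \<open>\<ell>\<^sub>2\<close> consisting of the triples \<open>(x, 0, 0)\<close> is
  strictly singular along blocks: a sum of \<open>n\<close> normalised blocks whose last entries (or whose
  middle entries, if the last ones vanish) are bounded below in \<open>\<ell>\<^sub>2\<close> has norm at least of order
  \<open>\<surd>n (ln n)\<^sup>2\<close> (respectively \<open>\<surd>n ln n\<close>), while the \<open>\<ell>\<^sub>2\<close>-norm of these entries only grows like \<open>\<surd>n\<close>.
  Hence a subspace on which \<open>\<tau>\<close> is bounded below contains almost \<open>\<ell>\<^sub>2\<close>-blocks \<open>u\<^sub>n\<close>, so that \<open>\<tau>\<close>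
  composed with the block isometry is bounded below on \<open>\<ell>\<^sub>2\<close>. By the same strict singularity the
  composition is bounded below on the vectors of \<open>Z\<^sub>3\<close> that are supported far enough out.\<close>

subsection \<open>Scalar functions on the strip\<close>

text \<open>The norm of \<open>Z3\<close> is an infimum over analytic functions and not accessible
  directly, so every estimate goes through one device: a matrix with entries
  \<open>c * exp (l * (z - 1/2))\<close> that is contractive on both boundary lines acts on the
  Calderon space and hence on the triples of Taylor coefficients. Truncation, shift, block operators
  and their left inverses, lifts of a given entry and the functionals behind the lower bounds are
  all obtained from it. So are the logarithms: replacing a weight \<open>w\<close> by
  \<open>w / sqrt n\<close> adds \<open>ln n\<close> to the exponent \<open>- 2 * ln |w|\<close>,
  and the Taylor coefficients bring in powers of \<open>ln n\<close>.

  The search for \<open>l2\<close> blocks is stated for an arbitrary approximate condition because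
  it is used twice: for closeness to a subspace on which \<tau> is bounded below, and, in a proof by
  contradiction, for having a small image under the composed operator. The second use carries the
  lower bound from triples \<open>(x, 0, 0)\<close>, on which the block isometry is a plain linear
  substitution, to all triples supported far out; a shift into that tail yields the copy.\<close>

definition strip :: "complex set"
  where "strip = {z. 0 \<le> Re z \<and> Re z \<le> 1}"

definition ostrip :: "complex set"
  where "ostrip = {z. 0 < Re z \<and> Re z < 1}"

lemma open_ostrip: "open ostrip"
proof -
  have "ostrip = {z. 0 < Re z} \<inter> {z. Re z < 1}"
    by (auto simp: ostrip_def)
  then show ?thesis
    by (metis open_Int open_halfspace_Re_gt open_halfspace_Re_lt)
qed

lemma ostrip_subset_strip: "ostrip \<subseteq> strip"
  by (auto simp: strip_def ostrip_def)

lemma half_in_ostrip: "1/2 \<in> ostrip"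
  by (simp add: ostrip_def)

lemma Complex_in_strip: "0 \<le> s \<Longrightarrow> s \<le> 1 \<Longrightarrow> Complex s t \<in> strip"
  by (simp add: strip_def)

lemma norm_exp_sq: "cmod (exp (complex_of_real e * z\<^sup>2)) = exp (e * ((Re z)\<^sup>2 - (Im z)\<^sup>2))"
  unfolding norm_exp_eq_Re by (simp only: Re_power2 Re_complex_of_real Im_complex_of_real times_complex.sel) simp

text \<open>The factor \<open>exp (e * z\<^sup>2)\<close> decays along the strip and costs at most
  \<open>exp e\<close> in modulus, so the maximum principle on a tall box applies; then
  \<open>e\<close> tends to 0.\<close>

lemma strip_maximum_modulus:
  assumes cont: "continuous_on strip f" and holo: "f holomorphic_on ostrip"
    and bd: "bounded (f ` strip)"
    and b0: "\<And>t. cmod (f (Complex 0 t)) \<le> B" and b1: "\<And>t. cmod (f (Complex 1 t)) \<le> B"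
    and z: "z \<in> strip"
  shows "cmod (f z) \<le> B"
proof -
  have B0: "0 \<le> B"
    using b0[of 0] norm_ge_zero order_trans by blast
  obtain M where M: "\<And>w. w \<in> strip \<Longrightarrow> cmod (f w) \<le> M"
    using bd unfolding bounded_iff by auto
  have M0: "0 \<le> M"
    using M[OF z] norm_ge_zero order_trans by blast
  have damped: "cmod (f z) * exp (e * ((Re z)\<^sup>2 - (Im z)\<^sup>2)) \<le> B * exp e" if e: "e > 0" for e :: real
  proof -
    define g where "g w = f w * exp (complex_of_real e * w\<^sup>2)" for w
    have ng: "cmod (g w) = cmod (f w) * exp (e * ((Re w)\<^sup>2 - (Im w)\<^sup>2))" for w
      by (simp add: g_def norm_mult norm_exp_sq del: norm_exp_eq_Re)
    \<comment> \<open>A bound strictly above \<open>B\<close> leaves room for the horizontal sides,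
      where only \<open>M * exp (e - e * R\<^sup>2)\<close> is available; \<open>B\<close> itself
      may be 0.\<close>
    have bound: "cmod (g z) \<le> B' * exp e" if B': "B' > B" for B'
    proof -
      have "((\<lambda>R::real. M * exp (e - e * R\<^sup>2)) \<longlongrightarrow> 0) at_top"
        using e by real_asymp
      then have "\<forall>\<^sub>F R in at_top. M * exp (e - e * R\<^sup>2) < B' * exp e"
        using that B0 by (intro order_tendstoD(2)) auto
      moreover have "\<forall>\<^sub>F R in at_top. R > max 1 \<bar>Im z\<bar>"
        by (rule eventually_gt_at_top)
      ultimately obtain R where R: "M * exp (e - e * R\<^sup>2) < B' * exp e" "R > max 1 \<bar>Im z\<bar>"
        by (metis (mono_tags, lifting) eventually_conj eventually_happens trivial_limit_at_top_linorder)
      define Q where "Q = cbox (Complex 0 (-R)) (Complex 1 R)"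
      have Qs: "Q \<subseteq> strip"
        by (auto simp: Q_def strip_def in_cbox_complex_iff)
      have intQ: "interior Q = box (Complex 0 (-R)) (Complex 1 R)"
        by (simp add: Q_def)
      have boxs: "box (Complex 0 (-R)) (Complex 1 R) \<subseteq> ostrip"
        by (auto simp: ostrip_def in_box_complex_iff)
      show ?thesis
      proof (rule maximum_modulus_frontier[of g Q])
        show "g holomorphic_on interior Q"
          unfolding intQ g_def
          by (intro holomorphic_intros holomorphic_on_subset[OF holo boxs])
        have "closure Q = Q" by (simp add: Q_def)
        then show "continuous_on (closure Q) g"
          unfolding g_def
          using continuous_on_subset[OF cont Qs] by (auto intro!: continuous_intros)
        show "bounded Q" by (simp add: Q_def)
        show "z \<in> Q"
          using z R by (auto simp: Q_def strip_def in_cbox_complex_iff)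
      next
        fix w assume "w \<in> frontier Q"
        then have wQ: "w \<in> Q" and "w \<notin> box (Complex 0 (-R)) (Complex 1 R)"
          by (auto simp: Q_def frontier_cbox)
        then consider "Re w = 0" | "Re w = 1" | "\<bar>Im w\<bar> = R"
          by (auto simp: Q_def in_cbox_complex_iff in_box_complex_iff)
        then show "cmod (g w) \<le> B' * exp e"
        proof cases
          case 1
          then have "cmod (f w) \<le> B" using b0[of "Im w"] by (metis complex.collapse)
          moreover have "exp (e * ((Re w)\<^sup>2 - (Im w)\<^sup>2)) \<le> exp e"
            using 1 e by (simp add: order_trans[of _ 0])
          ultimately show ?thesis
            unfolding ng using B' B0 by (intro mult_mono) auto
        next
          case 2
          then have "cmod (f w) \<le> B" using b1[of "Im w"] by (metis complex.collapse)
          moreover have "exp (e * ((Re w)\<^sup>2 - (Im w)\<^sup>2)) \<le> exp e"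
            using 2 e by simp
          ultimately show ?thesis
            unfolding ng using B' B0 by (intro mult_mono) auto
        next
          case 3
          have "\<bar>Re w\<bar> \<le> 1" using wQ Qs by (auto simp: strip_def)
          then have "(Re w)\<^sup>2 \<le> 1" by (simp add: abs_square_le_1)
          moreover have "(Im w)\<^sup>2 = R\<^sup>2" using 3 by (metis power2_abs)
          ultimately have "e * ((Re w)\<^sup>2 - (Im w)\<^sup>2) \<le> e * (1 - R\<^sup>2)"
            using e by (intro mult_left_mono) auto
          then have "exp (e * ((Re w)\<^sup>2 - (Im w)\<^sup>2)) \<le> exp (e - e * R\<^sup>2)"
            by (simp add: algebra_simps)
          moreover have "cmod (f w) \<le> M" using M wQ Qs by auto
          ultimately have "cmod (g w) \<le> M * exp (e - e * R\<^sup>2)"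
            unfolding ng using M0 by (intro mult_mono) auto
          with R show ?thesis by linarith
        qed
      qed
    qed
    have "cmod (g z) \<le> B * exp e"
    proof (rule field_le_epsilon)
      fix d :: real assume "d > 0"
      then have "cmod (g z) \<le> (B + d / exp e) * exp e"
        by (intro bound) simp
      then show "cmod (g z) \<le> B * exp e + d" by (simp add: algebra_simps)
    qed
    then show ?thesis by (simp add: ng)
  qed
  have l1: "((\<lambda>e. cmod (f z) * exp (e * ((Re z)\<^sup>2 - (Im z)\<^sup>2))) \<longlongrightarrow> cmod (f z) * exp (0 * ((Re z)\<^sup>2 - (Im z)\<^sup>2))) (at_right (0::real))"
    by (intro tendsto_intros)
  have l2: "((\<lambda>e. B * exp e) \<longlongrightarrow> B * exp 0) (at_right (0::real))"
    by (intro tendsto_intros)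
  have "\<forall>\<^sub>F e in at_right (0::real). cmod (f z) * exp (e * ((Re z)\<^sup>2 - (Im z)\<^sup>2)) \<le> B * exp e"
    using eventually_at_right_less by eventually_elim (rule damped)
  from tendsto_le[OF _ l2 l1 this] show ?thesis by simp
qed

text \<open>The factor \<open>exp (l * w)\<close> with \<open>l = ln (A / B)\<close> gives both
  lines the bound \<open>A\<close>, which reduces the claim to the maximum principle.\<close>

lemma three_lines:
  assumes cont: "continuous_on strip f" and holo: "f holomorphic_on ostrip"
    and bd: "bounded (f ` strip)" and A: "A > 0" and B: "B > 0"
    and b0: "\<And>t. cmod (f (Complex 0 t)) \<le> A" and b1: "\<And>t. cmod (f (Complex 1 t)) \<le> B"
    and z: "z \<in> strip"
  shows "cmod (f z) \<le> A * (B / A) powr Re z"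
proof -
  define l where "l = ln (A / B)"
  define g where "g w = f w * exp (complex_of_real l * w)" for w
  have ng: "cmod (g w) = cmod (f w) * exp (l * Re w)" for w
    by (simp add: g_def norm_mult)
  obtain M where M: "\<And>w. w \<in> strip \<Longrightarrow> cmod (f w) \<le> M"
    using bd unfolding bounded_iff by auto
  have "cmod (g z) \<le> A"
  proof (rule strip_maximum_modulus[of g])
    show "continuous_on strip g" unfolding g_def by (intro continuous_intros cont)
    show "g holomorphic_on ostrip" unfolding g_def by (intro holomorphic_intros holo)
    show "z \<in> strip" by fact
    show "bounded (g ` strip)"
      unfolding bounded_iff
    proof (intro exI ballI)
      fix y assume "y \<in> g ` strip"
      then obtain w where w: "w \<in> strip" "y = g w" by auto
      have "0 \<le> Re w" "Re w \<le> 1" using w(1) by (auto simp: strip_def)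
      then have "\<bar>l * Re w\<bar> \<le> \<bar>l\<bar>" by (simp add: abs_mult mult_left_le)
      then have e: "exp (l * Re w) \<le> exp \<bar>l\<bar>" by simp
      have "0 \<le> M" using M[OF w(1)] norm_ge_zero order_trans by blast
      then show "norm y \<le> M * exp \<bar>l\<bar>"
        unfolding w(2) ng using M[OF w(1)] e by (intro mult_mono) simp_all
    qed
    show "cmod (g (Complex 0 t)) \<le> A" for t using b0[of t] by (simp add: ng)
    show "cmod (g (Complex 1 t)) \<le> A" for t
    proof -
      have "exp l = A / B" using A B by (simp add: l_def)
      then show ?thesis using b1[of t] A B by (simp add: ng pos_divide_le_eq)
    qed
  qed
  then have "cmod (f z) \<le> A * exp (- (l * Re z))"
    by (simp add: ng exp_minus divide_inverse[symmetric] pos_le_divide_eq)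
  also have "exp (- (l * Re z)) = (B / A) powr Re z"
    using A B by (simp add: powr_def l_def ln_div algebra_simps)
  finally show ?thesis .
qed

text \<open>Scalar functions in the Calderon space of the couple of two copies of the scalar field.\<close>

definition scal :: "(complex \<Rightarrow> complex) \<Rightarrow> bool" where
  "scal f \<longleftrightarrow> continuous_on strip f \<and> f holomorphic_on ostrip \<and> bounded (f ` strip) \<and>
    ((\<lambda>t. f (Complex 0 t)) \<longlongrightarrow> 0) at_infinity \<and> ((\<lambda>t. f (Complex 1 t)) \<longlongrightarrow> 0) at_infinity"

lemma scal_zero [simp]: "scal (\<lambda>z. 0)"
  by (auto simp: scal_def bounded_iff)

lemma scal_add: "scal f \<Longrightarrow> scal g \<Longrightarrow> scal (\<lambda>z. f z + g z)"
  unfolding scal_def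
  by (intro conjI continuous_on_add holomorphic_on_add bounded_plus_comp tendsto_add_zero) auto

lemma bounded_strip_multiplier_tendsto:
  assumes "bounded (g ` strip)" "0 \<le> s" "s \<le> 1" "((\<lambda>t. f (Complex s t)) \<longlongrightarrow> (0::complex)) at_infinity"
  shows "((\<lambda>t. g (Complex s t) * f (Complex s t)) \<longlongrightarrow> (0::complex)) at_infinity"
proof -
  obtain M where M: "\<And>w. w \<in> strip \<Longrightarrow> cmod (g w) \<le> M"
    using assms unfolding bounded_iff by auto
  show ?thesis
  proof (rule Lim_null_comparison)
    show "\<forall>\<^sub>F t in at_infinity. norm (g (Complex s t) * f (Complex s t)) \<le> M * norm (f (Complex s t))"
      using M assms by (intro always_eventually allI) (auto simp: norm_mult Complex_in_strip intro!: mult_right_mono)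
    show "((\<lambda>t. M * norm (f (Complex s t))) \<longlongrightarrow> 0) at_infinity"
      using tendsto_mult_right_zero[OF tendsto_norm_zero[OF assms(4)]] by simp
  qed
qed

lemma scal_mult:
  assumes "continuous_on strip g" "g holomorphic_on ostrip" "bounded (g ` strip)" "scal f"
  shows "scal (\<lambda>z. g z * f z)"
  unfolding scal_def
proof (intro conjI)
  have f: "continuous_on strip f" "f holomorphic_on ostrip" "bounded (f ` strip)"
    using assms(4) by (auto simp: scal_def)
  show "continuous_on strip (\<lambda>z. g z * f z)" "(\<lambda>z. g z * f z) holomorphic_on ostrip"
    using assms f by (auto intro!: continuous_on_mult holomorphic_on_mult)
  obtain M L where "\<And>w. w \<in> strip \<Longrightarrow> cmod (g w) \<le> M" "\<And>w. w \<in> strip \<Longrightarrow> cmod (f w) \<le> L"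
    using assms(3) f(3) unfolding bounded_iff by auto
  then have "cmod (g w * f w) \<le> M * L" if "w \<in> strip" for w
    unfolding norm_mult using that norm_ge_zero order_trans by (intro mult_mono) blast+
  then show "bounded ((\<lambda>z. g z * f z) ` strip)"
    unfolding bounded_iff by blast
  show "((\<lambda>t. g (Complex 0 t) * f (Complex 0 t)) \<longlongrightarrow> 0) at_infinity"
    "((\<lambda>t. g (Complex 1 t) * f (Complex 1 t)) \<longlongrightarrow> 0) at_infinity"
    using assms by (auto simp: scal_def intro!: bounded_strip_multiplier_tendsto)
qed

lemma scal_cmult: "scal f \<Longrightarrow> scal (\<lambda>z. c * f z)"
  by (rule scal_mult[of "\<lambda>_. c"]) (auto simp: bounded_iff)

lemma scal_sum: "(\<And>i. i \<in> I \<Longrightarrow> scal (f i)) \<Longrightarrow> scal (\<lambda>z. \<Sum>i\<in>I. f i z)"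
  by (induction I rule: infinite_finite_induct) (auto intro: scal_add)

lemma bounded_exp_strip: "bounded ((\<lambda>z. exp (complex_of_real l * (z - 1/2))) ` strip)"
  unfolding bounded_iff
proof (intro exI ballI)
  fix y assume "y \<in> (\<lambda>z. exp (complex_of_real l * (z - 1/2))) ` strip"
  then obtain z where z: "z \<in> strip" "y = exp (complex_of_real l * (z - 1/2))" by auto
  have "\<bar>l * (Re z - 1/2)\<bar> \<le> \<bar>l\<bar> * 1"
    unfolding abs_mult using z by (intro mult_left_mono) (auto simp: strip_def abs_if)
  then have "l * (Re z - 1/2) \<le> \<bar>l\<bar>" by linarith
  then show "norm y \<le> exp \<bar>l\<bar>" unfolding z(2) norm_exp_eq_Re by simp
qed

lemma scal_exp: "scal f \<Longrightarrow> scal (\<lambda>z. c * exp (complex_of_real l * (z - 1/2)) * f z)"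
  unfolding mult.assoc
  by (intro scal_cmult scal_mult bounded_exp_strip continuous_intros holomorphic_intros)

lemma norm_gauss:
  "cmod ((z - 1/2)^i * exp ((z - 1/2)\<^sup>2)) = cmod (z - 1/2) ^ i * exp ((Re z - 1/2)\<^sup>2 - (Im z)\<^sup>2)"
  unfolding norm_mult norm_power norm_exp_eq_Re Re_power2 by simp

lemma norm_gauss_le:
  assumes "z \<in> strip" "i \<le> 2"
  shows "cmod ((z - 1/2)^i * exp ((z - 1/2)\<^sup>2)) \<le> 2"
proof -
  define r where "r = cmod (z - 1/2)"
  have r0: "r \<ge> 0" by (simp add: r_def)
  have r2: "r\<^sup>2 = (Re z - 1/2)\<^sup>2 + (Im z)\<^sup>2"
    by (simp add: r_def cmod_power2)
  have "\<bar>Re z - 1/2\<bar> \<le> 1/2" using assms by (auto simp: strip_def abs_if)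
  then have "(Re z - 1/2)\<^sup>2 \<le> (1/2)\<^sup>2"
    by (metis abs_le_square_iff abs_of_nonneg zero_le_divide_1_iff zero_le_numeral)
  then have "(Re z - 1/2)\<^sup>2 - (Im z)\<^sup>2 \<le> 1/2 - r\<^sup>2"
    unfolding r2 by (simp add: power2_eq_square)
  then have "cmod ((z - 1/2)^i * exp ((z - 1/2)\<^sup>2)) \<le> r ^ i * exp (1/2 - r\<^sup>2)"
    unfolding norm_gauss r_def[symmetric] using r0 by (intro mult_left_mono) auto
  also have "\<dots> = exp (1/2) * (r ^ i * exp (- r\<^sup>2))"
    by (simp add: diff_conv_add_uminus exp_add del: add_uminus_conv_diff)
  also have "r ^ i * exp (- r\<^sup>2) \<le> 1"
  proof -
    have "r ^ i \<le> 1 + r\<^sup>2"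
    proof -
      consider "i = 0" | "i = 1" | "i = 2" using assms(2) by linarith
      then show ?thesis
      proof cases
        case 2
        have "0 \<le> (r - 1)\<^sup>2" by simp
        then have "2 * r \<le> 1 + r\<^sup>2" by (simp add: power2_eq_square algebra_simps)
        with r0 2 show ?thesis by simp
      qed auto
    qed
    also have "1 + r\<^sup>2 \<le> exp (r\<^sup>2)" by (rule exp_ge_add_one_self)
    finally show ?thesis by (simp add: exp_minus divide_inverse[symmetric] pos_divide_le_eq)
  qed
  also have "exp (1/2) \<le> (2::real)"
  proof -
    have "exp (1/2::real) ^ 2 = exp 1" by (simp add: power2_eq_square flip: exp_add)
    also have "\<dots> \<le> 3" using exp_le by simp
    also have "\<dots> \<le> 2 ^ 2" by simp
    finally show ?thesis by (rule power2_le_imp_le) simp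
  qed
  finally show ?thesis by simp
qed

text \<open>Powers of \<open>z - 1/2\<close> have prescribed Taylor coefficients at 1/2 but grow
  along the strip; the Gaussian supplies decay at infinity and leaves the coefficients up to order
  \<open>i\<close> unchanged (\<open>jet_gauss\<close>).\<close>

lemma scal_gauss:
  assumes "i \<le> 2"
  shows "scal (\<lambda>z. (z - 1/2)^i * exp ((z - 1/2)\<^sup>2))"
proof -
  have "((\<lambda>t. (Complex s t - 1/2)^i * exp ((Complex s t - 1/2)\<^sup>2)) \<longlongrightarrow> 0) at_infinity" for s
  proof (rule tendsto_norm_zero_cancel)
    have *: "((\<lambda>t. (\<bar>s\<bar> + 1/2 + t) ^ i * exp ((s - 1/2)\<^sup>2 - t\<^sup>2)) \<longlongrightarrow> 0) at_top"
      by real_asymp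
    have "((\<lambda>t. (\<bar>s\<bar> + 1/2 + norm t) ^ i * exp ((s - 1/2)\<^sup>2 - (norm t)\<^sup>2)) \<longlongrightarrow> 0) (at_infinity :: real filter)"
      by (rule filterlim_compose[OF *]) (rule filterlim_norm_at_top)
    then show "((\<lambda>t. cmod ((Complex s t - 1/2)^i * exp ((Complex s t - 1/2)\<^sup>2))) \<longlongrightarrow> 0) at_infinity"
    proof (rule Lim_null_comparison[rotated], intro always_eventually allI)
      fix t :: real
      have "cmod (Complex s t - 1/2) \<le> cmod (Complex s t) + cmod (1/2)"
        by (rule norm_triangle_ineq4)
      also have "cmod (Complex s t) \<le> \<bar>s\<bar> + \<bar>t\<bar>"
        using cmod_le[of "Complex s t"] by simp
      finally have "cmod (Complex s t - 1/2) \<le> \<bar>s\<bar> + 1/2 + norm t" by simp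
      then show "norm (cmod ((Complex s t - 1/2)^i * exp ((Complex s t - 1/2)\<^sup>2)))
          \<le> (\<bar>s\<bar> + 1/2 + norm t) ^ i * exp ((s - 1/2)\<^sup>2 - (norm t)\<^sup>2)"
        unfolding norm_gauss by (simp add: mult_right_mono power_mono)
    qed
  qed
  then show ?thesis
    unfolding scal_def bounded_iff using norm_gauss_le[OF _ assms]
    by (auto intro!: continuous_intros holomorphic_intros exI[of _ 2])
qed

subsection \<open>Taylor coefficients at 1/2\<close>

definition jet :: "nat \<Rightarrow> (complex \<Rightarrow> complex) \<Rightarrow> complex" where
  "jet k f = (deriv ^^ k) f (1/2) / fact k"

text \<open>Division by the factorials turns the Leibniz rule into a Cauchy product.\<close>

lemma jet_mult:
  assumes "f holomorphic_on ostrip" "g holomorphic_on ostrip"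
  shows "jet k (\<lambda>z. f z * g z) = (\<Sum>i\<le>k. jet i f * jet (k - i) g)"
  unfolding jet_def higher_deriv_mult[OF assms open_ostrip half_in_ostrip] sum_divide_distrib
    atMost_atLeast0
  by (intro sum.cong refl) (auto simp: binomial_fact field_simps)

lemma jet_cong:
  assumes "\<And>z. z \<in> ostrip \<Longrightarrow> f z = g z"
  shows "jet k f = jet k g"
proof -
  have "\<forall>\<^sub>F z in nhds (1/2). f z = g z"
    unfolding eventually_nhds using open_ostrip half_in_ostrip assms by blast
  then have "(deriv ^^ k) f (1/2) = (deriv ^^ k) g (1/2)"
    by (rule higher_deriv_cong_ev) simp
  then show ?thesis by (simp add: jet_def)
qed

lemma jet_zero [simp]: "jet k (\<lambda>z. 0) = 0"
  by (simp add: jet_def)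

lemma jet_add:
  "f holomorphic_on ostrip \<Longrightarrow> g holomorphic_on ostrip \<Longrightarrow>
    jet k (\<lambda>z. f z + g z) = jet k f + jet k g"
  unfolding jet_def by (subst higher_deriv_add[OF _ _ open_ostrip half_in_ostrip]) (auto simp: add_divide_distrib)

lemma jet_sum:
  assumes "finite I" "\<And>i. i \<in> I \<Longrightarrow> f i holomorphic_on ostrip"
  shows "jet k (\<lambda>z. \<Sum>i\<in>I. f i z) = (\<Sum>i\<in>I. jet k (f i))"
  using assms by (induction I rule: finite_induct) (simp_all add: jet_add holomorphic_on_sum)

lemma jet_cmult: "f holomorphic_on ostrip \<Longrightarrow> jet k (\<lambda>z. c * f z) = c * jet k f"
  unfolding jet_def by (subst higher_deriv_cmult[OF _ half_in_ostrip open_ostrip]) auto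

lemma jet_exp: "jet k (\<lambda>z. exp (c * (z - 1/2))) = c ^ k / fact k"
proof -
  have "(deriv ^^ k) (\<lambda>z. exp (c * (z - 1/2))) = (\<lambda>z. c ^ k * exp (c * (z - 1/2)))"
  proof (induction k)
    case (Suc k)
    have "deriv (\<lambda>z. c ^ k * exp (c * (z - 1/2))) z = c ^ Suc k * exp (c * (z - 1/2))" for z
      by (rule DERIV_imp_deriv) (auto intro!: derivative_eq_intros)
    then show ?case using Suc by auto
  qed auto
  then show ?thesis by (simp add: jet_def)
qed

lemma jet_exp_mult:
  assumes "f holomorphic_on ostrip"
  shows "jet k (\<lambda>z. c * exp (complex_of_real l * (z - 1/2)) * f z)
    = c * (\<Sum>i\<le>k. (complex_of_real l ^ i / fact i) * jet (k - i) f)"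
proof -
  have "jet k (\<lambda>z. c * (exp (complex_of_real l * (z - 1/2)) * f z))
      = c * jet k (\<lambda>z. exp (complex_of_real l * (z - 1/2)) * f z)"
    by (rule jet_cmult) (intro holomorphic_intros assms)
  also have "jet k (\<lambda>z. exp (complex_of_real l * (z - 1/2)) * f z) = (\<Sum>i\<le>k. (complex_of_real l ^ i / fact i) * jet (k - i) f)"
    by (subst jet_mult) (auto intro!: holomorphic_intros assms simp: jet_exp)
  finally show ?thesis by (simp add: mult.assoc)
qed

text \<open>Multiplication by \<open>z - 1/2\<close> moves every Taylor coefficient up by one order,
  so induction on \<open>i\<close> ends at the value 1 of the Gaussian at 1/2.\<close>

lemma jet_gauss:
  assumes "k \<le> i"
  shows "jet k (\<lambda>z. (z - 1/2)^i * exp ((z - 1/2)\<^sup>2)) = (if k = i then 1 else 0)"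
  using assms
proof (induction i arbitrary: k)
  case 0
  then show ?case by (simp add: jet_def)
next
  case (Suc i)
  define g where "g = (\<lambda>z::complex. (z - 1/2)^i * exp ((z - 1/2)\<^sup>2))"
  have id: "jet j (\<lambda>z. z - 1/2) = (if j = 1 then 1 else 0)" for j
  proof -
    have "deriv (\<lambda>z::complex. z - 1/2) = (\<lambda>z. 1)"
      by (intro ext DERIV_imp_deriv) (auto intro!: derivative_eq_intros)
    moreover have "(deriv ^^ n) (\<lambda>z::complex. 1) = (\<lambda>z. if n = 0 then 1 else 0)" for n
      by (induction n) auto
    ultimately show ?thesis
      by (cases j) (simp_all add: jet_def funpow_Suc_right del: funpow.simps)
  qed
  have "jet k (\<lambda>z. (z - 1/2)^Suc i * exp ((z - 1/2)\<^sup>2)) = jet k (\<lambda>z. (z - 1/2) * g z)"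
    by (simp add: g_def mult.assoc)
  also have "\<dots> = (\<Sum>j\<le>k. jet j (\<lambda>z. z - 1/2) * jet (k - j) g)"
    by (rule jet_mult) (auto simp: g_def intro!: holomorphic_intros)
  also have "\<dots> = (\<Sum>j\<le>k. if j = 1 then jet (k - 1) g else 0)"
    by (intro sum.cong) (auto simp: id)
  also have "\<dots> = (if 1 \<le> k then jet (k - 1) g else 0)"
    by simp
  finally show ?case
    using Suc.IH[of "k - 1"] Suc.prems by (auto simp: g_def)
qed

text \<open>Cauchy's estimate on the disc of radius 1/2 about 1/2, the largest one in the strip;
  hence the factor \<open>2 ^ k\<close>. The disc touches both boundary lines, so continuity up to
  the boundary enters.\<close>

lemma jet_bound:
  assumes "scal f" and b0: "\<And>t. cmod (f (Complex 0 t)) \<le> B" and b1: "\<And>t. cmod (f (Complex 1 t)) \<le> B"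
  shows "cmod (jet k f) \<le> 2 ^ k * B"
proof -
  have sub: "cball (1/2) (1/2) \<subseteq> strip"
  proof
    fix z :: complex assume "z \<in> cball (1/2) (1/2)"
    then have "cmod (1/2 - z) \<le> 1/2" by (simp add: dist_norm)
    then have "\<bar>Re (1/2 - z)\<bar> \<le> 1/2" using abs_Re_le_cmod order_trans by blast
    then show "z \<in> strip" by (simp add: strip_def abs_if split: if_splits)
  qed
  have subo: "ball (1/2) (1/2) \<subseteq> ostrip"
  proof
    fix z :: complex assume "z \<in> ball (1/2) (1/2)"
    then have "cmod (1/2 - z) < 1/2" by (simp add: dist_norm)
    then have "\<bar>Re (1/2 - z)\<bar> < 1/2" using abs_Re_le_cmod le_less_trans by blast
    then show "z \<in> ostrip" by (simp add: ostrip_def abs_if split: if_splits)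
  qed
  have f: "continuous_on strip f" "f holomorphic_on ostrip" "bounded (f ` strip)"
    using assms(1) by (auto simp: scal_def)
  have "norm ((deriv ^^ k) f (1/2)) \<le> (fact k) * B / (1/2)^k"
  proof (rule Cauchy_inequality)
    show "f holomorphic_on ball (1/2) (1/2)" using f subo holomorphic_on_subset by blast
    show "continuous_on (cball (1/2) (1/2)) f" using f sub continuous_on_subset by blast
    fix x :: complex assume "norm (1/2 - x) = 1/2"
    then have "x \<in> strip" using sub by (auto simp: dist_norm)
    then show "cmod (f x) \<le> B"
      by (rule strip_maximum_modulus[OF f b0 b1])
  qed simp
  then show ?thesis
    by (simp add: jet_def norm_divide field_simps)
qed

subsection \<open>Coordinates of analytic sequence-valued functions\<close>

lemma apply_Bcontfun_nat:
  fixes g :: "nat \<Rightarrow> complex"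
  assumes "\<And>j. cmod (g j) \<le> K"
  shows "apply_bcontfun (Bcontfun g) = g"
  by (rule Bcontfun_inverse) (rule bcontfun_normI[OF _ assms], simp)

lemma bounded_linear_apply_bcontfun: "bounded_linear (\<lambda>x :: ell_inf. apply_bcontfun x j)"
  by (rule bounded_linear_intro[of _ 1]) (auto simp: norm_bounded)

lemma bounded_linear_scaleC_left: "bounded_linear (\<lambda>h. h *\<^sub>C D)"
  for D :: "'a::complex_normed_vector"
proof (rule bounded_linear_intro[of _ "norm D"])
  show "(r *\<^sub>R h) *\<^sub>C D = r *\<^sub>R h *\<^sub>C D" for r h
    unfolding scaleR_conv_of_real scaleC_of_real[symmetric] scaleC_scaleC ..
qed (simp_all add: scaleC_add_left norm_scaleC)

lemma has_cderiv_coord: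
  fixes F :: "complex \<Rightarrow> ell_inf"
  assumes "has_cderiv F D z"
  shows "((\<lambda>w. F w j) has_field_derivative D j) (at z)"
proof -
  have "((\<lambda>w. F w j) has_derivative (\<lambda>h. apply_bcontfun (h *\<^sub>C D) j)) (at z)"
    using bounded_linear.has_derivative[OF bounded_linear_apply_bcontfun] assms
    unfolding has_cderiv_def by blast
  moreover have "(\<lambda>h. apply_bcontfun (h *\<^sub>C D) j) = (*) (D j)"
    by (simp add: fun_eq_iff apply_scaleC_bcontfun scaleC_complex_def)
  ultimately show ?thesis
    by (simp add: has_field_derivative_def)
qed

text \<open>The circle of radius \<open>r/4\<close> about a point of the half ball stays in the
  ball. The bound depends on \<open>g\<close> only through \<open>M\<close>, which makes it uniform
  over all coordinates.\<close>

lemma deriv_bound: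
  assumes "g holomorphic_on ball z r" "\<And>w. w \<in> ball z r \<Longrightarrow> cmod (g w) \<le> M"
    and "0 < r" "w \<in> ball z (r/2)"
  shows "cmod ((deriv ^^ k) g w) \<le> fact k * M / (r/4) ^ k"
proof (rule Cauchy_inequality)
  have sub: "cball w (r/4) \<subseteq> ball z r"
  proof
    fix x assume "x \<in> cball w (r/4)"
    then show "x \<in> ball z r"
      using assms(3,4) dist_triangle[of z x w] by auto
  qed
  then show "g holomorphic_on ball w (r/4)"
    using assms(1) ball_subset_cball holomorphic_on_subset by blast
  show "continuous_on (cball w (r/4)) g"
    using assms(1) sub holomorphic_on_imp_continuous_on continuous_on_subset by blast
  show "0 < r/4" using assms by simp
  show "cmod (g x) \<le> M" if "norm (w - x) = r/4" for x
    using that sub by (intro assms(2)) (auto simp: dist_norm)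
qed

text \<open>A uniformly bounded family of holomorphic functions is differentiable as a function with
  values in \<^typ>\<open>ell_inf\<close> since Taylor's estimate is uniform.\<close>

lemma has_cderiv_of_coords:
  fixes F :: "complex \<Rightarrow> ell_inf"
  assumes holo: "\<And>j. (\<lambda>w. F w j) holomorphic_on ball z r"
    and M: "\<And>w j. w \<in> ball z r \<Longrightarrow> cmod (F w j) \<le> M" and r: "0 < r"
  shows "\<exists>D. has_cderiv F D z \<and> (\<forall>j. apply_bcontfun D j = deriv (\<lambda>w. F w j) z)"
proof -
  define D where "D = Bcontfun (\<lambda>j. deriv (\<lambda>w. F w j) z)"
  have D: "apply_bcontfun D j = deriv (\<lambda>w. F w j) z" for j
  proof -
    have "cmod (deriv (\<lambda>w. F w j) z) \<le> fact 1 * M / (r/4) ^ 1" for j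
      using deriv_bound[OF holo M r, of z 1 j] r by simp
    from apply_Bcontfun_nat[of "\<lambda>j. deriv (\<lambda>w. F w j) z", OF this] show ?thesis
      by (simp add: D_def)
  qed
  define C where "C = fact 2 * M / (r/4)^2"
  have M0: "0 \<le> M" using M[of z 0] r norm_ge_zero order_trans centre_in_ball by metis
  then have C0: "0 \<le> C" unfolding C_def by (intro divide_nonneg_nonneg mult_nonneg_nonneg) auto
  have taylor: "norm (F y - F z - (y - z) *\<^sub>C D) \<le> C * (norm (y - z))\<^sup>2" if y: "norm (y - z) < r/2" for y
  proof (rule norm_bound)
    fix j
    define g where "g = (\<lambda>w. apply_bcontfun (F w) j)"
    have gh: "g holomorphic_on ball z r" unfolding g_def by (rule holo)
    have "cmod ((\<lambda>i. (deriv ^^ i) g) 0 y - (\<Sum>i\<le>1. (\<lambda>i. (deriv ^^ i) g) i z * (y - z)^i / (fact i)))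
        \<le> C * cmod (y - z)^(Suc 1) / fact 1"
    proof (rule complex_Taylor[of "ball z (r/2)"])
      fix i x assume "x \<in> ball z (r/2)" "i \<le> (1::nat)"
      then have "x \<in> ball z r" using r by auto
      have "(deriv ^^ i) g holomorphic_on ball z r"
        by (rule holomorphic_higher_deriv[OF gh]) simp
      then have "((deriv ^^ i) g has_field_derivative deriv ((deriv ^^ i) g) x) (at x)"
        by (rule holomorphic_derivI) (use \<open>x \<in> ball z r\<close> in auto)
      then show "((deriv ^^ i) g has_field_derivative (deriv ^^ Suc i) g x) (at x within ball z (r/2))"
        by (simp add: has_field_derivative_at_within)
    next
      fix x assume "x \<in> ball z (r/2)"
      then show "cmod ((deriv ^^ Suc 1) g x) \<le> C"
        unfolding C_def using deriv_bound[OF gh _ r, of M x 2] M by (simp add: g_def numeral_2_eq_2)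
    qed (use y r in \<open>auto simp: dist_norm norm_minus_commute\<close>)
    then show "cmod ((F y - F z - (y - z) *\<^sub>C D) j) \<le> C * (norm (y - z))\<^sup>2"
      by (simp add: g_def apply_scaleC_bcontfun scaleC_complex_def D power2_eq_square algebra_simps)
  qed
  have "has_cderiv F D z"
    unfolding has_cderiv_def has_derivative_at_alt
  proof (intro conjI allI impI bounded_linear_scaleC_left)
    fix e :: real assume e: "e > 0"
    define d where "d = min (r/2) (e / (C + 1))"
    have "d > 0" using r e C0 by (auto simp: d_def)
    moreover have "norm (F y - F z - (y - z) *\<^sub>C D) \<le> e * norm (y - z)" if "norm (y - z) < d" for y
    proof -
      have "norm (y - z) < r/2" "norm (y - z) \<le> e / (C + 1)" using that by (auto simp: d_def)
      then have "norm (F y - F z - (y - z) *\<^sub>C D) \<le> (C * norm (y - z)) * norm (y - z)"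
        using taylor[of y] by (simp add: power2_eq_square mult.assoc)
      also have "C * norm (y - z) \<le> (C + 1) * (e / (C + 1))"
        using C0 \<open>norm (y - z) \<le> e / (C + 1)\<close> by (intro mult_mono) auto
      also have "\<dots> = e" using C0 by simp
      finally show ?thesis by (simp add: mult_right_mono)
    qed
    ultimately show "\<exists>d>0. \<forall>y. norm (y - z) < d \<longrightarrow> norm (F y - F z - (y - z) *\<^sub>C D) \<le> e * norm (y - z)"
      by blast
  qed
  with D show ?thesis by blast
qed

text \<open>The bounds are local so that the property passes to derivatives: those of a function
  bounded on the strip may blow up at its boundary.\<close>

definition loc_bounded_holo :: "(complex \<Rightarrow> ell_inf) \<Rightarrow> bool" where
  "loc_bounded_holo F \<longleftrightarrow> (\<forall>j. (\<lambda>w. F w j) holomorphic_on ostrip) \<and>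
    (\<forall>z\<in>ostrip. \<exists>r>0. \<exists>M. ball z r \<subseteq> ostrip \<and> (\<forall>w\<in>ball z r. \<forall>j. cmod (F w j) \<le> M))"

lemma loc_bounded_holo_cderiv:
  assumes "loc_bounded_holo F" "z \<in> ostrip"
  shows "has_cderiv F (cderiv F z) z" and "cderiv F z j = deriv (\<lambda>w. F w j) z"
proof -
  obtain r M where rM: "r > 0" "ball z r \<subseteq> ostrip" "\<And>w j. w \<in> ball z r \<Longrightarrow> cmod (F w j) \<le> M"
    using assms unfolding loc_bounded_holo_def by metis
  moreover have "(\<lambda>w. F w j) holomorphic_on ball z r" for j
    using assms rM(2) unfolding loc_bounded_holo_def by (meson holomorphic_on_subset)
  ultimately obtain D where D: "has_cderiv F D z" "\<And>j. apply_bcontfun D j = deriv (\<lambda>w. F w j) z"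
    using has_cderiv_of_coords[of F z r M] by metis
  then show "has_cderiv F (cderiv F z) z" "cderiv F z j = deriv (\<lambda>w. F w j) z"
    using cderiv_eqI[OF D(1)] by auto
qed

lemma loc_bounded_holo_step:
  assumes F: "loc_bounded_holo F"
  shows "loc_bounded_holo (cderiv F)"
  unfolding loc_bounded_holo_def
proof (intro conjI allI ballI)
  fix j
  have "deriv (\<lambda>w. F w j) holomorphic_on ostrip"
    using F open_ostrip by (intro holomorphic_deriv) (auto simp: loc_bounded_holo_def)
  then show "(\<lambda>w. cderiv F w j) holomorphic_on ostrip"
    by (rule holomorphic_transform) (simp add: loc_bounded_holo_cderiv[OF F])
next
  fix z assume z: "z \<in> ostrip"
  obtain r M where rM: "r > 0" "ball z r \<subseteq> ostrip" "\<And>w j. w \<in> ball z r \<Longrightarrow> cmod (F w j) \<le> M"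
    using F z unfolding loc_bounded_holo_def by metis
  have "(\<lambda>w. F w j) holomorphic_on ball z r" for j
    using F rM(2) unfolding loc_bounded_holo_def by (meson holomorphic_on_subset)
  from deriv_bound[OF this rM(3) rM(1)]
  have b: "cmod ((deriv ^^ 1) (\<lambda>w. F w j) w) \<le> fact 1 * M / (r/4) ^ 1" if "w \<in> ball z (r/2)" for w j
    using that by blast
  have s: "ball z (r/2) \<subseteq> ball z r" using rM(1) by (intro subset_ball) simp
  show "\<exists>r>0. \<exists>M. ball z r \<subseteq> ostrip \<and> (\<forall>w\<in>ball z r. \<forall>j. cmod (cderiv F w j) \<le> M)"
  proof (intro exI conjI ballI allI)
    show "r/2 > 0" using rM by simp
    show "ball z (r/2) \<subseteq> ostrip" using s rM(2) by blast
    fix w j assume w: "w \<in> ball z (r/2)"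
    then have "w \<in> ostrip" using s rM(2) by blast
    then show "cmod (cderiv F w j) \<le> fact 1 * M / (r/4) ^ 1"
      using b[OF w, of j] by (simp add: loc_bounded_holo_cderiv(2)[OF F])
  qed
qed

text \<open>The identity is carried along on the whole open strip, since \<open>cderiv\<close> at a
  point depends on the previous derivative in a neighbourhood.\<close>

lemma loc_bounded_holo_higher:
  assumes F: "loc_bounded_holo F"
  shows "loc_bounded_holo ((cderiv ^^ k) F) \<and>
    (\<forall>z\<in>ostrip. \<forall>j. (cderiv ^^ k) F z j = (deriv ^^ k) (\<lambda>w. F w j) z)"
proof (induction k)
  case 0
  with F show ?case by simp
next
  case (Suc k)
  then have L: "loc_bounded_holo ((cderiv ^^ k) F)"
    and c: "\<And>z j. z \<in> ostrip \<Longrightarrow> (cderiv ^^ k) F z j = (deriv ^^ k) (\<lambda>w. F w j) z" by auto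
  have "(cderiv ^^ Suc k) F z j = (deriv ^^ Suc k) (\<lambda>w. F w j) z" if z: "z \<in> ostrip" for z j
  proof -
    have "(cderiv ^^ Suc k) F z j = deriv (\<lambda>w. (cderiv ^^ k) F w j) z"
      using loc_bounded_holo_cderiv(2)[OF L z] by simp
    also have "\<dots> = deriv ((deriv ^^ k) (\<lambda>w. F w j)) z"
    proof (rule deriv_cong_ev)
      show "\<forall>\<^sub>F w in nhds z. (cderiv ^^ k) F w j = (deriv ^^ k) (\<lambda>w. F w j) w"
        unfolding eventually_nhds using open_ostrip z c by blast
    qed simp
    finally show ?thesis by simp
  qed
  with loc_bounded_holo_step[OF L] show ?case by simp
qed

text \<open>Removes the derivatives chosen by \<open>SOME\<close> from the description of
  \<open>Z3\<close>: its triples are now given by scalar Taylor coefficients.\<close>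

lemma Delta_coord:
  assumes "loc_bounded_holo F"
  shows "Delta k F j = jet k (\<lambda>w. F w j)"
  using loc_bounded_holo_higher[OF assms, of k] half_in_ostrip
  by (simp add: Delta_def jet_def apply_scaleC_bcontfun scaleC_complex_def)


subsection \<open>The Calderon space in coordinates\<close>

text \<open>A bound for the Calderon norm of the part of \<open>f\<close> from index
  \<open>m\<close> on. Finite partial sums stand in for the \<open>ell1\<close> norm, so no
  summability has to be carried along.\<close>

definition cald_tail :: "(nat \<Rightarrow> complex \<Rightarrow> complex) \<Rightarrow> nat \<Rightarrow> real \<Rightarrow> bool" where
  "cald_tail f m e \<longleftrightarrow> (\<forall>t. (\<forall>j\<ge>m. cmod (f j (Complex 0 t)) \<le> e) \<and>
    (\<forall>J. finite J \<longrightarrow> J \<subseteq> {m..} \<longrightarrow> (\<Sum>j\<in>J. cmod (f j (Complex 1 t))) \<le> e))"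

text \<open>The condition on tails builds in the approximation by finitely supported sequences. By
  \<open>calderon_of_seq\<close> and \<open>seq_of_calderon\<close> these are exactly the elements
  of the Calderon space, read on the strip.\<close>

definition cald_seq :: "(nat \<Rightarrow> complex \<Rightarrow> complex) \<Rightarrow> bool" where
  "cald_seq f \<longleftrightarrow> (\<forall>j. scal (f j)) \<and> (\<forall>e>0. \<exists>m. cald_tail f m e)"

lemma cald_tailD:
  assumes "cald_tail f m e"
  shows "m \<le> j \<Longrightarrow> cmod (f j (Complex 0 t)) \<le> e" "m \<le> j \<Longrightarrow> cmod (f j (Complex 1 t)) \<le> e"
    "finite J \<Longrightarrow> J \<subseteq> {m..} \<Longrightarrow> (\<Sum>j\<in>J. cmod (f j (Complex 1 t))) \<le> e"
proof -
  show s: "finite J \<Longrightarrow> J \<subseteq> {m..} \<Longrightarrow> (\<Sum>j\<in>J. cmod (f j (Complex 1 t))) \<le> e" for J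
    using assms by (auto simp: cald_tail_def)
  show "m \<le> j \<Longrightarrow> cmod (f j (Complex 0 t)) \<le> e"
    using assms by (auto simp: cald_tail_def)
  show "m \<le> j \<Longrightarrow> cmod (f j (Complex 1 t)) \<le> e"
    using s[of "{j}"] by simp
qed

lemma cald_tail_nonneg: "cald_tail f m e \<Longrightarrow> 0 \<le> e"
  using order_trans[OF norm_ge_zero cald_tailD(1)[of f m e m 0]] by simp

lemma cald_tail_mono:
  assumes "cald_tail f m e" "m \<le> m'" "e \<le> e'"
  shows "cald_tail f m' e'"
  unfolding cald_tail_def
proof (intro allI conjI impI)
  fix t j assume "m' \<le> j"
  then have "cmod (f j (Complex 0 t)) \<le> e" using assms(2) by (intro cald_tailD(1)[OF assms(1)]) simp
  with assms(3) show "cmod (f j (Complex 0 t)) \<le> e'" by simp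
next
  fix t J assume "finite J" "J \<subseteq> {m'..}"
  then have "(\<Sum>j\<in>J. cmod (f j (Complex 1 t))) \<le> e"
    using assms(2) by (intro cald_tailD(3)[OF assms(1)]) auto
  with assms(3) show "(\<Sum>j\<in>J. cmod (f j (Complex 1 t))) \<le> e'" by simp
qed

lemma cald_tail_add:
  assumes "cald_tail f m e" "cald_tail g m e'"
  shows "cald_tail (\<lambda>j z. f j z + g j z) m (e + e')"
  unfolding cald_tail_def
proof (intro allI conjI impI)
  fix t j assume "m \<le> j"
  then show "cmod (f j (Complex 0 t) + g j (Complex 0 t)) \<le> e + e'"
    by (intro norm_triangle_mono cald_tailD(1)[OF assms(1)] cald_tailD(1)[OF assms(2)])
next
  fix t J assume J: "finite J" "J \<subseteq> {m..}"
  have "(\<Sum>j\<in>J. cmod (f j (Complex 1 t) + g j (Complex 1 t)))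
      \<le> (\<Sum>j\<in>J. cmod (f j (Complex 1 t))) + (\<Sum>j\<in>J. cmod (g j (Complex 1 t)))"
    unfolding sum.distrib[symmetric] by (intro sum_mono norm_triangle_ineq)
  also have "\<dots> \<le> e + e'"
    by (intro add_mono cald_tailD(3)[OF assms(1)] cald_tailD(3)[OF assms(2)] J)
  finally show "(\<Sum>j\<in>J. cmod (f j (Complex 1 t) + g j (Complex 1 t))) \<le> e + e'" .
qed

lemma cald_tail_cmult:
  assumes "cald_tail f m e"
  shows "cald_tail (\<lambda>j z. c * f j z) m (cmod c * e)"
  unfolding cald_tail_def norm_mult sum_distrib_left[symmetric]
  by (simp add: mult_left_mono cald_tailD[OF assms])

lemma cald_tail_strip:
  assumes "cald_tail f m e" "scal (f j)" "m \<le> j" "z \<in> strip"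
  shows "cmod (f j z) \<le> e"
  using assms(2) cald_tailD(1,2)[OF assms(1) assms(3)]
  by (intro strip_maximum_modulus[OF _ _ _ _ _ assms(4), of "f j"]) (auto simp: scal_def)

lemma cald_seq_add:
  assumes "cald_seq f" "cald_seq g"
  shows "cald_seq (\<lambda>j z. f j z + g j z)"
  unfolding cald_seq_def
proof (intro conjI allI impI)
  show "scal (\<lambda>z. f j z + g j z)" for j
    using assms by (auto simp: cald_seq_def intro: scal_add)
  fix e :: real assume "e > 0"
  then have "e/2 > 0" by simp
  then obtain m n where "cald_tail f m (e/2)" "cald_tail g n (e/2)"
    using assms unfolding cald_seq_def by metis
  then have "cald_tail f (max m n) (e/2)" "cald_tail g (max m n) (e/2)"
    by (auto elim: cald_tail_mono)
  from cald_tail_add[OF this] show "\<exists>m. cald_tail (\<lambda>j z. f j z + g j z) m e"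
    by auto
qed

lemma cald_seq_cmult:
  assumes "cald_seq f"
  shows "cald_seq (\<lambda>j z. c * f j z)"
  unfolding cald_seq_def
proof (intro conjI allI impI)
  show "scal (\<lambda>z. c * f j z)" for j
    using assms by (auto simp: cald_seq_def intro: scal_cmult)
  fix e :: real assume "e > 0"
  then have "e / (cmod c + 1) > 0" by (simp add: add_nonneg_pos)
  then obtain m where m: "cald_tail f m (e / (cmod c + 1))"
    using assms unfolding cald_seq_def by metis
  have "cmod c * (e / (cmod c + 1)) \<le> (cmod c + 1) * (e / (cmod c + 1))"
    using \<open>e > 0\<close> by (intro mult_right_mono) (auto simp: add_nonneg_pos)
  also have "\<dots> = e" by (simp add: add_nonneg_eq_0_iff)
  finally show "\<exists>m. cald_tail (\<lambda>j z. c * f j z) m e"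
    using cald_tail_mono[OF cald_tail_cmult[OF m, of c]] by blast
qed

lemma cald_seq_finite_support:
  assumes "\<And>j. scal (f j)" "\<And>j. j \<ge> m \<Longrightarrow> f j = (\<lambda>z. 0)"
  shows "cald_seq f"
proof -
  have "cald_tail f m e" if "e > 0" for e
    unfolding cald_tail_def
  proof (intro allI conjI impI)
    fix t J assume "finite J" "J \<subseteq> {m..}"
    then have "(\<Sum>j\<in>J. cmod (f j (Complex 1 t))) = 0"
      using assms(2) by (intro sum.neutral) auto
    with that show "(\<Sum>j\<in>J. cmod (f j (Complex 1 t))) \<le> e" by simp
  qed (use assms(2) that in auto)
  with assms(1) show ?thesis by (auto simp: cald_seq_def)
qed

lemma sum_split_le:
  fixes g :: "nat \<Rightarrow> real"
  assumes "finite J" "\<And>j. 0 \<le> g j" "(\<Sum>j<m. g j) \<le> a"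
    and "\<And>I. finite I \<Longrightarrow> I \<subseteq> {m..} \<Longrightarrow> (\<Sum>j\<in>I. g j) \<le> b"
  shows "(\<Sum>j\<in>J. g j) \<le> a + b"
proof -
  have "(\<Sum>j\<in>J. g j) = (\<Sum>j\<in>J \<inter> {..<m}. g j) + (\<Sum>j\<in>J - {..<m}. g j)"
    using assms(1) by (rule sum.Int_Diff)
  also have "(\<Sum>j\<in>J \<inter> {..<m}. g j) \<le> (\<Sum>j<m. g j)"
    using assms(2) by (intro sum_mono2) auto
  also have "(\<Sum>j\<in>J - {..<m}. g j) \<le> b"
    using assms(1) by (intro assms(4)) auto
  finally show ?thesis using assms(3) by simp
qed

lemma cald_seq_bounded:
  assumes "cald_seq f"
  shows "\<exists>K. cald_tail f 0 K"
proof -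
  obtain m where m: "cald_tail f m 1"
    using assms unfolding cald_seq_def by (meson zero_less_one)
  have "\<exists>M. \<forall>z\<in>strip. cmod (f j z) \<le> M" for j
    using assms unfolding cald_seq_def scal_def bounded_iff by auto
  then obtain M where M: "\<And>j z. z \<in> strip \<Longrightarrow> cmod (f j z) \<le> M j" by metis
  have z: "0 \<in> strip" by (simp add: strip_def)
  have M0: "0 \<le> M j" for j using M[OF z, of j] norm_ge_zero order_trans by blast
  define K where "K = (\<Sum>j<m. M j) + 1"
  have "cald_tail f 0 K"
    unfolding cald_tail_def
  proof (intro allI conjI impI)
    fix t and j :: nat
    show "cmod (f j (Complex 0 t)) \<le> K"
    proof (cases "m \<le> j")
      case True
      then have "cmod (f j (Complex 0 t)) \<le> 1" by (rule cald_tailD(1)[OF m])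
      also have "1 \<le> K" unfolding K_def using M0 by (simp add: sum_nonneg)
      finally show ?thesis .
    next
      case False
      then have "M j \<le> (\<Sum>j<m. M j)" using M0 by (intro member_le_sum) auto
      with M[OF Complex_in_strip[of 0 t], of j] show ?thesis by (simp add: K_def)
    qed
  next
    fix t and J :: "nat set" assume J: "finite J"
    have "(\<Sum>j<m. cmod (f j (Complex 1 t))) \<le> (\<Sum>j<m. M j)"
      by (intro sum_mono M Complex_in_strip) auto
    then show "(\<Sum>j\<in>J. cmod (f j (Complex 1 t))) \<le> K"
      unfolding K_def using J cald_tailD(3)[OF m] by (intro sum_split_le) auto
  qed
  then show ?thesis by blast
qed

lemma ell1_norm_leI:
  fixes x :: ell_inf
  assumes "\<And>J. finite J \<Longrightarrow> (\<Sum>j\<in>J. cmod (x j)) \<le> K"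
  shows "x \<in> ell1" "ell1_norm x \<le> K"
proof -
  have s: "summable (\<lambda>n. cmod (x n))"
    by (rule bounded_imp_summable[of _ K]) (auto intro: assms)
  then show "x \<in> ell1" by (simp add: ell1_def)
  show "ell1_norm x \<le> K" unfolding ell1_norm_def
    using s by (rule suminf_le_const) (auto intro: assms)
qed

lemma sum_le_ell1_norm:
  fixes x :: ell_inf
  assumes "x \<in> ell1" "finite J"
  shows "(\<Sum>j\<in>J. cmod (x j)) \<le> ell1_norm x"
  using assms unfolding ell1_norm_def ell1_def by (intro sum_le_suminf) auto

lemma eventually_within_self: "\<forall>\<^sub>F w in at z within S. w \<in> S"
  by (simp add: eventually_at_filter)

text \<open>Uniformly small tails reduce each continuity and decay claim to finitely many
  coordinates, where it holds by \<open>scal\<close>; analyticity follows from the common bound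
  \<open>K\<close>.\<close>

lemma calderon_of_seq:
  assumes f: "cald_seq f"
  obtains F where "F \<in> calderon" "\<And>z j. z \<in> strip \<Longrightarrow> apply_bcontfun (F z) j = f j z"
proof -
  obtain K where K: "cald_tail f 0 K" using cald_seq_bounded[OF f] by blast
  have sc: "scal (f j)" for j using f by (simp add: cald_seq_def)
  have cont: "continuous_on strip (f j)" for j using sc[of j] by (simp add: scal_def)
  \<comment> \<open>Off the strip \<open>f j z\<close> may be unbounded in \<open>j\<close>, so the
    value there is set to 0; elements of \<open>calderon\<close> matter on the strip only.\<close>
  define F where "F z = Bcontfun (\<lambda>j. if z \<in> strip then f j z else 0)" for z
  have FK: "cmod (f j z) \<le> K" if "z \<in> strip" for j z
    using cald_tail_strip[OF K sc _ that] by simp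
  have F: "apply_bcontfun (F z) j = f j z" if z: "z \<in> strip" for z j
  proof -
    have "cmod (if z \<in> strip then f j z else 0) \<le> K" for j
      using FK[OF z] z by simp
    from apply_Bcontfun_nat[of "\<lambda>j. if z \<in> strip then f j z else 0", OF this] z show ?thesis
      by (simp add: F_def)
  qed
  have contF: "continuous_on strip F"
    unfolding continuous_on_def
  proof (intro ballI tendstoI)
    fix z and e :: real assume z: "z \<in> strip" and e: "e > 0"
    obtain m where m: "cald_tail f m (e/3)"
      using f e unfolding cald_seq_def by (meson divide_pos_pos zero_less_numeral)
    have "\<forall>\<^sub>F w in at z within strip. \<forall>j\<in>{..<m}. dist (f j w) (f j z) < e/3"
      using cont z e by (intro eventually_ball_finite ballI tendstoD) (auto simp: continuous_on_def)
    then show "\<forall>\<^sub>F w in at z within strip. dist (F w) (F z) < e"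
      using eventually_within_self
    proof eventually_elim
      case (elim w)
      have "dist (F w) (F z) \<le> e/3 + e/3"
      proof (rule dist_bound)
        fix j
        show "dist (F w j) (F z j) \<le> e/3 + e/3"
        proof (cases "j < m")
          case True
          with elim(1) have "dist (f j w) (f j z) < e/3" by auto
          with e show ?thesis by (simp add: F z elim(2))
        next
          case False
          then have "cmod (f j w) \<le> e/3" "cmod (f j z) \<le> e/3"
            using cald_tail_strip[OF m sc] z elim(2) by auto
          then show ?thesis
            using norm_triangle_ineq4[of "f j w" "f j z"] by (simp add: F z elim(2) dist_norm)
        qed
      qed
      with e show ?case by simp
    qed
  qed
  have "loc_bounded_holo F"
    unfolding loc_bounded_holo_def
  proof (intro conjI allI ballI)
    fix j
    have "f j holomorphic_on ostrip" using sc[of j] by (simp add: scal_def)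
    then show "(\<lambda>w. F w j) holomorphic_on ostrip"
      by (rule holomorphic_transform) (use F ostrip_subset_strip in auto)
  next
    fix z assume "z \<in> ostrip"
    then obtain r where "r > 0" "ball z r \<subseteq> ostrip"
      using open_ostrip open_contains_ball by metis
    moreover have "cmod (F w j) \<le> K" if "w \<in> ball z r" for w j
    proof -
      have "w \<in> strip" using that calculation(2) ostrip_subset_strip by blast
      then show ?thesis using FK F by simp
    qed
    ultimately show "\<exists>r>0. \<exists>M. ball z r \<subseteq> ostrip \<and> (\<forall>w\<in>ball z r. \<forall>j. cmod (F w j) \<le> M)"
      by blast
  qed
  then have deriv: "\<exists>D. has_cderiv F D z" if "z \<in> ostrip" for z
    using loc_bounded_holo_cderiv(1) that by blast
  have bd: "bounded (F ` strip)"
    unfolding bounded_iff using FK F by (auto intro!: exI[of _ K] norm_bound)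
  have lim: "((\<lambda>t. f j (Complex 0 t)) \<longlongrightarrow> 0) at_infinity" "((\<lambda>t. f j (Complex 1 t)) \<longlongrightarrow> 0) at_infinity" for j
    using sc[of j] by (auto simp: scal_def)
  have "C0_into UNIV norm (\<lambda>t. F (Complex 0 t))"
    unfolding C0_into_def
  proof (intro conjI allI)
    fix t
    have "continuous_on UNIV (\<lambda>s. F (Complex 0 s))"
      by (rule continuous_on_compose2[OF contF]) (auto intro!: continuous_intros simp: strip_def)
    then have "((\<lambda>s. F (Complex 0 s)) \<longlongrightarrow> F (Complex 0 t)) (at t)"
      by (simp add: continuous_on_def)
    then show "((\<lambda>s. norm (F (Complex 0 s) - F (Complex 0 t))) \<longlongrightarrow> 0) (at t)"
      by (intro tendsto_norm_zero LIM_zero)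
  next
    show "((\<lambda>t. norm (F (Complex 0 t))) \<longlongrightarrow> 0) at_infinity"
    proof (rule tendstoI)
      fix e :: real assume e: "e > 0"
      obtain m where m: "cald_tail f m (e/2)"
        using f e unfolding cald_seq_def by (meson divide_pos_pos zero_less_numeral)
      have "\<forall>\<^sub>F t in at_infinity. \<forall>j\<in>{..<m}. dist (f j (Complex 0 t)) 0 < e/2"
        using e lim by (intro eventually_ball_finite ballI tendstoD) auto
      then show "\<forall>\<^sub>F t in at_infinity. dist (norm (F (Complex 0 t))) 0 < e"
      proof eventually_elim
        case (elim t)
        have "norm (F (Complex 0 t)) \<le> e/2"
        proof (rule norm_bound)
          fix j
          show "norm (F (Complex 0 t) j) \<le> e/2"
            using elim[rule_format, of j] cald_tailD(1)[OF m, of j t]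
            by (cases "j < m") (auto simp: F Complex_in_strip)
        qed
        with e show ?case by simp
      qed
    qed
  qed simp
  moreover have "C0_into ell1 ell1_norm (\<lambda>t. F (Complex 1 t))"
    unfolding C0_into_def
  proof (intro conjI allI)
    have "F (Complex 1 t) \<in> ell1" for t
      by (rule ell1_norm_leI[of _ K]) (use cald_tailD(3)[OF K] in \<open>auto simp: F Complex_in_strip\<close>)
    then show "range (\<lambda>t. F (Complex 1 t)) \<subseteq> ell1" by auto
  next
    fix t
    show "((\<lambda>s. ell1_norm (F (Complex 1 s) - F (Complex 1 t))) \<longlongrightarrow> 0) (at t)"
    proof (rule tendstoI)
      fix e :: real assume e: "e > 0"
      \<comment> \<open>A head below \<open>e/2\<close> and two tails of at most \<open>e/8\<close>
        stay strictly below \<open>e\<close>.\<close>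
      obtain m where m: "cald_tail f m (e/8)"
        using f e unfolding cald_seq_def by (meson divide_pos_pos zero_less_numeral)
      have "((\<lambda>s. f j (Complex 1 s)) \<longlongrightarrow> f j (Complex 1 t)) (at t)" for j
      proof -
        have "continuous_on UNIV (\<lambda>s. f j (Complex 1 s))"
          by (rule continuous_on_compose2[OF cont]) (auto intro!: continuous_intros simp: strip_def)
        then show ?thesis by (simp add: continuous_on_def)
      qed
      then have "((\<lambda>s. \<Sum>j<m. cmod (f j (Complex 1 s) - f j (Complex 1 t))) \<longlongrightarrow> 0) (at t)"
        by (intro tendsto_null_sum tendsto_norm_zero LIM_zero)
      then have "\<forall>\<^sub>F s in at t. dist (\<Sum>j<m. cmod (f j (Complex 1 s) - f j (Complex 1 t))) 0 < e/2"
        using e by (intro tendstoD) auto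
      then show "\<forall>\<^sub>F s in at t. dist (ell1_norm (F (Complex 1 s) - F (Complex 1 t))) 0 < e"
      proof eventually_elim
        case (elim s)
        then have el: "(\<Sum>j<m. cmod (f j (Complex 1 s) - f j (Complex 1 t))) < e/2" by simp
        have le: "(\<Sum>j\<in>J. cmod ((F (Complex 1 s) - F (Complex 1 t)) j)) \<le> e/2 + (e/8 + e/8)" if J: "finite J" for J
        proof -
          have "(\<Sum>j\<in>J. cmod (f j (Complex 1 s) - f j (Complex 1 t))) \<le> e/2 + (e/8 + e/8)"
          proof (rule sum_split_le[OF J])
            fix I assume I: "finite I" "I \<subseteq> {m..}"
            have "(\<Sum>j\<in>I. cmod (f j (Complex 1 s) - f j (Complex 1 t)))
              \<le> (\<Sum>j\<in>I. cmod (f j (Complex 1 s))) + (\<Sum>j\<in>I. cmod (f j (Complex 1 t)))"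
              unfolding sum.distrib[symmetric] by (intro sum_mono norm_triangle_ineq4)
            also have "\<dots> \<le> e/8 + e/8"
              using I by (intro add_mono cald_tailD(3)[OF m]) auto
            finally show "(\<Sum>j\<in>I. cmod (f j (Complex 1 s) - f j (Complex 1 t))) \<le> e/8 + e/8" .
          qed (use el in auto)
          then show ?thesis by (simp add: F Complex_in_strip)
        qed
        have "0 \<le> ell1_norm (F (Complex 1 s) - F (Complex 1 t))"
          using sum_le_ell1_norm[OF ell1_norm_leI(1)[OF le], of "{}"] by simp
        with ell1_norm_leI(2)[OF le] e show ?case by simp
      qed
    qed
  next
    show "((\<lambda>t. ell1_norm (F (Complex 1 t))) \<longlongrightarrow> 0) at_infinity"
    proof (rule tendstoI)
      fix e :: real assume e: "e > 0"
      obtain m where m: "cald_tail f m (e/4)"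
        using f e unfolding cald_seq_def by (meson divide_pos_pos zero_less_numeral)
      have "((\<lambda>t. \<Sum>j<m. cmod (f j (Complex 1 t))) \<longlongrightarrow> 0) at_infinity"
        using lim by (intro tendsto_null_sum tendsto_norm_zero)
      then have "\<forall>\<^sub>F t in at_infinity. dist (\<Sum>j<m. cmod (f j (Complex 1 t))) 0 < e/2"
        using e by (intro tendstoD) auto
      then show "\<forall>\<^sub>F t in at_infinity. dist (ell1_norm (F (Complex 1 t))) 0 < e"
      proof eventually_elim
        case (elim t)
        then have el: "(\<Sum>j<m. cmod (f j (Complex 1 t))) < e/2" by simp
        have le: "(\<Sum>j\<in>J. cmod (F (Complex 1 t) j)) \<le> e/2 + e/4" if J: "finite J" for J
        proof -
          have "(\<Sum>j\<in>J. cmod (f j (Complex 1 t))) \<le> e/2 + e/4"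
            using el cald_tailD(3)[OF m] by (intro sum_split_le[OF J, of _ m]) auto
          then show ?thesis by (simp add: F Complex_in_strip)
        qed
        have "0 \<le> ell1_norm (F (Complex 1 t))"
          using sum_le_ell1_norm[OF ell1_norm_leI(1)[OF le], of "{}"] by simp
        with ell1_norm_leI(2)[OF le] e show ?case by simp
      qed
    qed
  qed
  ultimately have "F \<in> calderon"
    unfolding calderon_def mem_Collect_eq strip_def[symmetric]
    using contF bd deriv by (auto simp: ostrip_def)
  with F that show thesis by blast
qed

section \<open>Uniformly small tails of Calderon functions on the boundary lines\<close>

lemma uniform_tail:
  fixes P :: "nat \<Rightarrow> real \<Rightarrow> bool"
  assumes mono: "\<And>m m' t. P m t \<Longrightarrow> m \<le> m' \<Longrightarrow> P m' t"
    and loc: "\<And>t. \<exists>m. \<exists>d>0. \<forall>s. \<bar>s - t\<bar> < d \<longrightarrow> P m s"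
    and inf: "\<forall>\<^sub>F t in at_infinity. P n t"
  shows "\<exists>m. \<forall>t. P m t"
proof -
  obtain R where R: "\<And>t. R \<le> \<bar>t\<bar> \<Longrightarrow> P n t"
    using inf unfolding eventually_at_infinity by auto
  \<comment> \<open>Bisection serves as compactness: indices that work on adjacent intervals are
    combined by \<open>max\<close>. The absolute value keeps the interval nonempty, since
    \<open>R\<close> may be negative.\<close>
  have "\<exists>m. \<forall>t\<in>{-\<bar>R\<bar>..\<bar>R\<bar>}. P m t"
  proof (rule Bolzano[of "-\<bar>R\<bar>" "\<bar>R\<bar>" "\<lambda>a b. \<exists>m. \<forall>t\<in>{a..b}. P m t"])
    fix a b c :: real
    assume "\<exists>m. \<forall>t\<in>{a..b}. P m t" "\<exists>m. \<forall>t\<in>{b..c}. P m t"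
    then obtain m m' where "\<forall>t\<in>{a..b}. P m t" "\<forall>t\<in>{b..c}. P m' t" by auto
    then have "\<forall>t\<in>{a..c}. P (max m m') t"
      by (meson atLeastAtMost_iff linear max.cobounded1 max.cobounded2 mono)
    then show "\<exists>m. \<forall>t\<in>{a..c}. P m t" by blast
  next
    fix x :: real
    obtain m d where md: "d > 0" "\<forall>s. \<bar>s - x\<bar> < d \<longrightarrow> P m s" using loc by blast
    have "\<exists>m. \<forall>t\<in>{a..b}. P m t" if "a \<le> x" "x \<le> b" "b - a < d" for a b
      using md(2) that by (intro exI[of _ m]) (auto simp: abs_if)
    with md(1) show "\<exists>d>0. \<forall>a b. a \<le> x \<and> x \<le> b \<and> b - a < d \<longrightarrow> (\<exists>m. \<forall>t\<in>{a..b}. P m t)"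
      by blast
  qed simp
  then obtain m where m: "\<forall>t\<in>{-\<bar>R\<bar>..\<bar>R\<bar>}. P m t" by blast
  have "P (max m n) t" for t
  proof (cases "R \<le> \<bar>t\<bar>")
    case True
    then show ?thesis using R mono max.cobounded2 by blast
  next
    case False
    then have "t \<in> {-\<bar>R\<bar>..\<bar>R\<bar>}" by auto
    then show ?thesis using m mono max.cobounded1 by blast
  qed
  then show ?thesis by blast
qed

lemma ell1_diff:
  assumes "x \<in> ell1" "y \<in> ell1"
  shows "x - y \<in> ell1"
proof (rule ell1_norm_leI)
  fix J :: "nat set" assume J: "finite J"
  have "(\<Sum>j\<in>J. cmod ((x - y) j)) \<le> (\<Sum>j\<in>J. cmod (x j)) + (\<Sum>j\<in>J. cmod (y j))"
    unfolding sum.distrib[symmetric] by (intro sum_mono) (simp add: norm_triangle_ineq4)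
  also have "\<dots> \<le> ell1_norm x + ell1_norm y"
    by (intro add_mono sum_le_ell1_norm assms J)
  finally show "(\<Sum>j\<in>J. cmod ((x - y) j)) \<le> ell1_norm x + ell1_norm y" .
qed

lemma ell1_small_tail:
  assumes "x \<in> ell1" "e > 0"
  shows "\<exists>m. \<forall>J. finite J \<longrightarrow> J \<subseteq> {m..} \<longrightarrow> (\<Sum>j\<in>J. cmod (x j)) \<le> e"
proof -
  have "(\<lambda>m. \<Sum>j<m. cmod (x j)) \<longlonglongrightarrow> ell1_norm x"
    using assms(1) unfolding ell1_def ell1_norm_def by (intro summable_LIMSEQ) simp
  then have "\<forall>\<^sub>F m in sequentially. ell1_norm x - e < (\<Sum>j<m. cmod (x j))"
    using assms(2) by (intro order_tendstoD(1)) auto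
  then obtain m where m: "ell1_norm x - e < (\<Sum>j<m. cmod (x j))"
    using eventually_happens'[OF sequentially_bot] by blast
  have "(\<Sum>j\<in>J. cmod (x j)) \<le> e" if J: "finite J" "J \<subseteq> {m..}" for J
  proof -
    have "(\<Sum>j<m. cmod (x j)) + (\<Sum>j\<in>J. cmod (x j)) = (\<Sum>j\<in>{..<m} \<union> J. cmod (x j))"
      using J by (intro sum.union_disjoint[symmetric]) auto
    also have "\<dots> \<le> ell1_norm x"
      using J by (intro sum_le_ell1_norm assms) auto
    finally show ?thesis using m by simp
  qed
  then show ?thesis by blast
qed

text \<open>On \<open>Re z = 1\<close> small tails come from summability and continuity in
  \<open>ell1_norm\<close>. On \<open>Re z = 0\<close> the supremum norm gives nothing of the kind,
  and smallness is transported from the other line through points of the strip close to the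
  boundary.\<close>

lemma seq_of_calderon:
  assumes "F \<in> calderon"
  shows "cald_seq (\<lambda>j z. F z j)"
proof -
  have contF: "continuous_on strip F" and bd: "bounded (F ` strip)"
    and der: "\<And>z. z \<in> ostrip \<Longrightarrow> \<exists>D. has_cderiv F D z"
    and c0: "C0_into UNIV norm (\<lambda>t. F (Complex 0 t))" and c1: "C0_into ell1 ell1_norm (\<lambda>t. F (Complex 1 t))"
    using assms by (auto simp: calderon_def strip_def ostrip_def)
  obtain M where M: "\<And>z. z \<in> strip \<Longrightarrow> norm (F z) \<le> M"
    using bd unfolding bounded_iff by auto
  have in1: "F (Complex 1 t) \<in> ell1" for t
    using c1 by (auto simp: C0_into_def)
  have sc: "scal (\<lambda>z. F z j)" for j
    unfolding scal_def
  proof (intro conjI)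
    show "continuous_on strip (\<lambda>z. F z j)"
      by (rule bounded_linear.continuous_on[OF bounded_linear_apply_bcontfun contF])
    show "(\<lambda>z. F z j) holomorphic_on ostrip"
      unfolding holomorphic_on_open[OF open_ostrip] using der has_cderiv_coord by blast
    show "bounded ((\<lambda>z. F z j) ` strip)"
      unfolding bounded_iff using M norm_bounded order_trans by blast
    have l0: "((\<lambda>t. norm (F (Complex 0 t))) \<longlongrightarrow> 0) at_infinity"
      and l1: "((\<lambda>t. ell1_norm (F (Complex 1 t))) \<longlongrightarrow> 0) at_infinity"
      using c0 c1 by (auto simp: C0_into_def)
    show "((\<lambda>t. F (Complex 0 t) j) \<longlongrightarrow> 0) at_infinity"
      by (rule Lim_null_comparison[OF _ l0]) (simp add: norm_bounded)
    have "norm (F (Complex 1 t) j) \<le> ell1_norm (F (Complex 1 t))" for t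
      using norm_le_ell1_norm[OF in1] norm_bounded order_trans by blast
    then show "((\<lambda>t. F (Complex 1 t) j) \<longlongrightarrow> 0) at_infinity"
      by (intro Lim_null_comparison[OF _ l1]) simp
  qed
  have tail1: "\<exists>m. \<forall>t. \<forall>J. finite J \<longrightarrow> J \<subseteq> {m..} \<longrightarrow> (\<Sum>j\<in>J. cmod (F (Complex 1 t) j)) \<le> e"
    if e: "e > 0" for e
  proof (rule uniform_tail)
    fix m m' :: nat and t
    assume "\<forall>J. finite J \<longrightarrow> J \<subseteq> {m..} \<longrightarrow> (\<Sum>j\<in>J. cmod (F (Complex 1 t) j)) \<le> e" and "m \<le> m'"
    moreover from \<open>m \<le> m'\<close> have "{m'..} \<subseteq> {m..}" by simp
    ultimately show "\<forall>J. finite J \<longrightarrow> J \<subseteq> {m'..} \<longrightarrow> (\<Sum>j\<in>J. cmod (F (Complex 1 t) j)) \<le> e"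
      by (meson subset_trans)
  next
    fix t :: real
    obtain m where m: "\<And>J. finite J \<Longrightarrow> J \<subseteq> {m..} \<Longrightarrow> (\<Sum>j\<in>J. cmod (F (Complex 1 t) j)) \<le> e/2"
      using ell1_small_tail[OF in1, of "e/2" t] e by auto
    have "((\<lambda>s. ell1_norm (F (Complex 1 s) - F (Complex 1 t))) \<longlongrightarrow> 0) (at t)"
      using c1 by (simp add: C0_into_def)
    then have "\<forall>\<^sub>F s in at t. ell1_norm (F (Complex 1 s) - F (Complex 1 t)) < e/2"
      using e by (intro order_tendstoD(2)) auto
    then obtain d where d: "d > 0" "\<And>s. s \<noteq> t \<Longrightarrow> dist s t < d \<Longrightarrow> ell1_norm (F (Complex 1 s) - F (Complex 1 t)) < e/2"
      unfolding eventually_at by auto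
    have "(\<Sum>j\<in>J. cmod (F (Complex 1 s) j)) \<le> e" if J: "finite J" "J \<subseteq> {m..}" and s: "\<bar>s - t\<bar> < d" for s J
    proof (cases "s = t")
      case True
      then show ?thesis using m[OF J] e by simp
    next
      case False
      have "(\<Sum>j\<in>J. cmod (F (Complex 1 s) j))
          \<le> (\<Sum>j\<in>J. cmod ((F (Complex 1 s) - F (Complex 1 t)) j)) + (\<Sum>j\<in>J. cmod (F (Complex 1 t) j))"
        unfolding sum.distrib[symmetric]
        by (intro sum_mono) (metis diff_add_cancel minus_bcontfun.rep_eq norm_triangle_ineq)
      also have "\<dots> \<le> e/2 + e/2"
        using d(2)[OF False] s sum_le_ell1_norm[OF ell1_diff[OF in1 in1] J(1), of s t] m[OF J]
        by (intro add_mono) (auto simp: dist_real_def)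
      finally show ?thesis by simp
    qed
    with d(1) show "\<exists>m. \<exists>d>0. \<forall>s. \<bar>s - t\<bar> < d \<longrightarrow> (\<forall>J. finite J \<longrightarrow> J \<subseteq> {m..} \<longrightarrow> (\<Sum>j\<in>J. cmod (F (Complex 1 s) j)) \<le> e)"
      by blast
  next
    have "\<forall>\<^sub>F t in at_infinity. ell1_norm (F (Complex 1 t)) < e"
      using c1 e by (intro order_tendstoD(2)[of _ 0]) (auto simp: C0_into_def)
    then show "\<forall>\<^sub>F t in at_infinity. \<forall>J. finite J \<longrightarrow> J \<subseteq> {0..} \<longrightarrow> (\<Sum>j\<in>J. cmod (F (Complex 1 t) j)) \<le> e"
    proof eventually_elim
      case (elim t)
      then show ?case using sum_le_ell1_norm[OF in1, of _ t] by (meson less_imp_le order_trans)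
    qed
  qed
  have vanish: "\<exists>m. \<forall>j\<ge>m. cmod (F (Complex 0 t) j) \<le> e" if e: "e > 0" for e t
  proof -
    have "Complex 0 t \<in> strip" by (simp add: strip_def)
    then obtain d where d: "d > 0" "\<And>w. w \<in> strip \<Longrightarrow> dist w (Complex 0 t) < d \<Longrightarrow> dist (F w) (F (Complex 0 t)) < e/2"
      using contF e unfolding continuous_on_iff by (meson half_gt_zero)
    \<comment> \<open>A point to the right of \<open>Complex 0 t\<close>, within the strip and so
      close that passing to it changes \<open>F\<close> by less than \<open>e/2\<close>.\<close>
    define s where "s = min (d/2) 1"
    have s: "0 < s" "s \<le> 1" using d(1) by (auto simp: s_def)
    then have sS: "Complex s t \<in> strip" by (simp add: strip_def)
    have "Complex s t - Complex 0 t = complex_of_real s" by (simp add: complex_eq_iff)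
    then have "dist (Complex s t) (Complex 0 t) = s" using s by (simp add: dist_norm)
    also have "s < d" using d(1) by (auto simp: s_def)
    finally have near: "dist (F (Complex s t)) (F (Complex 0 t)) < e/2" by (rule d(2)[OF sS])
    define A where "A = M + 1"
    have A: "A > 0" using M[OF sS] norm_ge_zero[of "F (Complex s t)"] unfolding A_def by linarith
    \<comment> \<open>The solution of \<open>A * (r / A) powr s = e / 2\<close>: tails below
      \<open>r\<close> on \<open>Re z = 1\<close> are interpolated to \<open>e / 2\<close> at
      \<open>Complex s t\<close>.\<close>
    define r where "r = A * (e/2/A) powr (1/s)"
    have r: "r > 0" using A e by (simp add: r_def)
    have rs: "A * (r / A) powr s = e/2"
      using A e s by (simp add: r_def powr_powr)
    obtain m where m: "\<And>t J. finite J \<Longrightarrow> J \<subseteq> {m..} \<Longrightarrow> (\<Sum>j\<in>J. cmod (F (Complex 1 t) j)) \<le> r"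
      using tail1[OF r] by metis
    have "cmod (F (Complex 0 t) j) \<le> e" if j: "m \<le> j" for j
    proof -
      have "cmod (F (Complex s t) j) \<le> A * (r / A) powr Re (Complex s t)"
      proof (rule three_lines[of "\<lambda>z. F z j"])
        show "cmod (F (Complex 0 t) j) \<le> A" for t
          using M[of "Complex 0 t"] norm_bounded[of "F (Complex 0 t)" j] by (simp add: A_def strip_def)
        show "cmod (F (Complex 1 t) j) \<le> r" for t
          using m[of "{j}" t] j by simp
      qed (use sc[of j] A r sS in \<open>auto simp: scal_def\<close>)
      then have "cmod (F (Complex s t) j) \<le> e/2" by (simp add: rs)
      moreover have "dist (F (Complex s t) j) (F (Complex 0 t) j) < e/2"
        by (rule le_less_trans[OF dist_bounded near])
      ultimately show ?thesis
        using norm_triangle_ineq2[of "F (Complex 0 t) j" "F (Complex s t) j"]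
        by (simp add: dist_norm norm_minus_commute)
    qed
    then show ?thesis by blast
  qed
  have tail0: "\<exists>m. \<forall>t. \<forall>j\<ge>m. cmod (F (Complex 0 t) j) \<le> e" if e: "e > 0" for e
  proof (rule uniform_tail)
    fix t :: real
    obtain m where m: "\<And>j. m \<le> j \<Longrightarrow> cmod (F (Complex 0 t) j) \<le> e/2"
      using vanish[of "e/2" t] e by auto
    have "((\<lambda>s. norm (F (Complex 0 s) - F (Complex 0 t))) \<longlongrightarrow> 0) (at t)"
      using c0 by (simp add: C0_into_def)
    then have "\<forall>\<^sub>F s in at t. norm (F (Complex 0 s) - F (Complex 0 t)) < e/2"
      using e by (intro order_tendstoD(2)) auto
    then obtain d where d: "d > 0" "\<And>s. s \<noteq> t \<Longrightarrow> dist s t < d \<Longrightarrow> norm (F (Complex 0 s) - F (Complex 0 t)) < e/2"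
      unfolding eventually_at by auto
    have "cmod (F (Complex 0 s) j) \<le> e" if j: "m \<le> j" and s: "\<bar>s - t\<bar> < d" for s j
    proof (cases "s = t")
      case True
      then show ?thesis using m[OF j] e by simp
    next
      case False
      then have "norm (F (Complex 0 s) - F (Complex 0 t)) < e/2" using d(2) s by (simp add: dist_real_def)
      then have "cmod (F (Complex 0 s) j - F (Complex 0 t) j) < e/2"
        using norm_bounded[of "F (Complex 0 s) - F (Complex 0 t)" j] by simp
      with m[OF j] show ?thesis
        using norm_triangle_ineq2[of "F (Complex 0 s) j" "F (Complex 0 t) j"] by simp
    qed
    with d(1) show "\<exists>m. \<exists>d>0. \<forall>s. \<bar>s - t\<bar> < d \<longrightarrow> (\<forall>j\<ge>m. cmod (F (Complex 0 s) j) \<le> e)"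
      by blast
  next
    have "\<forall>\<^sub>F t in at_infinity. norm (F (Complex 0 t)) < e"
      using c0 e by (intro order_tendstoD(2)[of _ 0]) (auto simp: C0_into_def)
    then show "\<forall>\<^sub>F t in at_infinity. \<forall>j\<ge>0. cmod (F (Complex 0 t) j) \<le> e"
    proof eventually_elim
      case (elim t)
      then show ?case using norm_bounded[of "F (Complex 0 t)"] by (meson less_imp_le order_trans)
    qed
  qed auto
  have "\<exists>m. cald_tail (\<lambda>j z. F z j) m e" if e: "e > 0" for e
  proof -
    obtain m where m: "\<And>t j. m \<le> j \<Longrightarrow> cmod (F (Complex 0 t) j) \<le> e" using tail0[OF e] by blast
    obtain n where n: "\<And>t J. finite J \<Longrightarrow> J \<subseteq> {n..} \<Longrightarrow> (\<Sum>j\<in>J. cmod (F (Complex 1 t) j)) \<le> e"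
      using tail1[OF e] by blast
    have "cald_tail (\<lambda>j z. F z j) (max m n) e"
      unfolding cald_tail_def
    proof (intro allI conjI impI)
      show "finite J \<Longrightarrow> J \<subseteq> {max m n..} \<Longrightarrow> (\<Sum>j\<in>J. cmod (F (Complex 1 t) j)) \<le> e" for t J
        by (rule n) auto
    qed (simp add: m)
    then show ?thesis by blast
  qed
  with sc show ?thesis by (simp add: cald_seq_def)
qed

text \<open>\<open>SUP\<close> over the reals is meaningful only for bounded sets; the bound
  \<open>B\<close> secures this before the suprema are compared with \<open>K\<close>.\<close>

lemma calderon_norm_le_iff:
  assumes F: "F \<in> calderon"
  shows "calderon_norm F \<le> K \<longleftrightarrow> cald_tail (\<lambda>j z. F z j) 0 K"
proof -
  obtain B where B: "cald_tail (\<lambda>j z. F z j) 0 B"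
    using cald_seq_bounded[OF seq_of_calderon[OF F]] by blast
  have le: "norm (F (Complex 0 t)) \<le> K" "ell1_norm (F (Complex 1 t)) \<le> K"
    if "cald_tail (\<lambda>j z. F z j) 0 K" for K t
    using cald_tailD(1,3)[OF that] by (auto intro!: norm_bound ell1_norm_leI(2))
  have "bdd_above (range (\<lambda>t. norm (F (Complex 0 t))))" "bdd_above (range (\<lambda>t. ell1_norm (F (Complex 1 t))))"
    using le[OF B] by (auto intro!: bdd_aboveI[of _ B])
  then have "calderon_norm F \<le> K \<longleftrightarrow> (\<forall>t. norm (F (Complex 0 t)) \<le> K) \<and> (\<forall>t. ell1_norm (F (Complex 1 t)) \<le> K)"
    unfolding calderon_norm_def by (simp add: cSUP_le_iff)
  also have "\<dots> \<longleftrightarrow> cald_tail (\<lambda>j z. F z j) 0 K"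
  proof
    assume K: "(\<forall>t. norm (F (Complex 0 t)) \<le> K) \<and> (\<forall>t. ell1_norm (F (Complex 1 t)) \<le> K)"
    have "F (Complex 1 t) \<in> ell1" for t
      using F by (auto simp: calderon_def C0_into_def)
    moreover have "cmod (F (Complex 0 t) j) \<le> K" for t j
      using K norm_bounded[of "F (Complex 0 t)" j] order_trans by blast
    ultimately show "cald_tail (\<lambda>j z. F z j) 0 K"
      unfolding cald_tail_def using K order_trans[OF sum_le_ell1_norm] by simp
  qed (use le in auto)
  finally show ?thesis .
qed

lemma loc_bounded_holo_calderon:
  assumes F: "F \<in> calderon"
  shows "loc_bounded_holo F"
  unfolding loc_bounded_holo_def
proof (intro conjI allI ballI)
  have sc: "scal (\<lambda>w. F w j)" for j using seq_of_calderon[OF F] by (simp add: cald_seq_def)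
  then show "(\<lambda>w. F w j) holomorphic_on ostrip" for j by (simp add: scal_def)
  fix z assume "z \<in> ostrip"
  then obtain r where r: "r > 0" "ball z r \<subseteq> ostrip"
    using open_ostrip open_contains_ball by metis
  obtain B where B: "cald_tail (\<lambda>j z. F z j) 0 B"
    using cald_seq_bounded[OF seq_of_calderon[OF F]] by blast
  have "cmod (F w j) \<le> B" if "w \<in> ball z r" for w j
  proof -
    have "w \<in> strip" using that r(2) ostrip_subset_strip by blast
    then show ?thesis using cald_tail_strip[OF B sc] by simp
  qed
  with r show "\<exists>r>0. \<exists>M. ball z r \<subseteq> ostrip \<and> (\<forall>w\<in>ball z r. \<forall>j. cmod (F w j) \<le> M)"
    by blast
qed


subsection \<open>The third Rochberg space in coordinates\<close>

type_synonym ell_inf3 = "ell_inf \<times> ell_inf \<times> ell_inf"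

text \<open>Indexed by the order of the Taylor coefficient, whereas the triples list the highest
  order first: \<open>coef 0\<close> is the last entry. Every \<open>k\<close> above 1 selects the
  first entry, hence the recurring hypothesis \<open>k \<le> 2\<close>.\<close>

definition coef :: "nat \<Rightarrow> ell_inf3 \<Rightarrow> nat \<Rightarrow> complex" where
  "coef k x = apply_bcontfun (if k = 0 then snd (snd x) else if k = 1 then fst (snd x) else fst x)"

lemma coef_eqI:
  assumes "\<And>k j. k \<le> 2 \<Longrightarrow> coef k x j = coef k y j"
  shows "x = y"
proof -
  have "fst x = fst y" "fst (snd x) = fst (snd y)" "snd (snd x) = snd (snd y)"
    using assms[of 0] assms[of 1] assms[of 2] by (auto simp: coef_def intro: bcontfun_eqI)
  then show ?thesis by (simp add: prod_eq_iff)
qed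

lemma coef_add [simp]: "coef k (x + y) j = coef k x j + coef k y j"
  and coef_diff [simp]: "coef k (x - y) j = coef k x j - coef k y j"
  and coef_scaleC [simp]: "coef k (c *\<^sub>C x) j = c * coef k x j"
  and coef_zero [simp]: "coef k 0 j = 0"
  by (auto simp: coef_def scaleC_prod_def apply_scaleC_bcontfun scaleC_complex_def)

lemma coef_sum [simp]: "coef k (\<Sum>i\<in>I. x i) j = (\<Sum>i\<in>I. coef k (x i) j)"
  by (induction I rule: infinite_finite_induct) auto

definition represents :: "(nat \<Rightarrow> complex \<Rightarrow> complex) \<Rightarrow> ell_inf3 \<Rightarrow> bool" where
  "represents f x \<longleftrightarrow> cald_seq f \<and> (\<forall>k\<le>2. \<forall>j. jet k (f j) = coef k x j)"

lemma represents_calderon: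
  assumes "F \<in> calderon"
  shows "represents (\<lambda>j z. F z j) (Delta 2 F, Delta 1 F, Delta 0 F)"
proof -
  have "jet k (\<lambda>z. F z j) = coef k (Delta 2 F, Delta 1 F, Delta 0 F) j" if k: "k \<le> 2" for k j
  proof -
    consider "k = 0" | "k = 1" | "k = 2" using k by linarith
    then show ?thesis
      by cases (simp_all add: coef_def Delta_coord[OF loc_bounded_holo_calderon[OF assms]])
  qed
  with seq_of_calderon[OF assms] show ?thesis by (simp add: represents_def)
qed

lemma Z3_calderon_of_represents:
  assumes "represents f x" "cald_tail f 0 K"
  obtains F where "F \<in> calderon" "(Delta 2 F, Delta 1 F, Delta 0 F) = x" "calderon_norm F \<le> K"
proof -
  obtain F where F: "F \<in> calderon" "\<And>z j. z \<in> strip \<Longrightarrow> apply_bcontfun (F z) j = f j z"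
    using calderon_of_seq assms(1) unfolding represents_def by metis
  have "jet k (\<lambda>z. F z j) = jet k (f j)" for k j
    using F(2) ostrip_subset_strip by (intro jet_cong) auto
  then have "coef k (Delta 2 F, Delta 1 F, Delta 0 F) j = coef k x j" if "k \<le> 2" for k j
    using represents_calderon[OF F(1)] assms(1) that by (simp add: represents_def)
  then have "(Delta 2 F, Delta 1 F, Delta 0 F) = x" by (rule coef_eqI)
  moreover have "cald_tail (\<lambda>j z. F z j) 0 K"
    using assms(2) by (simp add: cald_tail_def F(2) Complex_in_strip)
  then have "calderon_norm F \<le> K" using calderon_norm_le_iff[OF F(1)] by simp
  ultimately show ?thesis using that F(1) by blast
qed

lemma calderon_norm_nonneg: "F \<in> calderon \<Longrightarrow> 0 \<le> calderon_norm F"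
  using calderon_norm_le_iff[of F "calderon_norm F"] cald_tail_nonneg by blast

lemma Z3_normI:
  assumes "represents f x" "cald_tail f 0 K"
  shows "x \<in> Z3" "Z3_norm x \<le> K"
proof -
  obtain F where F: "F \<in> calderon" "(Delta 2 F, Delta 1 F, Delta 0 F) = x" "calderon_norm F \<le> K"
    using Z3_calderon_of_represents[OF assms] by blast
  then show "x \<in> Z3" by (auto simp: Z3_def)
  have "Z3_norm x \<le> calderon_norm F"
    unfolding Z3_norm_def
    using F calderon_norm_nonneg by (intro cInf_lower bdd_belowI[of _ 0]) auto
  with F(3) show "Z3_norm x \<le> K" by simp
qed

text \<open>An infimum provides a witness only strictly above it. With \<open>Z3_normI\<close>,
  later arguments can work with representing sequences alone.\<close>

lemma Z3_normE:
  assumes "x \<in> Z3" "Z3_norm x < K"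
  obtains f where "represents f x" "cald_tail f 0 K"
proof -
  have "{calderon_norm F |F. F \<in> calderon \<and> (Delta 2 F, Delta 1 F, Delta 0 F) = x} \<noteq> {}"
    using assms(1) by (auto simp: Z3_def)
  from cInf_lessD[OF this] assms(2) obtain F where
    F: "F \<in> calderon" "(Delta 2 F, Delta 1 F, Delta 0 F) = x" "calderon_norm F < K"
    unfolding Z3_norm_def by auto
  then have "cald_tail (\<lambda>j z. F z j) 0 K" using calderon_norm_le_iff[OF F(1), of K] by simp
  then show ?thesis using that represents_calderon[OF F(1)] F(2) by simp
qed

lemma Z3_iff: "x \<in> Z3 \<longleftrightarrow> (\<exists>f. represents f x)"
  using Z3_normE[of x "Z3_norm x + 1"] Z3_normI(1) cald_seq_bounded
  by (metis less_add_one represents_def)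

lemma represents_exists:
  assumes f: "cald_seq f"
  obtains x where "represents f x"
proof -
  obtain K where K: "cald_tail f 0 K" using cald_seq_bounded[OF f] by blast
  have "cmod (jet k (f j)) \<le> 2 ^ k * K" for k j
    using f cald_tailD(1,2)[OF K] by (intro jet_bound) (auto simp: cald_seq_def)
  from apply_Bcontfun_nat[of "\<lambda>j. jet k (f j)" for k, OF this]
  have B: "apply_bcontfun (Bcontfun (\<lambda>j. jet k (f j))) = (\<lambda>j. jet k (f j))" for k .
  define x where "x = (Bcontfun (\<lambda>j. jet 2 (f j)), Bcontfun (\<lambda>j. jet 1 (f j)), Bcontfun (\<lambda>j. jet 0 (f j)))"
  have "jet k (f j) = coef k x j" if k: "k \<le> 2" for k j
  proof -
    consider "k = 0" | "k = 1" | "k = 2" using k by linarith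
    then show ?thesis by cases (simp_all add: x_def coef_def B)
  qed
  with f have "represents f x" by (simp add: represents_def)
  then show ?thesis by (rule that)
qed

lemma represents_holo: "represents f x \<Longrightarrow> f j holomorphic_on ostrip"
  by (simp add: represents_def cald_seq_def scal_def)

lemma represents_add:
  assumes "represents f x" "represents g y"
  shows "represents (\<lambda>j z. f j z + g j z) (x + y)"
  using assms jet_add[OF represents_holo[OF assms(1)] represents_holo[OF assms(2)]]
  by (simp add: represents_def cald_seq_add)

lemma represents_cmult:
  assumes "represents f x"
  shows "represents (\<lambda>j z. c * f j z) (c *\<^sub>C x)"
  using assms jet_cmult[OF represents_holo[OF assms]]
  by (simp add: represents_def cald_seq_cmult)

lemma Z3_add:
  assumes "x \<in> Z3" "y \<in> Z3"
  shows "x + y \<in> Z3" "Z3_norm (x + y) \<le> Z3_norm x + Z3_norm y"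
proof -
  show "x + y \<in> Z3" using assms represents_add unfolding Z3_iff by blast
  show "Z3_norm (x + y) \<le> Z3_norm x + Z3_norm y"
  proof (rule field_le_epsilon)
    fix e :: real assume "e > 0"
    then have l: "Z3_norm x < Z3_norm x + e/2" "Z3_norm y < Z3_norm y + e/2" by auto
    obtain f where f: "represents f x" "cald_tail f 0 (Z3_norm x + e/2)" by (rule Z3_normE[OF assms(1) l(1)])
    obtain g where g: "represents g y" "cald_tail g 0 (Z3_norm y + e/2)" by (rule Z3_normE[OF assms(2) l(2)])
    from Z3_normI(2)[OF represents_add[OF f(1) g(1)] cald_tail_add[OF f(2) g(2)]]
    show "Z3_norm (x + y) \<le> Z3_norm x + Z3_norm y + e" by simp
  qed
qed

lemma Z3_norm_nonneg: "x \<in> Z3 \<Longrightarrow> 0 \<le> Z3_norm x"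
  by (rule dense_ge) (metis Z3_normE cald_tail_nonneg)

lemma Z3_scaleC_aux:
  assumes "x \<in> Z3"
  shows "c *\<^sub>C x \<in> Z3" "Z3_norm (c *\<^sub>C x) \<le> cmod c * Z3_norm x"
proof -
  show "c *\<^sub>C x \<in> Z3" using assms represents_cmult unfolding Z3_iff by blast
  have "Z3_norm (c *\<^sub>C x) \<le> cmod c * (Z3_norm x + e)" if "e > 0" for e
  proof -
    have "Z3_norm x < Z3_norm x + e" using that by simp
    then obtain f where f: "represents f x" "cald_tail f 0 (Z3_norm x + e)" by (rule Z3_normE[OF assms(1)])
    show ?thesis by (rule Z3_normI(2)[OF represents_cmult[OF f(1)] cald_tail_cmult[OF f(2)]])
  qed
  then have ev: "\<forall>\<^sub>F e in at_right 0. Z3_norm (c *\<^sub>C x) \<le> cmod c * (Z3_norm x + e)"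
    using eventually_at_right_less by (rule eventually_mono[rotated])
  have "((\<lambda>e. cmod c * (Z3_norm x + e)) \<longlongrightarrow> cmod c * (Z3_norm x + 0)) (at_right 0)"
    by (intro tendsto_intros)
  from tendsto_lowerbound[OF this ev] show "Z3_norm (c *\<^sub>C x) \<le> cmod c * Z3_norm x" by simp
qed

lemma Z3_zero: "0 \<in> Z3" "Z3_norm 0 = 0"
proof -
  have "represents (\<lambda>j z. 0) 0"
    by (auto simp: represents_def intro: cald_seq_finite_support)
  moreover have "cald_tail (\<lambda>j z. 0) 0 0" by (simp add: cald_tail_def)
  ultimately show "0 \<in> Z3" "Z3_norm 0 = 0"
    using Z3_normI[of "\<lambda>j z. 0" 0 0] Z3_norm_nonneg[of 0] by auto
qed

lemma Z3_scaleC: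
  assumes "x \<in> Z3"
  shows "c *\<^sub>C x \<in> Z3" "Z3_norm (c *\<^sub>C x) = cmod c * Z3_norm x"
proof -
  show cx: "c *\<^sub>C x \<in> Z3" by (rule Z3_scaleC_aux[OF assms])
  show "Z3_norm (c *\<^sub>C x) = cmod c * Z3_norm x"
  proof (cases "c = 0")
    case True
    then show ?thesis by (simp add: Z3_zero)
  next
    case False
    have "Z3_norm (inverse c *\<^sub>C c *\<^sub>C x) \<le> cmod (inverse c) * Z3_norm (c *\<^sub>C x)"
      by (rule Z3_scaleC_aux[OF cx])
    also have "inverse c *\<^sub>C c *\<^sub>C x = x"
      using False by (simp only: complex_vector.scale_scale) simp
    finally have "cmod c * Z3_norm x \<le> cmod c * (cmod (inverse c) * Z3_norm (c *\<^sub>C x))"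
      by (rule mult_left_mono) simp
    also have "\<dots> = Z3_norm (c *\<^sub>C x)" using False by (simp add: norm_inverse)
    finally have "cmod c * Z3_norm x \<le> Z3_norm (c *\<^sub>C x)" .
    with Z3_scaleC_aux(2)[OF assms, of c] show ?thesis by simp
  qed
qed

lemma Z3_uminus: "x \<in> Z3 \<Longrightarrow> - x \<in> Z3" "x \<in> Z3 \<Longrightarrow> Z3_norm (- x) = Z3_norm x"
  using Z3_scaleC[of x "- 1"] by simp_all

lemma Z3_diff:
  assumes "x \<in> Z3" "y \<in> Z3"
  shows "x - y \<in> Z3" "Z3_norm (x - y) \<le> Z3_norm x + Z3_norm y"
  using Z3_add[OF assms(1) Z3_uminus(1)[OF assms(2)]] Z3_uminus(2)[OF assms(2)] by simp_all

lemma Z3_sum: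
  assumes "\<And>i. i \<in> I \<Longrightarrow> x i \<in> Z3"
  shows "(\<Sum>i\<in>I. x i) \<in> Z3 \<and> Z3_norm (\<Sum>i\<in>I. x i) \<le> (\<Sum>i\<in>I. Z3_norm (x i))"
  using assms
proof (induction I rule: infinite_finite_induct)
  case (insert i I)
  then have "(\<Sum>i\<in>I. x i) \<in> Z3 \<and> Z3_norm (\<Sum>i\<in>I. x i) \<le> (\<Sum>i\<in>I. Z3_norm (x i))" by simp
  then show ?case
    using insert.hyps Z3_add[of "x i" "\<Sum>i\<in>I. x i"] insert.prems by fastforce
qed (auto simp: Z3_zero)

lemma Z3_subspace: "complex_vector.subspace Z3"
  by (auto simp: complex_vector.subspace_def Z3_zero Z3_add Z3_scaleC)

text \<open>Continuity of the coefficient functionals by \<open>jet_bound\<close>; the value 4 for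
  \<open>k = 2\<close> reappears in the lower bounds for sums of blocks.\<close>

lemma coef_le_Z3_norm:
  assumes "x \<in> Z3" "k \<le> 2"
  shows "cmod (coef k x j) \<le> 2 ^ k * Z3_norm x"
proof -
  have "cmod (coef k x j) / 2 ^ k \<le> K" if K: "Z3_norm x < K" for K
  proof -
    obtain f where f: "represents f x" "cald_tail f 0 K" by (rule Z3_normE[OF assms(1) K])
    have "cmod (jet k (f j)) \<le> 2 ^ k * K"
      using f(1) cald_tailD(1,2)[OF f(2)] by (intro jet_bound) (auto simp: cald_seq_def represents_def)
    then show ?thesis using f(1) assms(2) by (simp add: represents_def field_simps)
  qed
  then have "cmod (coef k x j) / 2 ^ k \<le> Z3_norm x" by (rule dense_ge)
  then show ?thesis by (simp add: field_simps)
qed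

lemma Z3_norm_eq_0:
  assumes "x \<in> Z3" "Z3_norm x = 0"
  shows "x = 0"
  using coef_le_Z3_norm[OF assms(1)] assms(2) by (intro coef_eqI) simp

subsection \<open>Operators given by analytic matrices\<close>

text \<open>The entry \<open>c i j * exp (l i j * (z - 1/2))\<close> has modulus
  \<open>|c i j| * exp (- l i j / 2)\<close> on \<open>Re z = 0\<close> and
  \<open>|c i j| * exp (l i j / 2)\<close> on \<open>Re z = 1\<close>. Row sums give a contraction
  for the supremum norm on the first line, column sums one for the \<open>ell1\<close> norm on the
  second. Finite columns ensure that tails are mapped to tails.\<close>

definition contractive_matrix :: "(nat \<Rightarrow> nat \<Rightarrow> complex) \<Rightarrow> (nat \<Rightarrow> nat \<Rightarrow> real) \<Rightarrow> bool" where
  "contractive_matrix c l \<longleftrightarrow>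
    (\<forall>i. finite {j. c i j \<noteq> 0}) \<and> (\<forall>j. finite {i. c i j \<noteq> 0}) \<and>
    (\<forall>i. (\<Sum>j | c i j \<noteq> 0. cmod (c i j) * exp (- (l i j / 2))) \<le> 1) \<and>
    (\<forall>j. (\<Sum>i | c i j \<noteq> 0. cmod (c i j) * exp (l i j / 2)) \<le> 1)"

definition matrix_seq :: "(nat \<Rightarrow> nat \<Rightarrow> complex) \<Rightarrow> (nat \<Rightarrow> nat \<Rightarrow> real) \<Rightarrow>
    (nat \<Rightarrow> complex \<Rightarrow> complex) \<Rightarrow> nat \<Rightarrow> complex \<Rightarrow> complex" where
  "matrix_seq c l f i z = (\<Sum>j | c i j \<noteq> 0. c i j * exp (complex_of_real (l i j) * (z - 1/2)) * f j z)"

text \<open>The Cauchy product of the jets of \<open>exp (l i j * (z - 1/2))\<close> and of a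
  function representing \<open>x\<close>. It depends on \<open>x\<close> alone, which is why the
  matrix acts on the quotient \<open>Z3\<close>.\<close>

definition matrix_coef :: "(nat \<Rightarrow> nat \<Rightarrow> complex) \<Rightarrow> (nat \<Rightarrow> nat \<Rightarrow> real) \<Rightarrow> nat \<Rightarrow> ell_inf3 \<Rightarrow> nat \<Rightarrow> complex" where
  "matrix_coef c l k x i = (\<Sum>j | c i j \<noteq> 0. c i j *
    (\<Sum>p\<le>k. (complex_of_real (l i j) ^ p / fact p) * coef (k - p) x j))"

text \<open>Outside of \<^term>\<open>Z3\<close> the sequences below may be unbounded and the value is junk.\<close>

definition matrix_op :: "(nat \<Rightarrow> nat \<Rightarrow> complex) \<Rightarrow> (nat \<Rightarrow> nat \<Rightarrow> real) \<Rightarrow> ell_inf3 \<Rightarrow> ell_inf3" where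
  "matrix_op c l x = (Bcontfun (matrix_coef c l 2 x), Bcontfun (matrix_coef c l 1 x), Bcontfun (matrix_coef c l 0 x))"

text \<open>With separate indices \<open>m\<close> and \<open>n\<close> a single estimate covers
  both the whole norm, where they are 0, and the passage from tails to tails.\<close>

lemma cald_tail_matrix_seq:
  assumes ok: "contractive_matrix c l" and f: "cald_tail f n e"
    and mn: "\<And>i j. m \<le> i \<Longrightarrow> c i j \<noteq> 0 \<Longrightarrow> n \<le> j"
  shows "cald_tail (matrix_seq c l f) m e"
proof -
  have e: "0 \<le> e" by (rule cald_tail_nonneg[OF f])
  have finR: "finite {j. c i j \<noteq> 0}" and finC: "finite {i. c i j \<noteq> 0}"
    and row: "(\<Sum>j | c i j \<noteq> 0. cmod (c i j) * exp (- (l i j / 2))) \<le> 1"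
    and col: "(\<Sum>i | c i j \<noteq> 0. cmod (c i j) * exp (l i j / 2)) \<le> 1" for i j
    using ok by (auto simp: contractive_matrix_def)
  show ?thesis
    unfolding cald_tail_def
  proof (intro allI conjI impI)
    fix t i assume i: "m \<le> i"
    have "cmod (matrix_seq c l f i (Complex 0 t))
      \<le> (\<Sum>j | c i j \<noteq> 0. cmod (c i j * exp (complex_of_real (l i j) * (Complex 0 t - 1/2)) * f j (Complex 0 t)))"
      unfolding matrix_seq_def by (rule norm_sum)
    also have "\<dots> \<le> (\<Sum>j | c i j \<noteq> 0. cmod (c i j) * exp (- (l i j / 2)) * e)"
      using cald_tailD(1)[OF f] mn[OF i]
      by (intro sum_mono) (auto simp: norm_mult intro!: mult_left_mono)
    also have "\<dots> \<le> 1 * e"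
      unfolding sum_distrib_right[symmetric] using row e by (rule mult_right_mono)
    finally show "cmod (matrix_seq c l f i (Complex 0 t)) \<le> e" by simp
  next
    fix t J assume J: "finite J" "J \<subseteq> {m..}"
    define U where "U = (\<Union>i\<in>J. {j. c i j \<noteq> 0})"
    have U: "finite U" "U \<subseteq> {n..}" using J finR mn by (auto simp: U_def)
    define g where "g i j = cmod (c i j) * exp (l i j / 2) * cmod (f j (Complex 1 t))" for i j
    have "(\<Sum>i\<in>J. cmod (matrix_seq c l f i (Complex 1 t))) \<le> (\<Sum>i\<in>J. \<Sum>j | c i j \<noteq> 0. g i j)"
    proof (rule sum_mono)
      fix i
      have "cmod (matrix_seq c l f i (Complex 1 t))
        \<le> (\<Sum>j | c i j \<noteq> 0. cmod (c i j * exp (complex_of_real (l i j) * (Complex 1 t - 1/2)) * f j (Complex 1 t)))"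
        unfolding matrix_seq_def by (rule norm_sum)
      also have "\<dots> = (\<Sum>j | c i j \<noteq> 0. g i j)"
        by (simp add: g_def norm_mult)
      finally show "cmod (matrix_seq c l f i (Complex 1 t)) \<le> (\<Sum>j | c i j \<noteq> 0. g i j)" .
    qed
    also have "\<dots> = (\<Sum>i\<in>J. \<Sum>j\<in>U. g i j)"
      using U(1) by (intro sum.cong refl sum.mono_neutral_left) (auto simp: U_def g_def)
    also have "\<dots> = (\<Sum>j\<in>U. \<Sum>i\<in>J. g i j)" by (rule sum.swap)
    also have "\<dots> \<le> (\<Sum>j\<in>U. cmod (f j (Complex 1 t)))"
    proof (rule sum_mono)
      fix j
      have "(\<Sum>i\<in>J. cmod (c i j) * exp (l i j / 2)) = (\<Sum>i\<in>J \<inter> {i. c i j \<noteq> 0}. cmod (c i j) * exp (l i j / 2))"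
        using J by (intro sum.mono_neutral_right) auto
      also have "\<dots> \<le> (\<Sum>i | c i j \<noteq> 0. cmod (c i j) * exp (l i j / 2))"
        using finC by (intro sum_mono2) auto
      also have "\<dots> \<le> 1" by (rule col)
      finally have "(\<Sum>i\<in>J. cmod (c i j) * exp (l i j / 2)) * cmod (f j (Complex 1 t)) \<le> 1 * cmod (f j (Complex 1 t))"
        by (rule mult_right_mono) simp
      then show "(\<Sum>i\<in>J. g i j) \<le> cmod (f j (Complex 1 t))"
        by (simp add: g_def sum_distrib_right)
    qed
    also have "\<dots> \<le> e" by (rule cald_tailD(3)[OF f U])
    finally show "(\<Sum>i\<in>J. cmod (matrix_seq c l f i (Complex 1 t))) \<le> e" .
  qed
qed

lemma cald_seq_matrix_seq:
  assumes ok: "contractive_matrix c l" and f: "cald_seq f"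
  shows "cald_seq (matrix_seq c l f)"
  unfolding cald_seq_def
proof (intro conjI allI impI)
  show "scal (matrix_seq c l f i)" for i
    using f unfolding matrix_seq_def cald_seq_def by (intro scal_sum scal_exp) auto
  fix e :: real assume "e > 0"
  then obtain n where n: "cald_tail f n e" using f by (auto simp: cald_seq_def)
  \<comment> \<open>Only finitely many rows meet the first \<open>n\<close> columns;
    \<open>m\<close> is taken beyond all of them.\<close>
  have "finite (\<Union>j<n. {i. c i j \<noteq> 0})"
    using ok by (auto simp: contractive_matrix_def)
  then obtain m where m: "\<forall>i\<in>(\<Union>j<n. {i. c i j \<noteq> 0}). i < m"
    unfolding finite_nat_set_iff_bounded ..
  have "n \<le> j" if "m \<le> i" "c i j \<noteq> 0" for i j
  proof (rule ccontr)
    assume "\<not> n \<le> j"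
    with that(2) m have "i < m" by auto
    with that(1) show False by simp
  qed
  then show "\<exists>m. cald_tail (matrix_seq c l f) m e"
    using cald_tail_matrix_seq[OF ok n] by blast
qed

lemma represents_matrix:
  assumes ok: "contractive_matrix c l" and f: "represents f x"
  shows "represents (matrix_seq c l f) (matrix_op c l x)"
    and "k \<le> 2 \<Longrightarrow> coef k (matrix_op c l x) i = matrix_coef c l k x i"
proof -
  have "cald_seq (matrix_seq c l f)"
    using cald_seq_matrix_seq[OF ok] f by (simp add: represents_def)
  then obtain y where y: "represents (matrix_seq c l f) y" by (rule represents_exists)
  have "coef k y = matrix_coef c l k x" if k: "k \<le> 2" for k
  proof
    fix i
    have "coef k y i = jet k (matrix_seq c l f i)" using y k by (simp add: represents_def)
    also have "\<dots> = (\<Sum>j | c i j \<noteq> 0. jet k (\<lambda>z. c i j * exp (complex_of_real (l i j) * (z - 1/2)) * f j z))"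
      unfolding matrix_seq_def using ok represents_holo[OF f]
      by (intro jet_sum) (auto simp: contractive_matrix_def intro!: holomorphic_intros)
    also have "\<dots> = (\<Sum>j | c i j \<noteq> 0. c i j * (\<Sum>p\<le>k. (complex_of_real (l i j) ^ p / fact p) * jet (k - p) (f j)))"
      by (simp only: jet_exp_mult[OF represents_holo[OF f]])
    also have "\<dots> = matrix_coef c l k x i"
      unfolding matrix_coef_def using f k by (intro sum.cong refl arg_cong2[of _ _ _ _ "(*)"]) (auto simp: represents_def)
    finally show "coef k y i = matrix_coef c l k x i" .
  qed
  from this[of 0] this[of 1] this[of 2] have "matrix_op c l x = y"
    by (simp add: matrix_op_def coef_def apply_bcontfun_inverse prod_eq_iff flip: \<open>\<And>k. k \<le> 2 \<Longrightarrow> coef k y = matrix_coef c l k x\<close>)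
  with y \<open>\<And>k. k \<le> 2 \<Longrightarrow> coef k y = matrix_coef c l k x\<close>
  show "represents (matrix_seq c l f) (matrix_op c l x)"
    "k \<le> 2 \<Longrightarrow> coef k (matrix_op c l x) i = matrix_coef c l k x i" by auto
qed

lemma matrix_op_Z3:
  assumes ok: "contractive_matrix c l" and x: "x \<in> Z3"
  shows "matrix_op c l x \<in> Z3" "Z3_norm (matrix_op c l x) \<le> Z3_norm x"
    "k \<le> 2 \<Longrightarrow> coef k (matrix_op c l x) i = matrix_coef c l k x i"
proof -
  obtain f where f: "represents f x" using x Z3_iff by blast
  show "matrix_op c l x \<in> Z3" using represents_matrix(1)[OF ok f] Z3_iff by blast
  show "k \<le> 2 \<Longrightarrow> coef k (matrix_op c l x) i = matrix_coef c l k x i"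
    by (rule represents_matrix(2)[OF ok f])
  show "Z3_norm (matrix_op c l x) \<le> Z3_norm x"
  proof (rule dense_ge)
    fix K assume "Z3_norm x < K"
    then obtain g where g: "represents g x" "cald_tail g 0 K" by (rule Z3_normE[OF x])
    show "Z3_norm (matrix_op c l x) \<le> K"
      by (rule Z3_normI(2)[OF represents_matrix(1)[OF ok g(1)] cald_tail_matrix_seq[OF ok g(2)]]) simp
  qed
qed

lemma matrix_coef_add: "matrix_coef c l k (x + y) i = matrix_coef c l k x i + matrix_coef c l k y i"
  by (simp add: matrix_coef_def sum.distrib algebra_simps)

lemma matrix_coef_scaleC: "matrix_coef c l k (a *\<^sub>C x) i = a * matrix_coef c l k x i"
  by (simp add: matrix_coef_def sum_distrib_left mult_ac)

lemma matrix_op_linear: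
  assumes ok: "contractive_matrix c l" and "x \<in> Z3" "y \<in> Z3"
  shows "matrix_op c l (x + y) = matrix_op c l x + matrix_op c l y"
    "matrix_op c l (a *\<^sub>C x) = a *\<^sub>C matrix_op c l x"
  by (rule coef_eqI; simp add: matrix_op_Z3(3)[OF ok] assms Z3_add Z3_scaleC matrix_coef_add matrix_coef_scaleC)+

lemma matrix_op_bounded_op:
  assumes "contractive_matrix c l"
  shows "bounded_op Z3 Z3_norm Z3 Z3_norm (matrix_op c l)"
  unfolding bounded_op_def
  using matrix_op_linear[OF assms] matrix_op_Z3[OF assms] by (auto intro!: exI[of _ 1])


subsection \<open>Block operators\<close>

text \<open>The block \<open>n\<close> is \<open>U\<close> restricted to \<open>{j. \<nu> j = n}\<close>. The operator \<open>block_op U \<nu>\<close> maps the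
  unit vector with index \<open>n\<close> to \<open>sgn(U) \<bar>U\<bar>\<^sup>2\<^sup>z\<close> on that block, and \<open>block_adj U \<nu>\<close> pairs with
  \<open>cnj (sgn U) \<bar>U\<bar>\<^sup>2\<^sup>-\<^sup>2\<^sup>z\<close>; both are contractive on either boundary line.\<close>

definition block_op :: "(nat \<Rightarrow> complex) \<Rightarrow> (nat \<Rightarrow> nat) \<Rightarrow> ell_inf3 \<Rightarrow> ell_inf3" where
  "block_op U \<nu> = matrix_op (\<lambda>j n. if \<nu> j = n then U j else 0) (\<lambda>j n. 2 * ln (cmod (U j)))"

definition block_adj :: "(nat \<Rightarrow> complex) \<Rightarrow> (nat \<Rightarrow> nat) \<Rightarrow> ell_inf3 \<Rightarrow> ell_inf3" where
  "block_adj U \<nu> = matrix_op (\<lambda>n j. if \<nu> j = n then cnj (U j) else 0) (\<lambda>n j. - (2 * ln (cmod (U j))))"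

text \<open>Blocks are contained in the fibres of \<nu>, so disjointness is built in, and
  \<open>U j = 0\<close> removes the index \<open>j\<close>. The squares are the moduli of
  \<open>|U j|^(2z)\<close> on \<open>Re z = 1\<close>, that is, the column sums there.\<close>

definition blocks :: "(nat \<Rightarrow> complex) \<Rightarrow> (nat \<Rightarrow> nat) \<Rightarrow> bool" where
  "blocks U \<nu> \<longleftrightarrow> (\<forall>n. finite {j. \<nu> j = n \<and> U j \<noteq> 0} \<and> (\<Sum>j | \<nu> j = n \<and> U j \<noteq> 0. (cmod (U j))\<^sup>2) \<le> 1)"

lemma if_nonzero_collect: "{j. (if \<nu> j = n then V j else 0) \<noteq> 0} = {j. \<nu> j = n \<and> V j \<noteq> 0}"
  for V :: "'a \<Rightarrow> complex"
  by auto

lemma if_nonzero_collect': "{n. (if m = n then v else 0) \<noteq> 0} = (if v = 0 then {} else {m})"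
  for v :: complex
  by auto

lemma block_op_contractive:
  assumes "blocks U \<nu>"
  shows "contractive_matrix (\<lambda>j n. if \<nu> j = n then U j else 0) (\<lambda>j n. 2 * ln (cmod (U j)))"
  unfolding contractive_matrix_def if_nonzero_collect if_nonzero_collect'
proof (intro conjI allI)
  show "finite {j. \<nu> j = n \<and> U j \<noteq> 0}" for n using assms by (simp add: blocks_def)
  show "(\<Sum>n\<in>(if U j = 0 then {} else {\<nu> j}). cmod (if \<nu> j = n then U j else 0) * exp (- (2 * ln (cmod (U j)) / 2))) \<le> 1" for j
    by (simp add: exp_minus)
  show "(\<Sum>j | \<nu> j = n \<and> U j \<noteq> 0. cmod (if \<nu> j = n then U j else 0) * exp (2 * ln (cmod (U j)) / 2)) \<le> 1" for n
  proof -
    have "(\<Sum>j | \<nu> j = n \<and> U j \<noteq> 0. cmod (if \<nu> j = n then U j else 0) * exp (2 * ln (cmod (U j)) / 2))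
        = (\<Sum>j | \<nu> j = n \<and> U j \<noteq> 0. (cmod (U j))\<^sup>2)"
      by (intro sum.cong refl) (auto simp: power2_eq_square)
    then show ?thesis using assms by (simp add: blocks_def)
  qed
qed auto

lemma block_adj_contractive:
  assumes "blocks U \<nu>"
  shows "contractive_matrix (\<lambda>n j. if \<nu> j = n then cnj (U j) else 0) (\<lambda>n j. - (2 * ln (cmod (U j))))"
  unfolding contractive_matrix_def if_nonzero_collect if_nonzero_collect' complex_cnj_zero_iff
proof (intro conjI allI)
  show "finite {j. \<nu> j = n \<and> U j \<noteq> 0}" for n using assms by (simp add: blocks_def)
  show "(\<Sum>n\<in>(if U j = 0 then {} else {\<nu> j}). cmod (if \<nu> j = n then cnj (U j) else 0) * exp (- (2 * ln (cmod (U j))) / 2)) \<le> 1" for j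
    by (simp add: exp_minus)
  show "(\<Sum>j | \<nu> j = n \<and> U j \<noteq> 0. cmod (if \<nu> j = n then cnj (U j) else 0) * exp (- (- (2 * ln (cmod (U j))) / 2))) \<le> 1" for n
  proof -
    have "(\<Sum>j | \<nu> j = n \<and> U j \<noteq> 0. cmod (if \<nu> j = n then cnj (U j) else 0) * exp (- (- (2 * ln (cmod (U j))) / 2)))
        = (\<Sum>j | \<nu> j = n \<and> U j \<noteq> 0. (cmod (U j))\<^sup>2)"
      by (intro sum.cong refl) (auto simp: power2_eq_square)
    then show ?thesis using assms by (simp add: blocks_def)
  qed
qed auto

lemmas block_op_Z3 = matrix_op_Z3(1,2)[OF block_op_contractive, folded block_op_def]
lemmas block_op_bounded_op = matrix_op_bounded_op[OF block_op_contractive, folded block_op_def]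
lemmas block_adj_Z3 = matrix_op_Z3(1,2)[OF block_adj_contractive, folded block_adj_def]
lemmas block_adj_bounded_op = matrix_op_bounded_op[OF block_adj_contractive, folded block_adj_def]

lemma coef_block_op:
  assumes "blocks U \<nu>" "x \<in> Z3" "k \<le> 2"
  shows "coef k (block_op U \<nu> x) j
    = U j * (\<Sum>p\<le>k. (complex_of_real (2 * ln (cmod (U j))) ^ p / fact p) * coef (k - p) x (\<nu> j))"
proof -
  have "coef k (block_op U \<nu> x) j = matrix_coef (\<lambda>j n. if \<nu> j = n then U j else 0) (\<lambda>j n. 2 * ln (cmod (U j))) k x j"
    unfolding block_op_def by (rule matrix_op_Z3(3)[OF block_op_contractive[OF assms(1)] assms(2,3)])
  then show ?thesis
    unfolding matrix_coef_def if_nonzero_collect' by simp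
qed

lemma coef_block_adj:
  assumes "blocks U \<nu>" "x \<in> Z3" "k \<le> 2"
  shows "coef k (block_adj U \<nu> x) n = (\<Sum>j | \<nu> j = n \<and> U j \<noteq> 0. cnj (U j) *
    (\<Sum>p\<le>k. (complex_of_real (- (2 * ln (cmod (U j)))) ^ p / fact p) * coef (k - p) x j))"
proof -
  have "coef k (block_adj U \<nu> x) n = matrix_coef (\<lambda>n j. if \<nu> j = n then cnj (U j) else 0) (\<lambda>n j. - (2 * ln (cmod (U j)))) k x n"
    unfolding block_adj_def by (rule matrix_op_Z3(3)[OF block_adj_contractive[OF assms(1)] assms(2,3)])
  then show ?thesis
    unfolding matrix_coef_def if_nonzero_collect complex_cnj_zero_iff
    by (auto intro!: sum.cong)
qed

lemma sum_atMost_2: "(\<Sum>p\<le>2. g p) = g 0 + g 1 + g (2::nat)"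
  by (simp add: numeral_2_eq_2)

text \<open>For every \<open>z\<close> the corresponding entries of the two matrices multiply to
  \<open>|U j|^2\<close>, as the exponents \<open>2 * ln |U j|\<close> and
  \<open>- 2 * ln |U j|\<close> cancel, and over a block these squares sum to 1. Both operators
  being contractive, \<open>block_op\<close> is then an isometry with complemented range.\<close>

lemma block_adj_block_op:
  assumes b: "blocks U \<nu>" and x: "x \<in> Z3"
    and one: "\<And>n. (\<Sum>j | \<nu> j = n \<and> U j \<noteq> 0. (cmod (U j))\<^sup>2) = 1"
  shows "block_adj U \<nu> (block_op U \<nu> x) = x"
proof (rule coef_eqI)
  fix k n :: nat assume k: "k \<le> 2"
  define L where "L j = complex_of_real (2 * ln (cmod (U j)))" for j
  have y: "block_op U \<nu> x \<in> Z3" by (rule block_op_Z3[OF b x])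
  have "coef k (block_adj U \<nu> (block_op U \<nu> x)) n = (\<Sum>j | \<nu> j = n \<and> U j \<noteq> 0. cnj (U j) *
    (\<Sum>p\<le>k. ((- L j) ^ p / fact p) * coef (k - p) (block_op U \<nu> x) j))"
    by (simp add: coef_block_adj[OF b y k] L_def)
  also have "\<dots> = (\<Sum>j | \<nu> j = n \<and> U j \<noteq> 0. complex_of_real ((cmod (U j))\<^sup>2) * coef k x n)"
  proof (intro sum.cong refl)
    fix j assume j: "j \<in> {j. \<nu> j = n \<and> U j \<noteq> 0}"
    have c: "coef q (block_op U \<nu> x) j = U j * (\<Sum>p\<le>q. (L j ^ p / fact p) * coef (q - p) x n)" if "q \<le> 2" for q
      using coef_block_op[OF b x that, of j] j by (simp add: L_def)
    \<comment> \<open>The series of \<open>exp (- L j * t)\<close> and \<open>exp (L j * t)\<close>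
      multiply to 1, checked order by order up to 2.\<close>
    have "(\<Sum>p\<le>k. ((- L j) ^ p / fact p) * coef (k - p) (block_op U \<nu> x) j) = U j * coef k x n"
    proof -
      consider "k = 0" | "k = 1" | "k = 2" using k by linarith
      then show ?thesis
      proof cases
        case 1
        then show ?thesis by (simp add: c)
      next
        case 2
        then show ?thesis using c[of 0] c[of 1] by (simp add: algebra_simps)
      next
        case 3
        then show ?thesis using c[of 0] c[of 1] c[of 2]
          by (simp add: sum_atMost_2 algebra_simps power2_eq_square)
      qed
    qed
    then show "cnj (U j) * (\<Sum>p\<le>k. ((- L j) ^ p / fact p) * coef (k - p) (block_op U \<nu> x) j)
      = complex_of_real ((cmod (U j))\<^sup>2) * coef k x n"
      by (simp only: complex_norm_square mult.assoc mult.commute[of "cnj (U j)"])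
  qed
  also have "\<dots> = complex_of_real (\<Sum>j | \<nu> j = n \<and> U j \<noteq> 0. (cmod (U j))\<^sup>2) * coef k x n"
    by (simp only: sum_distrib_right of_real_sum)
  also have "\<dots> = coef k x n" by (simp add: one)
  finally show "coef k (block_adj U \<nu> (block_op U \<nu> x)) n = coef k x n" .
qed

text \<open>Written as a block operator with unit entries so that contractivity comes for free;
  \<open>ln 1 = 0\<close> removes the contributions of the other entries.\<close>

definition trunc :: "nat set \<Rightarrow> ell_inf3 \<Rightarrow> ell_inf3" where
  "trunc A = block_op (\<lambda>j. if j \<in> A then 1 else 0) (\<lambda>j. j)"

lemma blocks_trunc: "blocks (\<lambda>j. if j \<in> A then 1 else 0) (\<lambda>j. j)"
proof -
  have "{j. j = n \<and> (if j \<in> A then 1 else 0) \<noteq> (0::complex)} = (if n \<in> A then {n} else {})" for n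
    by auto
  then show ?thesis by (auto simp: blocks_def)
qed

lemmas trunc_Z3 = block_op_Z3[OF blocks_trunc, folded trunc_def]

lemma coef_trunc:
  assumes "x \<in> Z3" "k \<le> 2"
  shows "coef k (trunc A x) j = (if j \<in> A then coef k x j else 0)"
proof -
  have "(\<Sum>p\<le>k. 2 ^ p * 0 ^ p * coef (k - p) x j / fact p) = (\<Sum>p\<le>k. if p = 0 then coef k x j else 0)"
    by (intro sum.cong) auto
  then show ?thesis
    using coef_block_op[OF blocks_trunc assms, of A j] by (simp add: trunc_def)
qed

lemma trunc_small_tail:
  assumes x: "x \<in> Z3" and e: "e > 0"
  obtains m where "Z3_norm (x - trunc {..<m} x) \<le> e"
proof -
  obtain f where f: "represents f x" using x Z3_iff by blast
  then obtain m where m: "cald_tail f m e" using e by (auto simp: represents_def cald_seq_def)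
  have "x - trunc {..<m} x = trunc {m..} x"
    by (rule coef_eqI) (auto simp: coef_trunc x)
  \<comment> \<open>The rows below \<open>m\<close> vanish, so the bound for the tail of
    \<open>f\<close> from \<open>m\<close> on bounds the whole image.\<close>
  moreover have "Z3_norm (trunc {m..} x) \<le> e"
    unfolding trunc_def block_op_def
    by (rule Z3_normI(2)[OF represents_matrix(1)[OF block_op_contractive[OF blocks_trunc] f]
        cald_tail_matrix_seq[OF block_op_contractive[OF blocks_trunc] m]]) (auto split: if_splits)
  ultimately show ?thesis using that by metis
qed

subsection \<open>Lifts and functionals\<close>

definition supported :: "ell_inf3 \<Rightarrow> nat set \<Rightarrow> bool" where
  "supported x A \<longleftrightarrow> (\<forall>k\<le>2. \<forall>j. j \<notin> A \<longrightarrow> coef k x j = 0)"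

abbreviation l2 :: "(nat \<Rightarrow> complex) \<Rightarrow> nat set \<Rightarrow> real" where
  "l2 d A \<equiv> L2_set (\<lambda>j. cmod (d j)) A"

lemma l2_sq: "(l2 d A)\<^sup>2 = (\<Sum>j\<in>A. (cmod (d j))\<^sup>2)"
  by (simp add: L2_set_def sum_nonneg)

lemma supported_mono: "supported x A \<Longrightarrow> A \<subseteq> B \<Longrightarrow> supported x B"
  by (auto simp: supported_def)

lemma supported_diff: "supported x A \<Longrightarrow> supported y A \<Longrightarrow> supported (x - y) A"
  and supported_scaleC: "supported x A \<Longrightarrow> supported (c *\<^sub>C x) A"
  and supported_sum: "(\<And>i. i \<in> I \<Longrightarrow> supported (b i) A) \<Longrightarrow> supported (\<Sum>i\<in>I. b i) A"
  by (simp_all add: supported_def)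

lemma blocks_single:
  assumes "finite A" "(\<Sum>j\<in>A. (cmod (w j))\<^sup>2) \<le> 1"
  shows "blocks (\<lambda>j. if j \<in> A then w j else 0) (\<lambda>j. 0)"
  unfolding blocks_def
proof (intro allI conjI)
  fix n :: nat
  define S where "S = {j. 0 = n \<and> (if j \<in> A then w j else 0) \<noteq> 0}"
  have S: "S \<subseteq> A" by (auto simp: S_def)
  then show "finite {j. 0 = n \<and> (if j \<in> A then w j else 0) \<noteq> 0}"
    using assms(1) finite_subset unfolding S_def by blast
  have "(\<Sum>j\<in>S. (cmod (if j \<in> A then w j else 0))\<^sup>2) = (\<Sum>j\<in>S. (cmod (w j))\<^sup>2)"
    using S by (intro sum.cong) auto
  also have "\<dots> \<le> (\<Sum>j\<in>A. (cmod (w j))\<^sup>2)"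
    using S assms(1) by (intro sum_mono2) auto
  also have "\<dots> \<le> 1" by fact
  finally show "(\<Sum>j | 0 = n \<and> (if j \<in> A then w j else 0) \<noteq> 0. (cmod (if j \<in> A then w j else 0))\<^sup>2) \<le> 1"
    by (simp add: S_def)
qed

lemma gauss_element:
  assumes "i \<le> 2"
  obtains x where "x \<in> Z3" "Z3_norm x \<le> 2" "\<And>k. k \<le> i \<Longrightarrow> coef k x 0 = (if k = i then 1 else 0)"
proof -
  define f where "f j z = (if j = 0 then (z - 1/2)^i * exp ((z - 1/2)\<^sup>2) else 0)" for j :: nat and z :: complex
  have f0: "f 0 = (\<lambda>z. (z - 1/2)^i * exp ((z - 1/2)\<^sup>2))" and f1: "j \<ge> 1 \<Longrightarrow> f j = (\<lambda>z. 0)" for j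
    by (auto simp: f_def fun_eq_iff)
  have "scal (f j)" for j
    using scal_gauss[OF assms] f0 f1[of j] by (cases j) auto
  then have "cald_seq f" by (rule cald_seq_finite_support[OF _ f1])
  then obtain x where x: "represents f x" by (rule represents_exists)
  have b: "cmod (f 0 z) \<le> 2" if "z \<in> strip" for z
    unfolding f0 by (rule norm_gauss_le[OF that assms])
  have "cald_tail f 0 2"
    unfolding cald_tail_def
  proof (intro allI conjI impI)
    show "cmod (f j (Complex 0 t)) \<le> 2" for t j
      using b[of "Complex 0 t"] f1[of j] by (cases j) (auto simp: Complex_in_strip)
    fix t and J :: "nat set" assume "finite J"
    then have "(\<Sum>j\<in>J. cmod (f j (Complex 1 t))) = (\<Sum>j\<in>J \<inter> {0}. cmod (f j (Complex 1 t)))"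
      using f1 by (intro sum.mono_neutral_right) (auto simp: Suc_le_eq)
    also have "\<dots> \<le> (\<Sum>j\<in>{0}. cmod (f j (Complex 1 t)))"
      by (intro sum_mono2) auto
    also have "\<dots> \<le> 2" using b[of "Complex 1 t"] by (simp add: Complex_in_strip)
    finally show "(\<Sum>j\<in>J. cmod (f j (Complex 1 t))) \<le> 2" .
  qed
  note N = Z3_normI[OF x this]
  have "coef k x 0 = (if k = i then 1 else 0)" if "k \<le> i" for k
    using x that assms jet_gauss[OF that] by (auto simp: represents_def f0[symmetric])
  with N show ?thesis using that by blast
qed

text \<open>The normalised \<open>d\<close> serves as a single block, which carries the Gaussian
  element of order \<open>i\<close> at coordinate 0 to a vector with leading entry \<open>d\<close>.
  The factor 2 is the norm bound of that element.\<close>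

lemma lift_exists:
  assumes "finite A" "i \<le> 2"
  obtains x where "x \<in> Z3" "supported x A" "\<And>k j. k < i \<Longrightarrow> coef k x j = 0"
    "\<And>j. j \<in> A \<Longrightarrow> coef i x j = d j" "Z3_norm x \<le> 2 * l2 d A"
proof (cases "l2 d A = 0")
  case True
  then have "\<And>j. j \<in> A \<Longrightarrow> d j = 0" using assms(1) by (simp add: L2_set_eq_0_iff)
  then show ?thesis using that[of 0] True by (simp add: Z3_zero supported_def)
next
  case False
  define s where "s = l2 d A"
  have s: "s > 0" using False L2_set_nonneg[of "\<lambda>j. cmod (d j)" A] by (simp add: s_def less_le)
  define U where "U j = (if j \<in> A then d j / complex_of_real s else 0)" for j
  have "(\<Sum>j\<in>A. (cmod (d j / complex_of_real s))\<^sup>2) = (\<Sum>j\<in>A. (cmod (d j))\<^sup>2) / s\<^sup>2"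
    using s by (simp add: norm_divide power_divide sum_divide_distrib)
  also have "\<dots> = 1" using s by (simp add: l2_sq[symmetric] s_def[symmetric])
  finally have bl: "blocks U (\<lambda>j. 0)"
    unfolding U_def by (intro blocks_single assms) simp
  obtain p where p: "p \<in> Z3" "Z3_norm p \<le> 2" "\<And>k. k \<le> i \<Longrightarrow> coef k p 0 = (if k = i then 1 else 0)"
    using gauss_element[OF assms(2)] by blast
  define x where "x = complex_of_real s *\<^sub>C block_op U (\<lambda>j. 0) p"
  have cx: "coef k x j = s * (U j * (\<Sum>q\<le>k. (complex_of_real (2 * ln (cmod (U j))) ^ q / fact q) * coef (k - q) p 0))"
    if "k \<le> 2" for k j
    by (simp only: x_def coef_scaleC coef_block_op[OF bl p(1) that])
  have ci: "(\<Sum>q\<le>k. a q * coef (k - q) p 0) = (if k = i then a 0 else 0)" if "k \<le> i" for k and a :: "nat \<Rightarrow> complex"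
  proof -
    have "(\<Sum>q\<le>k. a q * coef (k - q) p 0) = (\<Sum>q\<le>k. if q = 0 then (if k = i then a 0 else 0) else 0)"
      using p(3) that by (intro sum.cong) auto
    then show ?thesis by simp
  qed
  show ?thesis
  proof (rule that)
    show "x \<in> Z3" unfolding x_def by (intro Z3_scaleC block_op_Z3 bl p)
    have "Z3_norm x = s * Z3_norm (block_op U (\<lambda>j. 0) p)"
      unfolding x_def using s by (subst Z3_scaleC(2)) (auto intro: block_op_Z3 bl p)
    also have "\<dots> \<le> s * 2" using block_op_Z3(2)[OF bl p(1)] p(2) s by (intro mult_left_mono) auto
    finally show "Z3_norm x \<le> 2 * l2 d A" by (simp add: s_def mult.commute)
    show "supported x A" unfolding supported_def by (simp add: cx U_def)
    show "coef k x j = 0" if k: "k < i" for k j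
      unfolding cx[OF order_trans[OF less_imp_le[OF k] assms(2)]] ci[OF less_imp_le[OF k]] using k by simp
    show "coef i x j = d j" if "j \<in> A" for j
      unfolding cx[OF assms(2)] ci[OF order_refl] using that s by (simp add: U_def)
  qed
qed

text \<open>The \<open>k\<close>-th coefficient of \<open>block_adj\<close> for the single block
  \<open>w\<close>: beyond order 0 it mixes the entries of \<open>x\<close> with logarithms of
  \<open>|w j|\<close>. Terms with \<open>w j = 0\<close> vanish, so the sum may run over all of
  \<open>A\<close>.\<close>

definition pairing :: "nat \<Rightarrow> (nat \<Rightarrow> complex) \<Rightarrow> nat set \<Rightarrow> ell_inf3 \<Rightarrow> complex" where
  "pairing k w A x = (\<Sum>j\<in>A. cnj (w j) *
    (\<Sum>p\<le>k. (complex_of_real (- (2 * ln (cmod (w j)))) ^ p / fact p) * coef (k - p) x j))"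

lemma pairing_bound:
  assumes "finite A" "(\<Sum>j\<in>A. (cmod (w j))\<^sup>2) \<le> 1" "x \<in> Z3" "k \<le> 2"
  shows "cmod (pairing k w A x) \<le> 2 ^ k * Z3_norm x"
proof -
  define U where "U j = (if j \<in> A then w j else 0)" for j
  have bl: "blocks U (\<lambda>j. 0)" unfolding U_def by (rule blocks_single[OF assms(1,2)])
  define S where "S = {j. 0 = (0::nat) \<and> U j \<noteq> 0}"
  have S: "S \<subseteq> A" "\<And>j. j \<in> A - S \<Longrightarrow> w j = 0" by (auto simp: S_def U_def split: if_splits)
  have "coef k (block_adj U (\<lambda>j. 0) x) 0 = (\<Sum>j\<in>S. cnj (U j) *
    (\<Sum>p\<le>k. (complex_of_real (- (2 * ln (cmod (U j)))) ^ p / fact p) * coef (k - p) x j))"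
    unfolding S_def by (rule coef_block_adj[OF bl assms(3,4)])
  also have "\<dots> = (\<Sum>j\<in>S. cnj (w j) *
    (\<Sum>p\<le>k. (complex_of_real (- (2 * ln (cmod (w j)))) ^ p / fact p) * coef (k - p) x j))"
    using S by (intro sum.cong refl) (auto simp: U_def)
  also have "\<dots> = pairing k w A x"
    unfolding pairing_def using S assms(1) by (intro sum.mono_neutral_left) auto
  finally have "cmod (pairing k w A x) = cmod (coef k (block_adj U (\<lambda>j. 0) x) 0)" by simp
  also have "\<dots> \<le> 2 ^ k * Z3_norm (block_adj U (\<lambda>j. 0) x)"
    by (intro coef_le_Z3_norm block_adj_Z3 bl assms)
  also have "\<dots> \<le> 2 ^ k * Z3_norm x"
    by (intro mult_left_mono block_adj_Z3 bl assms) simp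
  finally show ?thesis .
qed

lemma pairing_leading:
  assumes "\<And>q j. q < k \<Longrightarrow> j \<in> A \<Longrightarrow> coef q x j = 0"
  shows "pairing k w A x = (\<Sum>j\<in>A. cnj (w j) * coef k x j)"
proof -
  have *: "(\<Sum>p\<le>k. a p * coef (k - p) x j) = a 0 * coef k x j"
    if "j \<in> A" for j and a :: "nat \<Rightarrow> complex"
  proof -
    have "(\<Sum>p\<le>k. a p * coef (k - p) x j) = (\<Sum>p\<le>k. if p = 0 then a 0 * coef k x j else 0)"
      using assms that by (intro sum.cong) auto
    then show ?thesis by simp
  qed
  show ?thesis
    unfolding pairing_def by (intro sum.cong refl arg_cong2[of _ _ _ _ "(*)"]) (subst *, auto)
qed

lemma sum_cnj_self:
  assumes "s = l2 d A" "s \<noteq> 0"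
  shows "(\<Sum>j\<in>A. cnj (d j / complex_of_real s) * d j) = s"
    and "(\<Sum>j\<in>A. (cmod (d j / complex_of_real s))\<^sup>2) = 1"
proof -
  have ss: "complex_of_real (s\<^sup>2) = (\<Sum>j\<in>A. cnj (d j) * d j)"
    unfolding assms(1) l2_sq of_real_sum by (intro sum.cong refl) (simp add: complex_norm_square[symmetric] mult.commute)
  have "(\<Sum>j\<in>A. cnj (d j / complex_of_real s) * d j) = (\<Sum>j\<in>A. cnj (d j) * d j) / complex_of_real s"
    by (simp add: sum_divide_distrib)
  also have "\<dots> = s" using assms(2) unfolding ss[symmetric] by (simp add: power2_eq_square)
  finally show "(\<Sum>j\<in>A. cnj (d j / complex_of_real s) * d j) = s" .
  have "(\<Sum>j\<in>A. (cmod (d j / complex_of_real s))\<^sup>2) = (\<Sum>j\<in>A. (cmod (d j))\<^sup>2) / s\<^sup>2"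
    by (simp add: norm_divide power_divide sum_divide_distrib)
  also have "\<dots> = 1" using assms by (simp add: l2_sq[symmetric])
  finally show "(\<Sum>j\<in>A. (cmod (d j / complex_of_real s))\<^sup>2) = 1" .
qed

text \<open>Duality with the normalised entry itself; no logarithms enter, because the entries of
  lower order vanish on \<open>A\<close>. With \<open>lift_exists\<close> it shows that a leading
  entry is measured by its \<open>l2\<close> norm up to constants.\<close>

lemma l2_leading_le:
  assumes "finite A" "x \<in> Z3" "k \<le> 2" "\<And>q j. q < k \<Longrightarrow> j \<in> A \<Longrightarrow> coef q x j = 0"
  shows "l2 (coef k x) A \<le> 2 ^ k * Z3_norm x"
proof (cases "l2 (coef k x) A = 0")
  case True
  then show ?thesis using Z3_norm_nonneg[OF assms(2)] by simp
next
  case False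
  define s where "s = l2 (coef k x) A"
  have s: "s \<noteq> 0" "s \<ge> 0" using False by (auto simp: s_def L2_set_nonneg)
  define w where "w j = coef k x j / complex_of_real s" for j
  have "pairing k w A x = (\<Sum>j\<in>A. cnj (w j) * coef k x j)"
    by (rule pairing_leading) (rule assms(4))
  also have "\<dots> = s"
    unfolding w_def by (rule sum_cnj_self(1)[OF s_def s(1)])
  finally have "pairing k w A x = s" .
  moreover have "cmod (pairing k w A x) \<le> 2 ^ k * Z3_norm x"
    using sum_cnj_self(2)[OF s_def s(1)] by (intro pairing_bound assms) (simp add: w_def)
  ultimately show ?thesis using s(2) by (simp add: s_def)
qed

text \<open>The factor \<open>1/\<surd>n\<close> produces the logarithms on which the lower estimates for sums of blocks rest.\<close>

lemma pairing_scaled: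
  assumes "n > 0"
  shows "pairing 2 (\<lambda>j. w j / complex_of_real (sqrt n)) A x =
    (pairing 2 w A x + complex_of_real (ln (real n)) * pairing 1 w A x + complex_of_real ((ln (real n))\<^sup>2 / 2) * pairing 0 w A x) / complex_of_real (sqrt n)"
proof -
  define r where "r = complex_of_real (sqrt n)"
  define L where "L j = complex_of_real (- (2 * ln (cmod (w j))))" for j
  have "cnj (w j / r) * (\<Sum>p\<le>2. (complex_of_real (- (2 * ln (cmod (w j / r)))) ^ p / fact p) * coef (2 - p) x j)
    = (cnj (w j) * (\<Sum>p\<le>2. (L j ^ p / fact p) * coef (2 - p) x j)
      + complex_of_real (ln (real n)) * (cnj (w j) * (\<Sum>p\<le>1. (L j ^ p / fact p) * coef (1 - p) x j))
      + complex_of_real ((ln (real n))\<^sup>2 / 2) * (cnj (w j) * (\<Sum>p\<le>0. (L j ^ p / fact p) * coef (0 - p) x j))) / r" for j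
  proof (cases "w j = 0")
    case True
    then show ?thesis by simp
  next
    case False
    have e: "ln (cmod (w j / r)) = ln (cmod (w j)) - ln (real n) / 2"
      using False assms by (simp add: r_def norm_divide ln_div ln_sqrt)
    \<comment> \<open>The exponent grows by \<open>ln n\<close>; expanding the terms up to its
      square yields the pairings of order 2, 1 and 0 with weights 1, \<open>ln n\<close> and
      \<open>(ln n)^2 / 2\<close>.\<close>
    have "complex_of_real (- (2 * ln (cmod (w j / r)))) = L j + complex_of_real (ln (real n))"
      unfolding L_def e of_real_add[symmetric] of_real_eq_iff by simp
    moreover have "cnj (w j / r) = cnj (w j) / r" by (simp add: r_def)
    ultimately show ?thesis
      by (simp only:) (simp add: sum_atMost_2 add_divide_distrib distrib_left power2_eq_square algebra_simps)
  qed
  then show ?thesis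
    unfolding pairing_def r_def[symmetric] L_def[symmetric]
    by (simp only: sum_distrib_left sum.distrib[symmetric] sum_divide_distrib)
qed

section \<open>Logarithmic lower bounds for sums of disjoint blocks\<close>

lemma coef_block_sum:
  fixes n :: nat
  assumes dis: "\<And>k l. k < n \<Longrightarrow> l < n \<Longrightarrow> k \<noteq> l \<Longrightarrow> A k \<inter> A l = {}"
    and b: "\<And>k. k < n \<Longrightarrow> supported (b k) (A k)" and k: "k < n" "j \<in> A k" "q \<le> 2"
  shows "coef q (\<Sum>l<n. b l) j = coef q (b k) j"
proof -
  have "coef q (\<Sum>l<n. b l) j = (\<Sum>l<n. if l = k then coef q (b k) j else 0)"
    unfolding coef_sum
  proof (intro sum.cong refl)
    fix l assume l: "l \<in> {..<n}"
    have "coef q (b l) j = 0" if "l \<noteq> k"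
      using b[of l] l dis[of l k] that k by (auto simp: supported_def)
    then show "coef q (b l) j = (if l = k then coef q (b k) j else 0)" by simp
  qed
  also have "\<dots> = coef q (b k) j" using k by simp
  finally show ?thesis .
qed

text \<open>All blocks are tested at once with the weights \<open>w k / sqrt n\<close>, which
  together again have \<open>l2\<close> norm at most 1. Each block contributes at least
  \<open>r / sqrt n\<close>, in total \<open>sqrt n * r\<close>; the 4 is the bound for a pairing of
  order 2.\<close>

lemma block_sum_lower:
  fixes n :: nat
  assumes n: "n > 0" and A: "\<And>k. k < n \<Longrightarrow> finite (A k)" and dis: "\<And>k l. k < n \<Longrightarrow> l < n \<Longrightarrow> k \<noteq> l \<Longrightarrow> A k \<inter> A l = {}"
    and b: "\<And>k. k < n \<Longrightarrow> b k \<in> Z3" "\<And>k. k < n \<Longrightarrow> supported (b k) (A k)"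
    and w: "\<And>k. k < n \<Longrightarrow> (\<Sum>j\<in>A k. (cmod (w k j))\<^sup>2) \<le> 1"
    and low: "\<And>k. k < n \<Longrightarrow> r \<le> Re (pairing 2 (w k) (A k) (b k) + complex_of_real (ln (real n)) * pairing 1 (w k) (A k) (b k)
      + complex_of_real ((ln (real n))\<^sup>2 / 2) * pairing 0 (w k) (A k) (b k))"
  shows "sqrt n * r \<le> 4 * Z3_norm (\<Sum>k<n. b k)"
proof -
  define S where "S = (\<Sum>k<n. pairing 2 (w k) (A k) (b k) + complex_of_real (ln (real n)) * pairing 1 (w k) (A k) (b k)
      + complex_of_real ((ln (real n))\<^sup>2 / 2) * pairing 0 (w k) (A k) (b k))"
  define y where "y = (\<Sum>k<n. b k)"
  define \<rho> where "\<rho> = complex_of_real (sqrt n)"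
  \<comment> \<open>Inside a block the choice is forced by disjointness; elsewhere the value is
    arbitrary and does not enter the sum over \<open>B\<close>.\<close>
  define W where "W j = w (SOME k. k < n \<and> j \<in> A k) j / \<rho>" for j
  have W: "W j = w k j / \<rho>" if "k < n" "j \<in> A k" for k j
  proof -
    have "(SOME k. k < n \<and> j \<in> A k) = k"
      using that dis by (intro some_equality) blast+
    then show ?thesis by (simp add: W_def)
  qed
  have yZ: "y \<in> Z3" unfolding y_def using Z3_sum[of "{..<n}" b] b by simp
  have cy: "coef q y j = coef q (b k) j" if "k < n" "j \<in> A k" "q \<le> 2" for q j k
    unfolding y_def by (rule coef_block_sum[where A = A]) (use dis b that in auto)
  define B where "B = (\<Union>k<n. A k)"
  have split: "(\<Sum>j\<in>B. g j) = (\<Sum>k<n. \<Sum>j\<in>A k. g j)" for g :: "nat \<Rightarrow> 'c::comm_monoid_add"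
    unfolding B_def using A dis by (intro sum.UNION_disjoint) auto
  have "(\<Sum>j\<in>B. (cmod (W j))\<^sup>2) = (\<Sum>k<n. \<Sum>j\<in>A k. (cmod (w k j))\<^sup>2 / n)"
    unfolding split by (intro sum.cong refl) (simp add: W \<rho>_def norm_divide power_divide)
  also have "\<dots> \<le> (\<Sum>k<n. 1 / n)"
    using w by (intro sum_mono) (auto simp: sum_divide_distrib[symmetric] divide_right_mono)
  also have "\<dots> = 1" using n by simp
  finally have W1: "(\<Sum>j\<in>B. (cmod (W j))\<^sup>2) \<le> 1" .
  have fB: "finite B" using A by (auto simp: B_def)
  have "pairing 2 W B y = (\<Sum>k<n. pairing 2 (\<lambda>j. w k j / \<rho>) (A k) (b k))"
    unfolding pairing_def split
    by (intro sum.cong refl arg_cong2[of _ _ _ _ "(*)"]) (auto simp: W cy)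
  also have "\<dots> = (\<Sum>k<n. pairing 2 (w k) (A k) (b k) + complex_of_real (ln (real n)) * pairing 1 (w k) (A k) (b k)
      + complex_of_real ((ln (real n))\<^sup>2 / 2) * pairing 0 (w k) (A k) (b k)) / \<rho>"
    unfolding \<rho>_def pairing_scaled[OF n] by (simp add: sum_divide_distrib)
  finally have "cmod S = sqrt n * cmod (pairing 2 W B y)"
    using n by (simp add: S_def \<rho>_def norm_divide)
  also have "\<dots> \<le> sqrt n * (2\<^sup>2 * Z3_norm y)"
    by (intro mult_left_mono pairing_bound fB W1 yZ) auto
  finally have up: "cmod S \<le> sqrt n * (4 * Z3_norm y)" by simp
  have "(\<Sum>k<n. r) \<le> Re S"
    unfolding S_def Re_sum using low by (intro sum_mono) simp
  also have "\<dots> \<le> cmod S" by (rule complex_Re_le_cmod)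
  finally have "n * r \<le> sqrt n * (4 * Z3_norm y)"
    using up by simp
  also have "n * r = sqrt n * (sqrt n * r)"
    by (simp only: mult.assoc[symmetric] real_sqrt_mult_self abs_of_nat)
  finally show ?thesis using n by (simp add: y_def)
qed

lemma l2_block_sum_le:
  fixes n :: nat
  assumes A: "\<And>k. k < n \<Longrightarrow> finite (A k)" and dis: "\<And>k l. k < n \<Longrightarrow> l < n \<Longrightarrow> k \<noteq> l \<Longrightarrow> A k \<inter> A l = {}"
    and b: "\<And>k. k < n \<Longrightarrow> supported (b k) (A k)" and q: "q \<le> 2"
    and C: "C \<ge> 0" "\<And>k. k < n \<Longrightarrow> l2 (coef q (b k)) (A k) \<le> C"
  shows "l2 (coef q (\<Sum>k<n. b k)) (\<Union>k<n. A k) \<le> C * sqrt n"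
proof (rule power2_le_imp_le)
  have "(l2 (coef q (\<Sum>k<n. b k)) (\<Union>k<n. A k))\<^sup>2 = (\<Sum>k<n. \<Sum>j\<in>A k. (cmod (coef q (\<Sum>k<n. b k) j))\<^sup>2)"
    unfolding l2_sq using A dis by (intro sum.UNION_disjoint) auto
  also have "\<dots> = (\<Sum>k<n. (l2 (coef q (b k)) (A k))\<^sup>2)"
    unfolding l2_sq
    by (intro sum.cong refl arg_cong[of _ _ "\<lambda>x. (cmod x)\<^sup>2"] coef_block_sum[where A = A])
      (use dis b q in auto)
  also have "\<dots> \<le> (\<Sum>k<n. C\<^sup>2)"
    using C by (intro sum_mono power_mono) (auto simp: L2_set_nonneg)
  finally show "(l2 (coef q (\<Sum>k<n. b k)) (\<Union>k<n. A k))\<^sup>2 \<le> (C * sqrt n)\<^sup>2"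
    by (simp add: power_mult_distrib mult.commute)
qed (use C in simp)

text \<open>With \<open>w k\<close> the normalised last entry of \<open>b k\<close>, the pairing of
  order 0 is real, at least \<open>d\<close>, and carries the weight \<open>(ln n)^2 / 2\<close>.
  The other two terms can take away at most \<open>2 * B * ln n\<close> and
  \<open>4 * B\<close>.\<close>

lemma block_sum_lower0:
  fixes n :: nat
  assumes n: "n > 0" and A: "\<And>k. k < n \<Longrightarrow> finite (A k)" and dis: "\<And>k l. k < n \<Longrightarrow> l < n \<Longrightarrow> k \<noteq> l \<Longrightarrow> A k \<inter> A l = {}"
    and b: "\<And>k. k < n \<Longrightarrow> b k \<in> Z3" "\<And>k. k < n \<Longrightarrow> supported (b k) (A k)" "\<And>k. k < n \<Longrightarrow> Z3_norm (b k) \<le> B"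
    and d: "d > 0" "\<And>k. k < n \<Longrightarrow> d \<le> l2 (coef 0 (b k)) (A k)"
  shows "sqrt n * (d * (ln n)\<^sup>2 / 2 - 2 * B * ln n - 4 * B) \<le> 4 * Z3_norm (\<Sum>k<n. b k)"
proof -
  define s where "s k = l2 (coef 0 (b k)) (A k)" for k
  define w where "w k j = coef 0 (b k) j / complex_of_real (s k)" for k j
  have s: "s k \<noteq> 0" "d \<le> s k" if "k < n" for k using d(1) d(2)[OF that] by (auto simp: s_def)
  have w1: "(\<Sum>j\<in>A k. (cmod (w k j))\<^sup>2) \<le> 1" if "k < n" for k
    unfolding w_def using sum_cnj_self(2)[OF s_def s(1)[OF that]] by simp
  have ln: "ln n \<ge> 0" using n by simp
  show ?thesis
  proof (rule block_sum_lower[OF n A dis b(1,2) w1])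
    fix k assume k: "k < n"
    have "cmod (pairing 2 (w k) (A k) (b k)) \<le> 2^2 * Z3_norm (b k)" "cmod (pairing 1 (w k) (A k) (b k)) \<le> 2^1 * Z3_norm (b k)"
      by (intro pairing_bound A k w1 b; simp)+
    then have p2: "- 4 * B \<le> Re (pairing 2 (w k) (A k) (b k))" and p1: "- 2 * B \<le> Re (pairing 1 (w k) (A k) (b k))"
      using b(3)[OF k] abs_Re_le_cmod[of "pairing 2 (w k) (A k) (b k)"] abs_Re_le_cmod[of "pairing 1 (w k) (A k) (b k)"] by auto
    have "pairing 0 (w k) (A k) (b k) = (\<Sum>j\<in>A k. cnj (w k j) * coef 0 (b k) j)"
      by (rule pairing_leading) simp
    also have "\<dots> = s k"
      unfolding w_def by (rule sum_cnj_self(1)[OF s_def s(1)[OF k]])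
    finally have p0: "pairing 0 (w k) (A k) (b k) = s k" .
    have "ln n * (- 2 * B) \<le> ln n * Re (pairing 1 (w k) (A k) (b k))"
      using p1 ln by (rule mult_left_mono)
    moreover have "(ln n)\<^sup>2 / 2 * d \<le> (ln n)\<^sup>2 / 2 * s k" using s(2)[OF k] by (intro mult_left_mono) auto
    ultimately show "d * (ln n)\<^sup>2 / 2 - 2 * B * ln n - 4 * B \<le> Re (pairing 2 (w k) (A k) (b k) + complex_of_real (ln n) * pairing 1 (w k) (A k) (b k)
      + complex_of_real ((ln n)\<^sup>2 / 2) * pairing 0 (w k) (A k) (b k))"
      using p2 by (simp add: p0 algebra_simps)
  qed
qed

text \<open>The last entries have to vanish exactly: otherwise the term with \<open>(ln n)^2\<close>
  could dominate with an uncontrolled sign. The pairing of order 1 then reduces to the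
  \<open>l2\<close> norm of the middle entry and carries the weight \<open>ln n\<close>.\<close>

lemma block_sum_lower1:
  fixes n :: nat
  assumes n: "n > 0" and A: "\<And>k. k < n \<Longrightarrow> finite (A k)" and dis: "\<And>k l. k < n \<Longrightarrow> l < n \<Longrightarrow> k \<noteq> l \<Longrightarrow> A k \<inter> A l = {}"
    and b: "\<And>k. k < n \<Longrightarrow> b k \<in> Z3" "\<And>k. k < n \<Longrightarrow> supported (b k) (A k)" "\<And>k. k < n \<Longrightarrow> Z3_norm (b k) \<le> B"
    and c0: "\<And>k j. k < n \<Longrightarrow> j \<in> A k \<Longrightarrow> coef 0 (b k) j = 0"
    and d: "d > 0" "\<And>k. k < n \<Longrightarrow> d \<le> l2 (coef 1 (b k)) (A k)"
  shows "sqrt n * (d * ln n - 4 * B) \<le> 4 * Z3_norm (\<Sum>k<n. b k)"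
proof -
  define s where "s k = l2 (coef 1 (b k)) (A k)" for k
  define w where "w k j = coef 1 (b k) j / complex_of_real (s k)" for k j
  have s: "s k \<noteq> 0" "d \<le> s k" if "k < n" for k using d(1) d(2)[OF that] by (auto simp: s_def)
  have w1: "(\<Sum>j\<in>A k. (cmod (w k j))\<^sup>2) \<le> 1" if "k < n" for k
    unfolding w_def using sum_cnj_self(2)[OF s_def s(1)[OF that]] by simp
  have ln: "ln n \<ge> 0" using n by simp
  show ?thesis
  proof (rule block_sum_lower[OF n A dis b(1,2) w1])
    fix k assume k: "k < n"
    have "cmod (pairing 2 (w k) (A k) (b k)) \<le> 2^2 * Z3_norm (b k)"
      by (intro pairing_bound A k w1 b; simp)
    then have p2: "- 4 * B \<le> Re (pairing 2 (w k) (A k) (b k))"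
      using b(3)[OF k] abs_Re_le_cmod[of "pairing 2 (w k) (A k) (b k)"] by auto
    have "pairing 0 (w k) (A k) (b k) = (\<Sum>j\<in>A k. cnj (w k j) * coef 0 (b k) j)"
      by (rule pairing_leading) simp
    also have "\<dots> = 0" using c0[OF k] by simp
    finally have p0: "pairing 0 (w k) (A k) (b k) = 0" .
    have "pairing 1 (w k) (A k) (b k) = (\<Sum>j\<in>A k. cnj (w k j) * coef 1 (b k) j)"
      by (rule pairing_leading) (use c0[OF k] in simp)
    also have "\<dots> = s k"
      unfolding w_def by (rule sum_cnj_self(1)[OF s_def s(1)[OF k]])
    finally have p1: "pairing 1 (w k) (A k) (b k) = s k" .
    have "ln n * d \<le> ln n * s k" using s(2)[OF k] ln by (rule mult_left_mono)
    then show "d * ln n - 4 * B \<le> Re (pairing 2 (w k) (A k) (b k) + complex_of_real (ln n) * pairing 1 (w k) (A k) (b k)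
      + complex_of_real ((ln n)\<^sup>2 / 2) * pairing 0 (w k) (A k) (b k))"
      using p2 by (simp add: p0 p1 algebra_simps del: One_nat_def)
  qed
qed

subsection \<open>Strict singularity of the quotient map along blocks\<close>

text \<open>Each block starts where the previous one ends. The end points are chosen before the
  blocks, so \<open>M\<close> is a recursion on numbers alone.\<close>

lemma block_sequence:
  fixes P :: "nat \<Rightarrow> nat \<Rightarrow> nat \<Rightarrow> 'b \<Rightarrow> bool"
  assumes "\<And>k m. \<exists>m' y. m \<le> m' \<and> P k m m' y"
  obtains M b where "M 0 = m0" "\<And>k. M k \<le> M (Suc k)" "\<And>k. P k (M k) (M (Suc k)) (b k)"
proof -
  define f where "f k m = (SOME m'. m \<le> m' \<and> (\<exists>y. P k m m' y))" for k m
  define y where "y k m = (SOME y. P k m (f k m) y)" for k m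
  have f: "m \<le> f k m \<and> (\<exists>y. P k m (f k m) y)" for k m
    unfolding f_def by (rule someI_ex) (use assms in blast)
  then have fy: "m \<le> f k m" "P k m (f k m) (y k m)" for k m
    unfolding y_def by (auto intro: someI_ex)
  define M where "M = rec_nat m0 f"
  have "M (Suc k) = f k (M k)" for k by (simp add: M_def)
  then show ?thesis
    using that[of M "\<lambda>k. y k (M k)"] fy by (simp add: M_def)
qed

lemma interval_disjoint:
  fixes M :: "nat \<Rightarrow> nat"
  assumes M: "\<And>k. M k \<le> M (Suc k)" and "k \<noteq> l"
  shows "{M k..<M (Suc k)} \<inter> {M l..<M (Suc l)} = {}"
proof -
  have "M (Suc i) \<le> M j" if "i < j" for i j
    by (rule lift_Suc_mono_le[of M, OF M]) (use that in simp)
  from this[of k l] this[of l k] assms(2) show ?thesis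
    by (cases "k < l") auto
qed

lemma interval_union_subset:
  fixes M :: "nat \<Rightarrow> nat"
  assumes M: "\<And>k. M k \<le> M (Suc k)" and "k < n"
  shows "{M k..<M (Suc k)} \<subseteq> {M 0..<M n}"
proof -
  have "M i \<le> M j" if "i \<le> j" for i j
    by (rule lift_Suc_mono_le[of M, OF M]) (use that in simp)
  from this[of 0 k] this[of "Suc k" n] assms(2) show ?thesis by auto
qed

text \<open>\<open>Q \<eta> x\<close> says that \<open>x\<close> is \<open>\<eta>\<close>-close to satisfying a homogeneous condition that is
  met by normalised vectors supported arbitrarily far out.\<close>

definition tail_condition :: "(real \<Rightarrow> ell_inf3 \<Rightarrow> bool) \<Rightarrow> bool" where
  "tail_condition Q \<longleftrightarrow> Q 0 0 \<and>
    (\<forall>a b x y. Q a x \<longrightarrow> Q b y \<longrightarrow> x \<in> Z3 \<longrightarrow> y \<in> Z3 \<longrightarrow> Q (a + b) (x + y)) \<and>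
    (\<forall>c a x. Q a x \<longrightarrow> x \<in> Z3 \<longrightarrow> Q (cmod c * a) (c *\<^sub>C x)) \<and>
    (\<forall>a b x. Q a x \<longrightarrow> a \<le> b \<longrightarrow> Q b x) \<and>
    (\<forall>m. \<forall>\<eta>>0. \<exists>m' y. m \<le> m' \<and> y \<in> Z3 \<and> supported y {m..<m'} \<and> Z3_norm y = 1 \<and> Q \<eta> y)"

lemma tail_conditionD:
  assumes "tail_condition Q"
  shows "Q 0 0"
    and "\<And>a b x y. Q a x \<Longrightarrow> Q b y \<Longrightarrow> x \<in> Z3 \<Longrightarrow> y \<in> Z3 \<Longrightarrow> Q (a + b) (x + y)"
    and "\<And>c a x. Q a x \<Longrightarrow> x \<in> Z3 \<Longrightarrow> Q (cmod c * a) (c *\<^sub>C x)"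
    and "\<And>a b x. Q a x \<Longrightarrow> a \<le> b \<Longrightarrow> Q b x"
    and "\<And>m \<eta>. \<eta> > 0 \<Longrightarrow> \<exists>m' y. m \<le> m' \<and> y \<in> Z3 \<and> supported y {m..<m'} \<and> Z3_norm y = 1 \<and> Q \<eta> y"
  using assms unfolding tail_condition_def by blast+

lemma tail_condition_sum:
  assumes "tail_condition Q" "\<And>k. k < n \<Longrightarrow> b k \<in> Z3" "\<And>k. k < n \<Longrightarrow> Q \<eta> (b k)"
  shows "Q (real n * \<eta>) (\<Sum>k<n. b k)"
  using assms(2,3)
proof (induction n)
  case 0
  then show ?case using tail_conditionD(1)[OF assms(1)] by simp
next
  case (Suc n)
  have "(\<Sum>k<n. b k) \<in> Z3" using Z3_sum[of "{..<n}" b] Suc.prems by simp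
  then have "Q (real n * \<eta> + \<eta>) ((\<Sum>k<n. b k) + b n)"
    using Suc by (intro tail_conditionD(2)[OF assms(1)]) simp_all
  then show ?case by (simp add: distrib_right add.commute)
qed

lemma normalize:
  assumes "x \<in> Z3" "Z3_norm x > 0"
  defines "y \<equiv> complex_of_real (1 / Z3_norm x) *\<^sub>C x"
  shows "y \<in> Z3" "Z3_norm y = 1"
  using Z3_scaleC[OF assms(1), of "complex_of_real (1 / Z3_norm x)"] assms(2)
  by (simp_all add: y_def norm_divide)

lemma tail_condition_normalize:
  assumes "tail_condition Q" "x \<in> Z3" "Z3_norm x \<ge> 1" "Q \<eta> x" "\<eta> \<ge> 0"
  shows "Q \<eta> (complex_of_real (1 / Z3_norm x) *\<^sub>C x)"
proof -
  have "Q (cmod (complex_of_real (1 / Z3_norm x)) * \<eta>) (complex_of_real (1 / Z3_norm x) *\<^sub>C x)"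
    by (rule tail_conditionD(3)[OF assms(1,4,2)])
  moreover have "cmod (complex_of_real (1 / Z3_norm x)) * \<eta> \<le> 1 * \<eta>"
    using assms(3,5) by (intro mult_right_mono) (auto simp: norm_divide)
  ultimately show ?thesis using tail_conditionD(4)[OF assms(1)] by simp
qed

lemma l2_scaleC: "l2 (coef q (c *\<^sub>C x)) A = cmod c * l2 (coef q x) A"
  by (simp add: L2_set_right_distrib norm_mult)

lemma supported_zero: "supported x A \<Longrightarrow> q \<le> 2 \<Longrightarrow> j \<notin> A \<Longrightarrow> coef q x j = 0"
  by (simp add: supported_def)

lemma l2_supported_mono:
  assumes "supported x A" "A \<subseteq> B" "finite B" "q \<le> 2"
  shows "l2 (coef q x) B = l2 (coef q x) A"
  unfolding L2_set_def using assms
  by (intro arg_cong[of _ _ sqrt] sum.mono_neutral_right) (auto simp: supported_def)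

text \<open>A dichotomy on \<open>n\<close> blocks. Either one of them has a last entry of size at
  most \<delta>, or the norm of their sum exceeds the bound \<open>sqrt n\<close> for its last entry
  by the factor \<open>1 / \<delta>\<close>, and normalising the sum makes that entry small.\<close>

lemma tail_small_coef0:
  assumes Q: "tail_condition Q" and "\<eta> > 0" "\<delta> > 0"
  shows "\<exists>m' y. m \<le> m' \<and> y \<in> Z3 \<and> supported y {m..<m'} \<and> Z3_norm y = 1 \<and> Q \<eta> y \<and> l2 (coef 0 y) {m..<m'} \<le> \<delta>"
proof -
  have "filterlim (\<lambda>n::nat. (\<delta> * (ln n)\<^sup>2 / 2 - 2 * 1 * ln n - 4 * 1) / 4) at_top at_top"
    using \<open>\<delta> > 0\<close> by real_asymp
  \<comment> \<open>The 1 keeps the norm of the sum above 1, so that normalising does not enlarge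
    the error in \<open>Q\<close>; the \<open>1 / \<delta>\<close> gives the ratio between the norm
    and the last entry.\<close>
  then have "\<forall>\<^sub>F n in at_top. max 1 (1 / \<delta>) \<le> (\<delta> * (ln (real n))\<^sup>2 / 2 - 2 * 1 * ln (real n) - 4 * 1) / 4"
    by (simp add: filterlim_at_top)
  moreover have "\<forall>\<^sub>F n in at_top. n > (0::nat)" by (rule eventually_gt_at_top)
  ultimately obtain n :: nat where n: "n > 0"
    and R: "max 1 (1 / \<delta>) \<le> (\<delta> * (ln (real n))\<^sup>2 / 2 - 2 * 1 * ln (real n) - 4 * 1) / 4"
    using eventually_happens'[OF sequentially_bot eventually_conj] by blast
  \<comment> \<open>The errors of \<open>n\<close> blocks add up to \<eta> in their sum.\<close>
  have "\<eta> / n > 0" using \<open>\<eta> > 0\<close> n by simp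
  then have "\<And>k m. \<exists>m' y. m \<le> m' \<and> (y \<in> Z3 \<and> supported y {m..<m'} \<and> Z3_norm y = 1 \<and> Q (\<eta> / n) y)"
    using tail_conditionD(5)[OF Q] by blast
  then obtain M b where M: "M 0 = m" "\<And>k. M k \<le> M (Suc k)"
    and b: "\<And>k. b k \<in> Z3 \<and> supported (b k) {M k..<M (Suc k)} \<and> Z3_norm (b k) = 1 \<and> Q (\<eta> / n) (b k)"
    using block_sequence[where ?m0.0 = m and P = "\<lambda>k m m' y. y \<in> Z3 \<and> supported y {m..<m'} \<and> Z3_norm y = 1 \<and> Q (\<eta> / n) y"] by blast
  define A where "A k = {M k..<M (Suc k)}" for k
  have mM: "m \<le> M k" for k using lift_Suc_mono_le[of M 0 k] M by simp
  have sub: "A k \<subseteq> {m..<M n}" if "k < n" for k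
    using interval_union_subset[of M, OF M(2) that] M(1) by (simp add: A_def)
  show ?thesis
  proof (cases "\<exists>k<n. l2 (coef 0 (b k)) (A k) \<le> \<delta>")
    case True
    then obtain k where k: "k < n" "l2 (coef 0 (b k)) (A k) \<le> \<delta>" by blast
    have s: "supported (b k) {m..<M n}" using supported_mono[OF _ sub[OF k(1)]] b by (auto simp: A_def)
    have "l2 (coef 0 (b k)) {m..<M n} = l2 (coef 0 (b k)) (A k)"
      using b sub[OF k(1)] by (intro l2_supported_mono) (auto simp: A_def)
    moreover have "\<eta> / n \<le> \<eta>" using \<open>\<eta> > 0\<close> n by (simp add: divide_le_eq)
    then have "Q \<eta> (b k)" using tail_conditionD(4)[OF Q] b[of k] by blast
    ultimately show ?thesis using b[of k] s k(2) mM[of n] by (intro exI[of _ "M n"] exI[of _ "b k"]) simp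
  next
    case False
    then have d: "\<delta> \<le> l2 (coef 0 (b k)) (A k)" if "k < n" for k using that by auto
    define y where "y = (\<Sum>k<n. b k)"
    have yZ: "y \<in> Z3" unfolding y_def using Z3_sum[of "{..<n}" b] b by simp
    have dis: "k \<noteq> l \<Longrightarrow> A k \<inter> A l = {}" for k l unfolding A_def by (rule interval_disjoint[of M, OF M(2)])
    have supA: "supported (b k) (A k)" for k using b by (simp add: A_def)
    have "sqrt n * (\<delta> * (ln n)\<^sup>2 / 2 - 2 * 1 * ln n - 4 * 1) \<le> 4 * Z3_norm y"
      unfolding y_def using n \<open>\<delta> > 0\<close> d b dis supA
      by (intro block_sum_lower0[of n A b 1 \<delta>]) (auto simp: A_def)
    then have "sqrt n * ((\<delta> * (ln n)\<^sup>2 / 2 - 2 * 1 * ln n - 4 * 1) / 4) \<le> Z3_norm y" by simp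
    moreover have "sqrt n * max 1 (1 / \<delta>) \<le> sqrt n * ((\<delta> * (ln n)\<^sup>2 / 2 - 2 * 1 * ln n - 4 * 1) / 4)"
      using R by (intro mult_left_mono) auto
    ultimately have low: "sqrt n * max 1 (1 / \<delta>) \<le> Z3_norm y" by linarith
    have n1: "1 \<le> sqrt n" using n by simp
    have "1 * 1 \<le> sqrt n * max 1 (1 / \<delta>)" using n1 by (intro mult_mono) auto
    with low have y1: "Z3_norm y \<ge> 1" by simp
    have Qy: "Q \<eta> y" using tail_condition_sum[OF Q, of n b "\<eta> / n"] b n by (simp add: y_def)
    have "l2 (coef 0 y) (\<Union>k<n. A k) \<le> 1 * sqrt n"
      unfolding y_def
    proof (rule l2_block_sum_le)
      show "l2 (coef 0 (b k)) (A k) \<le> 1" for k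
        using l2_leading_le[of "A k" "b k" 0] b by (simp add: A_def)
    qed (use dis supA in \<open>auto simp: A_def\<close>)
    moreover have "l2 (coef 0 y) {m..<M n} = l2 (coef 0 y) (\<Union>k<n. A k)"
    proof (rule l2_supported_mono)
      show "supported y (\<Union>k<n. A k)"
        unfolding y_def by (intro supported_sum supported_mono[OF supA]) auto
      show "(\<Union>k<n. A k) \<subseteq> {m..<M n}" using sub by blast
    qed auto
    ultimately have up: "l2 (coef 0 y) {m..<M n} \<le> sqrt n" by simp
    have "sqrt n * (1 / \<delta>) \<le> sqrt n * max 1 (1 / \<delta>)" by (intro mult_left_mono) auto
    with low have "sqrt n * (1 / \<delta>) \<le> Z3_norm y" by linarith
    then have "sqrt n \<le> \<delta> * Z3_norm y" using \<open>\<delta> > 0\<close> by (simp add: field_simps)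
    with up have up': "l2 (coef 0 y) {m..<M n} \<le> \<delta> * Z3_norm y" by linarith
    define y' where "y' = complex_of_real (1 / Z3_norm y) *\<^sub>C y"
    have "y' \<in> Z3" "Z3_norm y' = 1" unfolding y'_def using normalize[OF yZ] y1 by simp_all
    moreover have "Q \<eta> y'" unfolding y'_def using tail_condition_normalize[OF Q yZ y1 Qy] \<open>\<eta> > 0\<close> by simp
    moreover have "supported y' {m..<M n}"
      unfolding y'_def y_def by (intro supported_scaleC supported_sum supported_mono[OF supA] sub) simp
    moreover have "l2 (coef 0 y') {m..<M n} \<le> \<delta>"
    proof -
      have "l2 (coef 0 y') {m..<M n} = (1 / Z3_norm y) * l2 (coef 0 y) {m..<M n}"
        unfolding y'_def l2_scaleC using y1 by (simp add: norm_divide)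
      also have "\<dots> \<le> (1 / Z3_norm y) * (\<delta> * Z3_norm y)" using up' y1 by (intro mult_left_mono) auto
      also have "\<dots> = \<delta>" using y1 by simp
      finally show ?thesis .
    qed
    ultimately show ?thesis using mM[of n] by blast
  qed
qed

text \<open>The dichotomy is repeated for the middle entries, after lifts have removed the last
  entries as \<open>block_sum_lower1\<close> demands. In both cases \<open>d\<close> arises by also
  subtracting a lift of the middle entry, which is small relative to the norm of the vector.\<close>

lemma tail_condition_near_l2:
  assumes Q: "tail_condition Q" and e: "\<epsilon> > 0"
  shows "\<exists>m' y d. m \<le> m' \<and> y \<in> Z3 \<and> d \<in> Z3 \<and> supported y {m..<m'} \<and> supported d {m..<m'} \<and>
    (\<forall>j. coef 0 d j = 0 \<and> coef 1 d j = 0) \<and> Z3_norm y = 1 \<and> Q \<epsilon> y \<and> Z3_norm (y - d) \<le> \<epsilon>"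
proof -
  have "filterlim (\<lambda>n::nat. (\<epsilon> / 4 * ln n - 4 * 2) / 4) at_top at_top"
    using e by real_asymp
  \<comment> \<open>The 9 bounds the correction \<open>D + l\<close>, of norm at most
    \<open>1 + 8 * sqrt n\<close>. Of the 2, one unit pays for \<open>D\<close> and the other keeps
    the norm of the sum above 1.\<close>
  then have "\<forall>\<^sub>F n in at_top. 2 + 9 / \<epsilon> \<le> (\<epsilon> / 4 * ln (real n) - 4 * 2) / 4"
    unfolding filterlim_at_top by blast
  moreover have "\<forall>\<^sub>F n in at_top. n > max 0 (nat \<lceil>2 / \<epsilon>\<rceil>)" by (rule eventually_gt_at_top)
  ultimately obtain n :: nat where n': "n > max 0 (nat \<lceil>2 / \<epsilon>\<rceil>)"
    and R: "2 + 9 / \<epsilon> \<le> (\<epsilon> / 4 * ln (real n) - 4 * 2) / 4"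
    using eventually_happens'[OF sequentially_bot eventually_conj] by blast
  have n: "n > 0" using n' by simp
  have "2 / \<epsilon> \<le> real (nat \<lceil>2 / \<epsilon>\<rceil>)" by (rule real_nat_ceiling_ge)
  also have "\<dots> \<le> n"
    using n' unfolding max_less_iff_conj by (intro of_nat_mono less_imp_le) blast
  finally have ne: "1 / n \<le> \<epsilon> / 2" using e n by (simp add: field_simps)
  have n1: "1 \<le> sqrt n" "1 / n \<le> 1" using n by simp_all
  \<comment> \<open>Last entries of size \<open>1 / (2 * n)\<close> have lifts of norm at most
    \<open>1 / n\<close>: each is at most \<open>\<epsilon> / 2\<close>, and all \<open>n\<close>
    together at most 1.\<close>
  have "\<exists>m' y. m \<le> m' \<and> (y \<in> Z3 \<and> supported y {m..<m'} \<and> Z3_norm y = 1 \<and> Q (\<epsilon> / n) y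
      \<and> l2 (coef 0 y) {m..<m'} \<le> 1 / (2 * n))" for m
    using tail_small_coef0[OF Q, of "\<epsilon> / n" "1 / (2 * n)" m] e n by simp
  then obtain M b where M: "M 0 = m" "\<And>k. M k \<le> M (Suc k)"
    and b: "\<And>k. b k \<in> Z3 \<and> supported (b k) {M k..<M (Suc k)} \<and> Z3_norm (b k) = 1 \<and> Q (\<epsilon> / n) (b k)
      \<and> l2 (coef 0 (b k)) {M k..<M (Suc k)} \<le> 1 / (2 * n)"
    using block_sequence[where ?m0.0 = m and P = "\<lambda>k m m' y. y \<in> Z3 \<and> supported y {m..<m'} \<and> Z3_norm y = 1
      \<and> Q (\<epsilon> / n) y \<and> l2 (coef 0 y) {m..<m'} \<le> 1 / (2 * n)"] by blast
  define A where "A k = {M k..<M (Suc k)}" for k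
  have finA: "finite (A k)" for k by (simp add: A_def)
  have mM: "m \<le> M k" for k using lift_Suc_mono_le[of M 0 k] M by simp
  have sub: "A k \<subseteq> {m..<M n}" if "k < n" for k
    using interval_union_subset[of M, OF M(2) that] M(1) by (simp add: A_def)
  have dis: "k \<noteq> l \<Longrightarrow> A k \<inter> A l = {}" for k l unfolding A_def by (rule interval_disjoint[of M, OF M(2)])
  have bZ: "b k \<in> Z3" and supA: "supported (b k) (A k)" and bN: "Z3_norm (b k) = 1"
    and bQ: "Q (\<epsilon> / n) (b k)" and b0: "l2 (coef 0 (b k)) (A k) \<le> 1 / (2 * n)" for k
    using b by (auto simp: A_def)
  have "\<exists>x. x \<in> Z3 \<and> supported x (A k) \<and> (\<forall>j\<in>A k. coef 0 x j = coef 0 (b k) j) \<and> Z3_norm x \<le> 1 / n" for k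
  proof -
    obtain x where x: "x \<in> Z3" "supported x (A k)" "\<And>j. j \<in> A k \<Longrightarrow> coef 0 x j = coef 0 (b k) j"
      "Z3_norm x \<le> 2 * l2 (coef 0 (b k)) (A k)"
      using lift_exists[OF finA[of k], of 0 "coef 0 (b k)"] by auto
    have "2 * l2 (coef 0 (b k)) (A k) \<le> 2 * (1 / (2 * n))" using b0[of k] by (rule mult_left_mono) simp
    also have "\<dots> = 1 / n" by simp
    finally show ?thesis using x by (intro exI[of _ x]) auto
  qed
  then have "\<forall>k. \<exists>x. x \<in> Z3 \<and> supported x (A k) \<and> (\<forall>j\<in>A k. coef 0 x j = coef 0 (b k) j) \<and> Z3_norm x \<le> 1 / n" by blast
  from choice[OF this] obtain L where L: "\<And>k. L k \<in> Z3" "\<And>k. supported (L k) (A k)"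
    "\<And>k j. j \<in> A k \<Longrightarrow> coef 0 (L k) j = coef 0 (b k) j" "\<And>k. Z3_norm (L k) \<le> 1 / n" by blast
  define b' where "b' k = b k - L k" for k
  have b'Z: "b' k \<in> Z3" for k unfolding b'_def by (intro Z3_diff bZ L)
  have b'A: "supported (b' k) (A k)" for k unfolding b'_def by (intro supported_diff supA L)
  have b'0: "coef 0 (b' k) j = 0" for k j
    using L(3)[of j k] supported_zero[OF b'A, of 0 j k] by (cases "j \<in> A k") (auto simp: b'_def)
  have b'N: "Z3_norm (b' k) \<le> 2" for k
    unfolding b'_def using Z3_diff(2)[OF bZ L(1), of k k] bN[of k] L(4)[of k] n1 by linarith
  have lift1: "\<exists>l. l \<in> Z3 \<and> supported l B \<and> coef 0 l = (\<lambda>j. 0) \<and> (\<forall>j. coef 1 l j = coef 1 x j) \<and> Z3_norm l \<le> 2 * l2 (coef 1 x) B"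
    if B: "finite B" "supported x B" for x B
  proof -
    obtain l where l: "l \<in> Z3" "supported l B" "\<And>k j. k < 1 \<Longrightarrow> coef k l j = 0"
      "\<And>j. j \<in> B \<Longrightarrow> coef 1 l j = coef 1 x j" "Z3_norm l \<le> 2 * l2 (coef 1 x) B"
      using lift_exists[OF B(1), of 1 "coef 1 x"] by auto
    have "coef 1 l j = coef 1 x j" for j
      using l(4)[of j] supported_zero[OF l(2), of 1 j] supported_zero[OF B(2), of 1 j] by (cases "j \<in> B") auto
    then show ?thesis using l by (intro exI[of _ l]) auto
  qed
  show ?thesis
  \<comment> \<open>The lift of a middle entry of size \<open>\<epsilon> / 4\<close> has norm at
    most \<open>\<epsilon> / 2\<close>; the lift \<open>L k\<close> accounts for the other
    half.\<close>
  proof (cases "\<exists>k<n. l2 (coef 1 (b' k)) (A k) \<le> \<epsilon> / 4")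
    case True
    then obtain k where k: "k < n" "l2 (coef 1 (b' k)) (A k) \<le> \<epsilon> / 4" by blast
    obtain l where l: "l \<in> Z3" "supported l (A k)" "coef 0 l = (\<lambda>j. 0)" "\<And>j. coef 1 l j = coef 1 (b' k) j"
      "Z3_norm l \<le> 2 * l2 (coef 1 (b' k)) (A k)"
      using lift1[OF finA b'A, of k] by blast
    define d where "d = b' k - l"
    have "d \<in> Z3" unfolding d_def by (intro Z3_diff b'Z l)
    moreover have "supported d {m..<M n}"
      unfolding d_def using sub[OF k(1)] by (intro supported_diff supported_mono[OF b'A] supported_mono[OF l(2)])
    moreover have "supported (b k) {m..<M n}" by (rule supported_mono[OF supA sub[OF k(1)]])
    moreover have "coef 0 d j = 0" "coef 1 d j = 0" for j using b'0 l by (auto simp: d_def)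
    moreover have "\<epsilon> / n \<le> \<epsilon>" using e n by (simp add: divide_le_eq)
    then have "Q \<epsilon> (b k)" using tail_conditionD(4)[OF Q bQ] by blast
    moreover have "Z3_norm (b k - d) \<le> \<epsilon>"
    proof -
      have "b k - d = L k + l" by (simp add: d_def b'_def)
      then have "Z3_norm (b k - d) \<le> Z3_norm (L k) + Z3_norm l" using Z3_add(2)[OF L(1) l(1)] by simp
      then show ?thesis using L(4)[of k] l(5) k(2) ne by linarith
    qed
    ultimately show ?thesis using bZ bN mM[of n] by blast
  next
    case False
    then have d4: "\<epsilon> / 4 \<le> l2 (coef 1 (b' k)) (A k)" if "k < n" for k using that by auto
    define y where "y = (\<Sum>k<n. b k)"
    define y' where "y' = (\<Sum>k<n. b' k)"
    define D where "D = (\<Sum>k<n. L k)"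
    have yZ: "y \<in> Z3" and y'Z: "y' \<in> Z3" and DZ: "D \<in> Z3"
      unfolding y_def y'_def D_def using Z3_sum[of "{..<n}"] bZ b'Z L(1) by simp_all
    have yD: "y = y' + D" by (simp add: y_def y'_def D_def b'_def sum_subtractf)
    have "Z3_norm D \<le> (\<Sum>k<n. Z3_norm (L k))" unfolding D_def using Z3_sum[of "{..<n}" L] L(1) by simp
    also have "\<dots> \<le> (\<Sum>k<n. 1 / n)" by (intro sum_mono L)
    also have "\<dots> = 1" using n by simp
    finally have D1: "Z3_norm D \<le> 1" .
    have "sqrt n * (\<epsilon> / 4 * ln n - 4 * 2) \<le> 4 * Z3_norm y'"
      unfolding y'_def using n e d4 b'0 b'N b'Z b'A dis finA
      by (intro block_sum_lower1[of n A b' 2 "\<epsilon> / 4"]) auto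
    then have "sqrt n * ((\<epsilon> / 4 * ln n - 4 * 2) / 4) \<le> Z3_norm y'" by simp
    moreover have "sqrt n * (2 + 9 / \<epsilon>) \<le> sqrt n * ((\<epsilon> / 4 * ln n - 4 * 2) / 4)"
      using R by (intro mult_left_mono) auto
    ultimately have low': "sqrt n * (2 + 9 / \<epsilon>) \<le> Z3_norm y'" by linarith
    have "Z3_norm y' \<le> Z3_norm y + Z3_norm D" using Z3_diff(2)[OF yZ DZ] yD by simp
    then have low2: "sqrt n + sqrt n * (9 / \<epsilon>) \<le> Z3_norm y"
      using low' D1 n1(1) unfolding distrib_left by linarith
    then have low: "sqrt n * (9 / \<epsilon>) \<le> Z3_norm y" using n1 by linarith
    have up: "l2 (coef 1 y') (\<Union>k<n. A k) \<le> 4 * sqrt n"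
      unfolding y'_def
    proof (rule l2_block_sum_le)
      show "l2 (coef 1 (b' k)) (A k) \<le> 4" for k
        using l2_leading_le[OF finA b'Z, of 1 k k] b'0 b'N[of k] by simp
    qed (use dis b'A finA in auto)
    have supU: "supported y' (\<Union>k<n. A k)"
      unfolding y'_def by (intro supported_sum supported_mono[OF b'A]) auto
    have finU: "finite (\<Union>k<n. A k)" using finA by simp
    have subU: "(\<Union>k<n. A k) \<subseteq> {m..<M n}" using sub by blast
    obtain l where l: "l \<in> Z3" "supported l (\<Union>k<n. A k)" "coef 0 l = (\<lambda>j. 0)" "\<And>j. coef 1 l j = coef 1 y' j"
      "Z3_norm l \<le> 2 * l2 (coef 1 y') (\<Union>k<n. A k)"
      using lift1[OF finU supU] by blast
    have low1: "1 \<le> Z3_norm y"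
    proof -
      have "0 \<le> sqrt n * (9 / \<epsilon>)" using e by simp
      then show ?thesis using low2 n1 by linarith
    qed
    define c where "c = complex_of_real (1 / Z3_norm y)"
    define d where "d = c *\<^sub>C (y' - l)"
    have "c *\<^sub>C y \<in> Z3" "Z3_norm (c *\<^sub>C y) = 1"
      unfolding c_def using normalize[OF yZ] low1 by simp_all
    moreover have "d \<in> Z3" unfolding d_def by (intro Z3_scaleC Z3_diff y'Z l)
    moreover have "supported (c *\<^sub>C y) {m..<M n}"
      unfolding y_def by (intro supported_scaleC supported_sum supported_mono[OF supA] sub) simp
    moreover have "supported d {m..<M n}"
      unfolding d_def by (intro supported_scaleC supported_diff supported_mono[OF supU subU] supported_mono[OF l(2) subU])
    moreover have "coef 0 d j = 0" "coef 1 d j = 0" for j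
      using b'0 l by (auto simp: d_def y'_def)
    moreover have "Q \<epsilon> (c *\<^sub>C y)"
      unfolding c_def using tail_condition_sum[OF Q bZ bQ, of n] n e
      by (intro tail_condition_normalize[OF Q yZ low1]) (simp_all add: y_def)
    moreover have "Z3_norm (c *\<^sub>C y - d) \<le> \<epsilon>"
    proof -
      have "c *\<^sub>C y - d = c *\<^sub>C (D + l)"
        by (rule coef_eqI) (simp add: d_def yD algebra_simps)
      then have "Z3_norm (c *\<^sub>C y - d) = (1 / Z3_norm y) * Z3_norm (D + l)"
        using Z3_scaleC(2)[OF Z3_add(1)[OF DZ l(1)], of c] low1 by (simp add: c_def norm_divide)
      also have "\<dots> \<le> (1 / Z3_norm y) * (9 * sqrt n)"
      proof (rule mult_left_mono)
        show "Z3_norm (D + l) \<le> 9 * sqrt n"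
          using Z3_add(2)[OF DZ l(1)] D1 l(5) up n1(1) by linarith
      qed (use low1 in simp)
      also have "\<dots> \<le> \<epsilon>"
        using low e low1 by (simp add: field_simps)
      finally show ?thesis .
    qed
    ultimately show ?thesis using mM[of n] by blast
  qed
qed

subsection \<open>Bounded operators and isomorphisms\<close>

lemma bounded_opD:
  assumes "bounded_op V N W M T"
  shows "x \<in> V \<Longrightarrow> T x \<in> W" "x \<in> V \<Longrightarrow> y \<in> V \<Longrightarrow> T (x + y) = T x + T y" "x \<in> V \<Longrightarrow> T (c *\<^sub>C x) = c *\<^sub>C T x"
  using assms by (auto simp: bounded_op_def)

lemma bounded_op_diff:
  assumes "bounded_op V N W M T" "complex_vector.subspace V" "x \<in> V" "y \<in> V"
  shows "T (x - y) = T x - T y"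
proof -
  have "(- 1) *\<^sub>C y \<in> V" using assms(2,4) by (rule complex_vector.subspace_scale)
  then have "T (x + (- 1) *\<^sub>C y) = T x + (- 1) *\<^sub>C T y"
    by (simp only: bounded_opD(2)[OF assms(1,3)] bounded_opD(3)[OF assms(1,4)])
  then show ?thesis by simp
qed

lemma bounded_op_bound:
  assumes "bounded_op V N W M T" "\<And>x. x \<in> V \<Longrightarrow> 0 \<le> N x"
  obtains K where "K > 0" "\<And>x. x \<in> V \<Longrightarrow> M (T x) \<le> K * N x"
proof -
  obtain K where K: "\<forall>x\<in>V. M (T x) \<le> K * N x" using assms(1) by (auto simp: bounded_op_def)
  have "M (T x) \<le> (\<bar>K\<bar> + 1) * N x" if "x \<in> V" for x
    using K that mult_right_mono[OF _ assms(2)[OF that], of K "\<bar>K\<bar> + 1"] by fastforce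
  then show ?thesis by (intro that[of "\<bar>K\<bar> + 1"]) auto
qed

lemma bounded_op_compose:
  assumes S: "bounded_op V N V' N' S" and T: "bounded_op V' N' W M T" and pos: "\<And>x. x \<in> V' \<Longrightarrow> 0 \<le> N' x"
  shows "bounded_op V N W M (\<lambda>x. T (S x))"
proof -
  obtain K where K: "K > 0" "\<And>x. x \<in> V' \<Longrightarrow> M (T x) \<le> K * N' x" using bounded_op_bound[OF T pos] by blast
  obtain L where L: "\<forall>x\<in>V. N' (S x) \<le> L * N x" using S by (auto simp: bounded_op_def)
  have "M (T (S x)) \<le> (K * L) * N x" if "x \<in> V" for x
  proof -
    have "M (T (S x)) \<le> K * N' (S x)" by (rule K(2)[OF bounded_opD(1)[OF S that]])
    also have "\<dots> \<le> K * (L * N x)" using L that K(1) by (intro mult_left_mono) auto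
    finally show ?thesis by (simp only: mult.assoc)
  qed
  then show ?thesis
    unfolding bounded_op_def using bounded_opD[OF S] bounded_opD[OF T] by auto
qed

lemma bounded_op_restrict:
  "bounded_op V N W M T \<Longrightarrow> U \<subseteq> V \<Longrightarrow> T ` U \<subseteq> W' \<Longrightarrow> bounded_op U N W' M T"
  unfolding bounded_op_def by (meson subset_iff)

lemma isomorphism_onto_image:
  assumes T: "bounded_op V N W M T" and V: "complex_vector.subspace V"
    and lower: "\<And>x. x \<in> V \<Longrightarrow> N x \<le> C * M (T x)"
    and M0: "M 0 = 0" and N0: "\<And>x. x \<in> V \<Longrightarrow> N x \<le> 0 \<Longrightarrow> x = 0"
  shows "isomorphism V N (T ` V) M T"
proof -
  have inj: "inj_on T V"
  proof (rule inj_onI)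
    fix x y assume xy: "x \<in> V" "y \<in> V" "T x = T y"
    have d: "x - y \<in> V" using V xy by (simp add: complex_vector.subspace_diff)
    have "T (x - y) = 0" using bounded_op_diff[OF T V xy(1,2)] xy(3) by simp
    then have "N (x - y) \<le> 0" using lower[OF d] M0 by simp
    then show "x = y" using N0[OF d] by simp
  qed
  have inv: "inv_into V T (T x) = x" if "x \<in> V" for x
    using inj that by (rule inv_into_f_f)
  have "bounded_op (T ` V) M V N (inv_into V T)"
    unfolding bounded_op_def
  proof (intro conjI ballI allI exI[of _ C])
    show "inv_into V T ` T ` V \<subseteq> V" using inv by auto
    fix u v assume "u \<in> T ` V" "v \<in> T ` V"
    then obtain x y where xy: "x \<in> V" "y \<in> V" "u = T x" "v = T y" by auto
    have "u + v = T (x + y)" using bounded_opD(2)[OF T] xy by simp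
    then show "inv_into V T (u + v) = inv_into V T u + inv_into V T v"
      using inv xy V by (simp add: complex_vector.subspace_add)
  next
    fix c u assume "u \<in> T ` V"
    then obtain x where x: "x \<in> V" "u = T x" by auto
    have "c *\<^sub>C u = T (c *\<^sub>C x)" using bounded_opD(3)[OF T] x by simp
    then show "inv_into V T (c *\<^sub>C u) = c *\<^sub>C inv_into V T u"
      using inv x V by (simp add: complex_vector.subspace_scale)
  next
    fix u assume "u \<in> T ` V"
    then show "N (inv_into V T u) \<le> C * M u" using inv lower by auto
  qed
  moreover have "bounded_op V N (T ` V) M T" by (rule bounded_op_restrict[OF T]) auto
  moreover have "bij_betw T V (T ` V)" using inj by (rule inj_on_imp_bij_betw)
  ultimately show ?thesis by (simp add: isomorphism_def)
qed

lemma isomorphism_lower_bound: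
  assumes "isomorphism V N W M T" "\<And>x. x \<in> V \<Longrightarrow> 0 \<le> M (T x)"
  obtains C where "C > 0" "\<And>x. x \<in> V \<Longrightarrow> N x \<le> C * M (T x)"
proof -
  have bij: "bij_betw T V W" and op: "bounded_op W M V N (inv_into V T)"
    using assms(1) by (auto simp: isomorphism_def)
  have "0 \<le> M y" if "y \<in> W" for y
    using assms(2) bij that by (auto simp: bij_betw_def)
  from bounded_op_bound[OF op this] obtain C where C: "C > 0" "\<And>y. y \<in> W \<Longrightarrow> N (inv_into V T y) \<le> C * M y" by blast
  have "N x \<le> C * M (T x)" if "x \<in> V" for x
    using C(2)[of "T x"] bij that by (auto simp: bij_betw_def inv_into_f_f)
  with C(1) show ?thesis by (rule that)
qed

text \<open>Induction on \<open>F\<close>: the kernel of one functional has codimension at most 1 in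
  \<open>Y\<close>, so a single extra spanning vector \<open>y0\<close> suffices.\<close>

lemma finite_dimensional_if_separated:
  fixes F :: "('v::complex_vector \<Rightarrow> complex) set"
  assumes "finite F" "complex_vector.subspace Y"
    and "\<And>f x y. f \<in> F \<Longrightarrow> f (x + y) = f x + f y" "\<And>f c x. f \<in> F \<Longrightarrow> f (c *\<^sub>C x) = c * f x"
    and "\<And>y. y \<in> Y \<Longrightarrow> (\<And>f. f \<in> F \<Longrightarrow> f y = 0) \<Longrightarrow> y = 0"
  shows "\<not> infinite_dimensional Y"
  using assms
proof (induction F arbitrary: Y rule: finite_induct)
  case empty
  then have "Y \<subseteq> complex_vector.span {}" by auto
  then show ?case unfolding infinite_dimensional_def by blast
next
  case (insert f F)
  have f: "f (x + y) = f x + f y" "f (c *\<^sub>C x) = c * f x" for x y c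
    using insert.prems(2,3) by simp_all
  have f0: "f 0 = 0" using f(2)[of 0 0] by simp
  define Y' where "Y' = {y \<in> Y. f y = 0}"
  have "\<not> infinite_dimensional Y'"
  proof (rule insert.IH)
    show "complex_vector.subspace Y'"
      using insert.prems(1) f f0 by (auto simp: Y'_def complex_vector.subspace_def)
    show "y = 0" if "y \<in> Y'" "\<And>g. g \<in> F \<Longrightarrow> g y = 0" for y
      using insert.prems(4)[of y] that by (auto simp: Y'_def)
  qed (use insert.prems in auto)
  then obtain B where B: "finite B" "Y' \<subseteq> complex_vector.span B" by (auto simp: infinite_dimensional_def)
  show ?case
  proof (cases "\<exists>y0\<in>Y. f y0 \<noteq> 0")
    case False
    then have "Y \<subseteq> complex_vector.span B" using B(2) by (auto simp: Y'_def)
    then show ?thesis using B(1) unfolding infinite_dimensional_def by blast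
  next
    case True
    then obtain y0 where y0: "y0 \<in> Y" "f y0 \<noteq> 0" by blast
    have "y \<in> complex_vector.span (insert y0 B)" if y: "y \<in> Y" for y
    proof -
      define a where "a = f y / f y0"
      have "y + (- a) *\<^sub>C y0 \<in> Y"
        using insert.prems(1) y y0 by (intro complex_vector.subspace_add complex_vector.subspace_scale)
      moreover have "f (y + (- a) *\<^sub>C y0) = 0"
        using y0(2) by (simp only: f) (simp add: a_def)
      ultimately have "y + (- a) *\<^sub>C y0 \<in> Y'" unfolding Y'_def by blast
      then have "y + (- a) *\<^sub>C y0 \<in> complex_vector.span (insert y0 B)"
        using B(2) complex_vector.span_mono[of B "insert y0 B"] by blast
      moreover have "a *\<^sub>C y0 \<in> complex_vector.span (insert y0 B)"
        by (intro complex_vector.span_scale complex_vector.span_base) simp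
      ultimately have "(y + (- a) *\<^sub>C y0) + a *\<^sub>C y0 \<in> complex_vector.span (insert y0 B)"
        by (rule complex_vector.span_add)
      then show ?thesis by (simp add: add.assoc scaleC_add_left[symmetric])
    qed
    then show ?thesis using B(1) unfolding infinite_dimensional_def
      by (metis finite_insert subsetI)
  qed
qed

section \<open>Blocks close to an infinite dimensional subspace\<close>

lemma tail_vector:
  assumes Y: "complex_vector.subspace Y" "Y \<subseteq> Z3" and inf: "infinite_dimensional Y"
  obtains y where "y \<in> Y" "Z3_norm y = 1" "supported y {m..}"
proof -
  \<comment> \<open>Finitely many coordinates cannot separate the points of an infinite dimensional
    space, so some nonzero vector of \<open>Y\<close> has all three entries zero below
    \<open>m\<close>.\<close>
  define F where "F = (\<lambda>(k, j) y. coef k y j) ` ({..2} \<times> {..<m})"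
  have F: "\<exists>k j. f = (\<lambda>y. coef k y j)" if "f \<in> F" for f
    using that unfolding F_def by (auto split: prod.splits)
  have "\<exists>y\<in>Y. (\<forall>f\<in>F. f y = 0) \<and> y \<noteq> 0"
  proof (rule ccontr)
    assume no: "\<not> ?thesis"
    have "\<not> infinite_dimensional Y"
    proof (rule finite_dimensional_if_separated[OF _ Y(1)])
      show "finite F" by (simp add: F_def)
      show "f (x + y) = f x + f y" "f (c *\<^sub>C x) = c * f x" if "f \<in> F" for f x y c
        using F[OF that] by auto
    qed (use no in blast)
    with inf show False by simp
  qed
  then obtain y where y: "y \<in> Y" "\<forall>f\<in>F. f y = 0" "y \<noteq> 0" by blast
  have yZ: "y \<in> Z3" using y Y by blast
  have "Z3_norm y \<noteq> 0" using y(3) Z3_norm_eq_0[OF yZ] by blast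
  then have pos: "Z3_norm y > 0" using Z3_norm_nonneg[OF yZ] by simp
  have "supported y {m..}"
    unfolding supported_def using y(2) by (auto simp: F_def)
  then show ?thesis
    using that normalize(2)[OF yZ pos] complex_vector.subspace_scale[OF Y(1) y(1)] supported_scaleC by blast
qed

text \<open>Cutting off costs \<open>e \<le> 1/2\<close>, so a norm of at least 1/2 remains and the
  normalising factor \<open>t\<close> is at most 2. Comparison with \<open>t\<close> times
  \<open>x\<close> suffices, since the conditions to be transferred are homogeneous.\<close>

lemma normalized_truncation:
  assumes x: "x \<in> Z3" "Z3_norm x = 1" "supported x {m..}" and e: "0 < e" "e \<le> 1/2"
  obtains m' y t where "m \<le> m'" "y \<in> Z3" "supported y {m..<m'}" "Z3_norm y = 1"
    "0 \<le> t" "t \<le> 2" "Z3_norm (y - complex_of_real t *\<^sub>C x) \<le> 2 * e"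
proof -
  obtain n where n: "Z3_norm (x - trunc {..<n} x) \<le> e" using trunc_small_tail[OF x(1) e(1)] by blast
  define z where "z = trunc {..<n} x"
  have zZ: "z \<in> Z3" unfolding z_def by (rule trunc_Z3[OF x(1)])
  have "Z3_norm x \<le> Z3_norm (x - z) + Z3_norm z"
    using Z3_add(2)[OF Z3_diff(1)[OF x(1) zZ] zZ] by simp
  then have z2: "Z3_norm z \<ge> 1/2" using n x(2) e(2) by (simp add: z_def)
  define t where "t = 1 / Z3_norm z"
  have t: "0 \<le> t" "t \<le> 2" using z2 by (auto simp: t_def field_simps)
  have "supported z {m..<max m n}"
    using x(3) by (auto simp: supported_def z_def coef_trunc[OF x(1)])
  then have "supported (complex_of_real t *\<^sub>C z) {m..<max m n}" by (rule supported_scaleC)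
  moreover have "complex_of_real t *\<^sub>C z \<in> Z3" "Z3_norm (complex_of_real t *\<^sub>C z) = 1"
    unfolding t_def using normalize[OF zZ] z2 by simp_all
  moreover have "Z3_norm (complex_of_real t *\<^sub>C z - complex_of_real t *\<^sub>C x) \<le> 2 * e"
  proof -
    have "complex_of_real t *\<^sub>C z - complex_of_real t *\<^sub>C x = complex_of_real (- t) *\<^sub>C (x - z)"
      by (rule coef_eqI) (simp add: algebra_simps)
    then have "Z3_norm (complex_of_real t *\<^sub>C z - complex_of_real t *\<^sub>C x) = t * Z3_norm (x - z)"
      using Z3_scaleC(2)[OF Z3_diff(1)[OF x(1) zZ], of "complex_of_real (- t)"] t by simp
    also have "\<dots> \<le> 2 * e" using t n Z3_norm_nonneg[OF Z3_diff(1)[OF x(1) zZ]] by (intro mult_mono) (auto simp: z_def)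
    finally show ?thesis .
  qed
  ultimately show ?thesis using that[of "max m n" "complex_of_real t *\<^sub>C z" t] t by simp
qed

text \<open>A gliding hump: vectors of \<open>Y\<close> supported far out are truncated and
  normalised. Truncation may leave \<open>Y\<close>, hence a condition of closeness instead of
  membership.\<close>

lemma tail_condition_near_subspace:
  assumes Y: "complex_vector.subspace Y" "Y \<subseteq> Z3" and inf: "infinite_dimensional Y"
  shows "tail_condition (\<lambda>\<eta> x. \<exists>y\<in>Y. Z3_norm (x - y) \<le> \<eta>)"
  unfolding tail_condition_def
proof (intro conjI allI impI)
  show "\<exists>y\<in>Y. Z3_norm (0 - y) \<le> 0"
    using complex_vector.subspace_0[OF Y(1)] Z3_zero by (intro bexI[of _ 0]) simp_all
next
  fix a b x x'
  assume "\<exists>y\<in>Y. Z3_norm (x - y) \<le> a" "\<exists>y\<in>Y. Z3_norm (x' - y) \<le> b" "x \<in> Z3" "x' \<in> Z3"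
  then obtain y y' where y: "y \<in> Y" "Z3_norm (x - y) \<le> a" "y' \<in> Y" "Z3_norm (x' - y') \<le> b" and x: "x \<in> Z3" "x' \<in> Z3" by auto
  have eq: "(x + x') - (y + y') = (x - y) + (x' - y')" by simp
  have "x - y \<in> Z3" "x' - y' \<in> Z3" using x y Y(2) by (auto intro: Z3_diff)
  then have "Z3_norm ((x + x') - (y + y')) \<le> Z3_norm (x - y) + Z3_norm (x' - y')"
    unfolding eq by (rule Z3_add(2))
  with y have "Z3_norm ((x + x') - (y + y')) \<le> a + b" by linarith
  then show "\<exists>y\<in>Y. Z3_norm (x + x' - y) \<le> a + b"
    using complex_vector.subspace_add[OF Y(1) y(1,3)] by blast
next
  fix c a x
  assume "\<exists>y\<in>Y. Z3_norm (x - y) \<le> a" "x \<in> Z3"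
  then obtain y where y: "y \<in> Y" "Z3_norm (x - y) \<le> a" and x: "x \<in> Z3" by auto
  have "x - y \<in> Z3" using x y Y(2) by (auto intro: Z3_diff)
  moreover have "c *\<^sub>C x - c *\<^sub>C y = c *\<^sub>C (x - y)" by (simp add: complex_vector.scale_right_diff_distrib)
  ultimately have "Z3_norm (c *\<^sub>C x - c *\<^sub>C y) \<le> cmod c * a"
    using Z3_scaleC(2)[of "x - y" c] y(2) by (simp add: mult_left_mono)
  then show "\<exists>y\<in>Y. Z3_norm (c *\<^sub>C x - y) \<le> cmod c * a"
    using complex_vector.subspace_scale[OF Y(1) y(1)] by blast
next
  fix a b :: real and x
  assume "\<exists>y\<in>Y. Z3_norm (x - y) \<le> a" "a \<le> b"
  then show "\<exists>y\<in>Y. Z3_norm (x - y) \<le> b" by force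
next
  fix m :: nat and \<eta> :: real assume "\<eta> > 0"
  obtain x where x: "x \<in> Y" "Z3_norm x = 1" "supported x {m..}" using tail_vector[OF Y inf] by blast
  define e where "e = min (1/2) (\<eta> / 2)"
  have e: "0 < e" "e \<le> 1/2" "2 * e \<le> \<eta>" using \<open>\<eta> > 0\<close> by (auto simp: e_def)
  have "x \<in> Z3" using x Y by blast
  then obtain m' y t where "m \<le> m'" "y \<in> Z3" "supported y {m..<m'}" "Z3_norm y = 1"
    "Z3_norm (y - complex_of_real t *\<^sub>C x) \<le> 2 * e"
    using normalized_truncation[OF _ x(2,3) e(1,2)] by metis
  then show "\<exists>m' y. m \<le> m' \<and> y \<in> Z3 \<and> supported y {m..<m'} \<and> Z3_norm y = 1 \<and> (\<exists>ya\<in>Y. Z3_norm (y - ya) \<le> \<eta>)"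
    using complex_vector.subspace_scale[OF Y(1) x(1), of "complex_of_real t"] e(3) by (meson order_trans)
qed

lemma l2_block_near_subspace:
  assumes Y: "complex_vector.subspace Y" "Y \<subseteq> Z3" and inf: "infinite_dimensional Y" and e: "e > 0"
  shows "\<exists>m' u. m \<le> m' \<and> u \<in> Z3 \<and> supported u {m..<m'} \<and> (\<forall>j. coef 0 u j = 0 \<and> coef 1 u j = 0) \<and>
    l2 (coef 2 u) {m..<m'} = 1 \<and> (\<exists>y\<in>Y. Z3_norm (y - u) \<le> e)"
proof -
  \<comment> \<open>The distance from \<open>y\<close> to \<open>d\<close> will be at most
    \<open>2 * \<epsilon>\<close>, and normalising multiplies it by at most 4. The bound 1/2 keeps
    \<open>d\<close> away from 0.\<close>
  define \<epsilon> where "\<epsilon> = min (1/2) (e / 8)"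
  have eps: "\<epsilon> > 0" "\<epsilon> \<le> 1/2" "8 * \<epsilon> \<le> e" using e by (auto simp: \<epsilon>_def)
  obtain m' x d y where x: "m \<le> m'" "x \<in> Z3" "d \<in> Z3" "supported d {m..<m'}"
    "\<forall>j. coef 0 d j = 0 \<and> coef 1 d j = 0" "Z3_norm x = 1" "Z3_norm (x - d) \<le> \<epsilon>"
    and y: "y \<in> Y" "Z3_norm (x - y) \<le> \<epsilon>"
    using tail_condition_near_l2[OF tail_condition_near_subspace[OF Y inf] eps(1), of m] by blast
  have yZ: "y \<in> Z3" using y Y by blast
  have "Z3_norm x \<le> Z3_norm (x - d) + Z3_norm d" using Z3_add(2)[OF Z3_diff(1)[OF x(2,3)] x(3)] by simp
  then have d2: "Z3_norm d \<ge> 1/2" using x(6,7) eps by simp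
  define s where "s = l2 (coef 2 d) {m..<m'}"
  obtain l where l: "l \<in> Z3" "supported l {m..<m'}" "\<And>k j. k < 2 \<Longrightarrow> coef k l j = 0"
    "\<And>j. j \<in> {m..<m'} \<Longrightarrow> coef 2 l j = coef 2 d j" "Z3_norm l \<le> 2 * s"
    unfolding s_def using lift_exists[of "{m..<m'}" 2 "coef 2 d"] by (metis finite_atLeastLessThan order_refl)
  \<comment> \<open>There are no entries beyond order 2, so a lift of that order is determined
    completely: \<open>d\<close> is its own lift and has norm at most \<open>2 * s\<close>.\<close>
  have "l = d"
  proof (rule coef_eqI)
    fix k j :: nat assume "k \<le> 2"
    then consider "k = 0" | "k = 1" | "k = 2" by linarith
    then show "coef k l j = coef k d j"
    proof cases
      case 3
      then show ?thesis
        using l(4)[of j] supported_zero[OF l(2), of 2 j] supported_zero[OF x(4), of 2 j]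
        by (cases "j \<in> {m..<m'}") simp_all
    qed (use l(3)[of k j] x(5) in simp_all)
  qed
  then have s: "s \<ge> 1/4" using l(5) d2 by simp
  define c where "c = complex_of_real (1 / s)"
  have yd: "Z3_norm (y - d) \<le> 2 * \<epsilon>"
    using Z3_add(2)[of "x - d" "y - x"] Z3_diff(1)[OF x(2,3)] Z3_diff(1)[OF yZ x(2)] Z3_uminus(2)[OF Z3_diff(1)[OF x(2) yZ]] x(7) y(2)
    by simp
  have "Z3_norm (c *\<^sub>C y - c *\<^sub>C d) = (1 / s) * Z3_norm (y - d)"
    using Z3_scaleC(2)[OF Z3_diff(1)[OF yZ x(3)], of c] s
    by (simp add: c_def complex_vector.scale_right_diff_distrib norm_divide)
  also have "\<dots> \<le> 4 * (2 * \<epsilon>)"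
    using s yd eps Z3_norm_nonneg[OF Z3_diff(1)[OF yZ x(3)]] by (intro mult_mono) (auto simp: field_simps)
  finally have near: "Z3_norm (c *\<^sub>C y - c *\<^sub>C d) \<le> e" using eps(3) by simp
  have "l2 (coef 2 (c *\<^sub>C d)) {m..<m'} = 1"
    unfolding l2_scaleC using s by (simp add: c_def norm_divide s_def[symmetric])
  then show ?thesis
    using x near complex_vector.subspace_scale[OF Y(1) y(1), of c] Z3_scaleC(1)[OF x(3), of c] supported_scaleC[OF x(4), of c]
    by (intro exI[of _ m'] exI[of _ "c *\<^sub>C d"]) auto
qed

text \<open>Normalised \<open>l2\<close> blocks approximating \<open>Y\<close> with summable errors
  are glued into one block operator. Closeness is claimed only for triples \<open>(x, 0, 0)\<close>
  of finite support, where the image is a finite combination of the blocks.\<close>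

lemma block_map_near_subspace:
  assumes Y: "complex_vector.subspace Y" "Y \<subseteq> Z3" and inf: "infinite_dimensional Y" and \<theta>: "\<theta> > 0"
  obtains U \<nu> where "blocks U \<nu>" "\<And>n. (\<Sum>j | \<nu> j = n \<and> U j \<noteq> 0. (cmod (U j))\<^sup>2) = 1"
    "\<And>x N. x \<in> Z3 \<Longrightarrow> supported x {..<N} \<Longrightarrow> (\<And>j. coef 0 x j = 0 \<and> coef 1 x j = 0) \<Longrightarrow>
      \<exists>y\<in>Y. Z3_norm (y - block_op U \<nu> x) \<le> \<theta> * Z3_norm x"
proof -
  \<comment> \<open>Coefficients \<open>coef 2 x k\<close> are at most \<open>4 * Z3_norm x\<close>
    and the powers of 1/2 sum to at most 2, so the factor \<open>\<theta> / 8\<close> gives the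
    total error \<open>\<theta> * Z3_norm x\<close>.\<close>
  define P where "P k m m' u \<longleftrightarrow> u \<in> Z3 \<and> supported u {m..<m'} \<and> (\<forall>j. coef 0 u j = 0 \<and> coef 1 u j = 0) \<and>
      l2 (coef 2 u) {m..<m'} = 1 \<and> (\<exists>y\<in>Y. Z3_norm (y - u) \<le> \<theta> / 8 / 2 ^ k)" for k m m' u
  have "\<exists>m' u. m \<le> m' \<and> P k m m' u" for k m
    unfolding P_def using \<theta> by (intro l2_block_near_subspace[OF Y inf]) simp
  from block_sequence[of P 0, OF this]
  obtain M u where M: "M 0 = (0::nat)" "\<And>k. M k \<le> M (Suc k)" and u: "\<And>k. P k (M k) (M (Suc k)) (u k)"
    by metis
  define A where "A k = {M k..<M (Suc k)}" for k
  have dis: "k \<noteq> l \<Longrightarrow> A k \<inter> A l = {}" for k l unfolding A_def by (rule interval_disjoint[of M, OF M(2)])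
  have uZ: "u k \<in> Z3" and uA: "supported (u k) (A k)" and u01: "coef 0 (u k) j = 0" "coef 1 (u k) j = 0"
    and u1: "l2 (coef 2 (u k)) (A k) = 1" for k j
    using u[of k] by (auto simp: A_def P_def)
  have "\<forall>k. \<exists>y. y \<in> Y \<and> Z3_norm (y - u k) \<le> \<theta> / 8 / 2 ^ k" using u unfolding P_def by blast
  from choice[OF this] obtain v where v: "\<And>k. v k \<in> Y" "\<And>k. Z3_norm (v k - u k) \<le> \<theta> / 8 / 2 ^ k" by blast
  have vZ: "v k \<in> Z3" for k using v Y by blast
  \<comment> \<open>For a coordinate in no interval the choice would be arbitrary; \<open>U\<close>
    is set to 0 there.\<close>
  define \<nu> where "\<nu> j = (SOME k. j \<in> A k)" for j
  have \<nu>: "\<nu> j = k" if "j \<in> A k" for j k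
    unfolding \<nu>_def using that dis by (intro some_equality) blast+
  define U where "U j = (if j \<in> A (\<nu> j) then coef 2 (u (\<nu> j)) j else 0)" for j
  have U: "U j = coef 2 (u k) j" if "j \<in> A k" for j k using \<nu>[OF that] that by (simp add: U_def)
  have eq: "{j. \<nu> j = n \<and> U j \<noteq> 0} = {j \<in> A n. coef 2 (u n) j \<noteq> 0}" for n
  proof (intro set_eqI iffI)
    fix j assume "j \<in> {j. \<nu> j = n \<and> U j \<noteq> 0}"
    then have j: "\<nu> j = n" "U j \<noteq> 0" by auto
    then have "j \<in> A n" unfolding U_def by metis
    with j U[of j n] show "j \<in> {j \<in> A n. coef 2 (u n) j \<noteq> 0}" by simp
  next
    fix j assume "j \<in> {j \<in> A n. coef 2 (u n) j \<noteq> 0}"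
    then show "j \<in> {j. \<nu> j = n \<and> U j \<noteq> 0}" using U[of j n] \<nu>[of j n] by simp
  qed
  have one: "(\<Sum>j | \<nu> j = n \<and> U j \<noteq> 0. (cmod (U j))\<^sup>2) = 1" for n
  proof -
    have "(\<Sum>j | \<nu> j = n \<and> U j \<noteq> 0. (cmod (U j))\<^sup>2) = (\<Sum>j\<in>{j \<in> A n. coef 2 (u n) j \<noteq> 0}. (cmod (coef 2 (u n) j))\<^sup>2)"
      unfolding eq by (intro sum.cong refl) (auto simp: U)
    also have "\<dots> = (\<Sum>j\<in>A n. (cmod (coef 2 (u n) j))\<^sup>2)"
      by (intro sum.mono_neutral_left) (auto simp: A_def)
    also have "\<dots> = 1" unfolding l2_sq[symmetric] u1 by simp
    finally show ?thesis .
  qed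
  have bl: "blocks U \<nu>"
    unfolding blocks_def one by (auto simp: eq A_def)
  have "\<exists>y\<in>Y. Z3_norm (y - block_op U \<nu> x) \<le> \<theta> * Z3_norm x"
    if x: "x \<in> Z3" "supported x {..<N}" "\<And>j. coef 0 x j = 0 \<and> coef 1 x j = 0" for x N
  proof -
    \<comment> \<open>With only the first entry present no logarithms appear, and the operator just
      substitutes \<open>u k\<close> for the \<open>k\<close>-th unit vector.\<close>
    have T: "block_op U \<nu> x = (\<Sum>k<N. coef 2 x k *\<^sub>C u k)"
    proof (rule coef_eqI)
      fix q j :: nat assume q: "q \<le> 2"
      have lead: "(\<Sum>p\<le>q. a p * coef (q - p) x i) = (if q = 2 then a 0 * coef 2 x i else 0)" for a :: "nat \<Rightarrow> complex" and i
      proof -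
        consider "q = 0" | "q = 1" | "q = 2" using q by linarith
        then show ?thesis using x(3)[of i] by cases (simp_all add: sum_atMost_2)
      qed
      have "coef q (block_op U \<nu> x) j = (if q = 2 then U j * coef 2 x (\<nu> j) else 0)"
        unfolding coef_block_op[OF bl x(1) q] lead by simp
      also have "\<dots> = (\<Sum>k<N. coef 2 x k * coef q (u k) j)"
      proof (cases "q = 2 \<and> j \<in> A (\<nu> j)")
        case True
        have "coef 2 (u k) j = 0" if "k \<noteq> \<nu> j" for k
          using supported_zero[OF uA, of 2 j k] \<nu>[of j k] that by auto
        then have "(\<Sum>k<N. coef 2 x k * coef q (u k) j) = (\<Sum>k<N. if k = \<nu> j then coef 2 x k * U j else 0)"
          using True by (intro sum.cong) (auto simp: U_def)
        also have "\<dots> = (if \<nu> j < N then coef 2 x (\<nu> j) * U j else 0)" by simp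
        also have "\<dots> = U j * coef 2 x (\<nu> j)"
          using supported_zero[OF x(2), of 2 "\<nu> j"] by (simp add: mult.commute)
        finally show ?thesis using True by simp
      next
        case False
        have "coef q (u k) j = 0" for k
        proof (cases "q = 2")
          case True
          then have "j \<notin> A k" using False \<nu>[of j k] by auto
          then show ?thesis using supported_zero[OF uA q] by blast
        next
          case False
          then have "q = 0 \<or> q = 1" using q by linarith
          then show ?thesis using u01 by auto
        qed
        then show ?thesis using False by (auto simp: U_def)
      qed
      finally show "coef q (block_op U \<nu> x) j = coef q (\<Sum>k<N. coef 2 x k *\<^sub>C u k) j" by simp
    qed
    define y where "y = (\<Sum>k<N. coef 2 x k *\<^sub>C v k)"
    have "y \<in> Y"
      unfolding y_def using Y(1) v(1) by (intro complex_vector.subspace_sum complex_vector.subspace_scale)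
    moreover have "Z3_norm (y - block_op U \<nu> x) \<le> \<theta> * Z3_norm x"
    proof -
      have dZ: "v k - u k \<in> Z3" for k by (intro Z3_diff vZ uZ)
      have eq: "y - block_op U \<nu> x = (\<Sum>k<N. coef 2 x k *\<^sub>C (v k - u k))"
        unfolding T y_def sum_subtractf[symmetric] complex_vector.scale_right_diff_distrib ..
      have "Z3_norm (y - block_op U \<nu> x) \<le> (\<Sum>k<N. Z3_norm (coef 2 x k *\<^sub>C (v k - u k)))"
        unfolding eq using Z3_sum[of "{..<N}" "\<lambda>k. coef 2 x k *\<^sub>C (v k - u k)"] Z3_scaleC(1)[OF dZ] by simp
      also have "\<dots> \<le> (\<Sum>k<N. (4 * Z3_norm x) * (\<theta> / 8 / 2 ^ k))"
      proof (rule sum_mono)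
        fix k
        show "Z3_norm (coef 2 x k *\<^sub>C (v k - u k)) \<le> (4 * Z3_norm x) * (\<theta> / 8 / 2 ^ k)"
          unfolding Z3_scaleC(2)[OF dZ] using coef_le_Z3_norm[OF x(1), of 2 k] v(2)[of k] Z3_norm_nonneg[OF dZ] Z3_norm_nonneg[OF x(1)]
          by (intro mult_mono) auto
      qed
      also have "\<dots> = (4 * Z3_norm x) * (\<theta> / 8) * (\<Sum>k<N. (1 / 2) ^ k)"
        by (simp add: sum_distrib_left power_divide)
      also have "\<dots> \<le> (4 * Z3_norm x) * (\<theta> / 8) * 2"
        using Z3_norm_nonneg[OF x(1)] \<theta> by (intro mult_left_mono) (auto simp: sum_gp_strict)
      also have "\<dots> = \<theta> * Z3_norm x" by simp
      finally show ?thesis .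
    qed
    ultimately show ?thesis by blast
  qed
  with bl one show thesis by (rule that)
qed

text \<open>Otherwise having a small image under \<sigma> is a tail condition, and
  \<open>tail_condition_near_l2\<close> yields a triple \<open>d\<close> of the form
  \<open>(x, 0, 0)\<close> with norm at least 1/2 and small image, against
  \<open>lower\<close>.\<close>

lemma bounded_below_on_tail:
  fixes \<sigma> :: "ell_inf3 \<Rightarrow> 'x::complex_banach"
  assumes op: "bounded_op Z3 Z3_norm (UNIV :: 'x set) norm \<sigma>" and c: "c > 0"
    and lower: "\<And>x N. x \<in> Z3 \<Longrightarrow> supported x {..<N} \<Longrightarrow> (\<And>j. coef 0 x j = 0 \<and> coef 1 x j = 0) \<Longrightarrow>
      c * Z3_norm x \<le> norm (\<sigma> x)"
  shows "\<exists>m. \<exists>a>0. \<forall>x\<in>Z3. supported x {m..} \<longrightarrow> a * Z3_norm x \<le> norm (\<sigma> x)"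
proof (rule ccontr)
  assume no: "\<not> ?thesis"
  obtain K where K: "K > 0" "\<And>x. x \<in> Z3 \<Longrightarrow> norm (\<sigma> x) \<le> K * Z3_norm x"
    using bounded_op_bound[OF op Z3_norm_nonneg] by blast
  note add = bounded_opD(2)[OF op] and scale = bounded_opD(3)[OF op]
    and diff = bounded_op_diff[OF op Z3_subspace]
  have "tail_condition (\<lambda>\<eta> x. norm (\<sigma> x) \<le> \<eta>)"
    unfolding tail_condition_def
  proof (intro conjI allI impI)
    show "norm (\<sigma> 0) \<le> 0" using K(2)[of 0] by (simp add: Z3_zero)
  next
    fix a b x y assume "norm (\<sigma> x) \<le> a" "norm (\<sigma> y) \<le> b" "x \<in> Z3" "y \<in> Z3"
    then show "norm (\<sigma> (x + y)) \<le> a + b" by (simp only: add norm_triangle_mono)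
  next
    fix c' a x assume "norm (\<sigma> x) \<le> a" "x \<in> Z3"
    then show "norm (\<sigma> (c' *\<^sub>C x)) \<le> cmod c' * a" by (simp only: scale norm_scaleC mult_left_mono norm_ge_zero)
  next
    fix a b x assume "norm (\<sigma> x) \<le> a" "a \<le> b"
    then show "norm (\<sigma> x) \<le> b" by (rule order_trans)
  next
    fix m :: nat and \<eta> :: real assume \<eta>: "\<eta> > 0"
    \<comment> \<open>One half of \<eta> goes to the image of \<open>x'\<close>, which truncation
      may scale by 2, the other half to the truncation error controlled by \<open>e\<close>
      below.\<close>
    have "\<eta> / 4 > 0" using \<eta> by simp
    then obtain x where x: "x \<in> Z3" "supported x {m..}" "norm (\<sigma> x) < \<eta> / 4 * Z3_norm x"
      using no by (meson not_le)
    have pos: "Z3_norm x > 0" using x(3) \<eta> norm_ge_zero[of "\<sigma> x"] Z3_norm_nonneg[OF x(1)]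
      by (cases "Z3_norm x = 0") auto
    define t where "t = complex_of_real (1 / Z3_norm x)"
    define x' where "x' = t *\<^sub>C x"
    have x': "x' \<in> Z3" "Z3_norm x' = 1" "supported x' {m..}"
      unfolding x'_def t_def using normalize[OF x(1) pos] supported_scaleC[OF x(2)] by auto
    have "norm (\<sigma> x') = norm (\<sigma> x) / Z3_norm x"
      unfolding x'_def using pos by (simp only: scale[OF x(1)] norm_scaleC) (simp add: t_def norm_divide)
    also have "\<dots> \<le> \<eta> / 4" using x(3) pos by (simp add: field_simps)
    finally have sx': "norm (\<sigma> x') \<le> \<eta> / 4" .
    define e where "e = min (1/2) (\<eta> / (4 * K))"
    have e: "0 < e" "e \<le> 1/2" using \<eta> K(1) by (auto simp: e_def)
    have "K * (2 * e) \<le> K * (2 * (\<eta> / (4 * K)))" using K(1) by (intro mult_left_mono) (auto simp: e_def)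
    also have "\<dots> = \<eta> / 2" using K(1) by simp
    finally have Ke: "K * (2 * e) \<le> \<eta> / 2" .
    obtain m' y s where y: "m \<le> m'" "y \<in> Z3" "supported y {m..<m'}" "Z3_norm y = 1"
      "0 \<le> s" "s \<le> 2" "Z3_norm (y - complex_of_real s *\<^sub>C x') \<le> 2 * e"
      by (rule normalized_truncation[OF x' e])
    have sZ: "complex_of_real s *\<^sub>C x' \<in> Z3" by (rule Z3_scaleC(1)[OF x'(1)])
    have "norm (\<sigma> y) \<le> norm (\<sigma> y - \<sigma> (complex_of_real s *\<^sub>C x')) + norm (\<sigma> (complex_of_real s *\<^sub>C x'))"
      using norm_triangle_ineq[of "\<sigma> y - \<sigma> (complex_of_real s *\<^sub>C x')" "\<sigma> (complex_of_real s *\<^sub>C x')"] by simp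
    also have "norm (\<sigma> y - \<sigma> (complex_of_real s *\<^sub>C x')) \<le> K * (2 * e)"
      unfolding diff[OF y(2) sZ, symmetric]
      using K(2)[OF Z3_diff(1)[OF y(2) sZ]] mult_left_mono[OF y(7), of K] K(1) by linarith
    also have "norm (\<sigma> (complex_of_real s *\<^sub>C x')) \<le> 2 * (\<eta> / 4)"
      unfolding scale[OF x'(1)] norm_scaleC using y(5,6) sx' by (intro mult_mono) auto
    finally have "norm (\<sigma> y) \<le> \<eta>" using Ke by linarith
    then show "\<exists>m' y. m \<le> m' \<and> y \<in> Z3 \<and> supported y {m..<m'} \<and> Z3_norm y = 1 \<and> norm (\<sigma> y) \<le> \<eta>"
      using y by blast
  qed
  \<comment> \<open>Chosen with \<open>(1 + K) * \<epsilon> \<le> c / 4\<close>, which contradicts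
    the lower bound \<open>c / 2\<close> for the image of \<open>d\<close>.\<close>
  moreover define \<epsilon> where "\<epsilon> = min (1/2) (c / (4 * (1 + K)))"
  have eps: "\<epsilon> > 0" "\<epsilon> \<le> 1/2"
    unfolding \<epsilon>_def using c K(1) by (simp_all only: min.cobounded1) simp
  ultimately obtain m' y d where yd: "y \<in> Z3" "d \<in> Z3" "supported d {0..<m'}"
    "\<forall>j. coef 0 d j = 0 \<and> coef 1 d j = 0" "Z3_norm y = 1" "norm (\<sigma> y) \<le> \<epsilon>" "Z3_norm (y - d) \<le> \<epsilon>"
    using tail_condition_near_l2[of "\<lambda>\<eta> x. norm (\<sigma> x) \<le> \<eta>" \<epsilon> 0] by blast
  have "Z3_norm y \<le> Z3_norm (y - d) + Z3_norm d" using Z3_add(2)[OF Z3_diff(1)[OF yd(1,2)] yd(2)] by simp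
  then have d2: "Z3_norm d \<ge> 1/2" using yd(5,7) eps by simp
  have "c * (1/2) \<le> c * Z3_norm d" using d2 c by (intro mult_left_mono) auto
  also have "\<dots> \<le> norm (\<sigma> d)"
    using yd by (intro lower[of d m']) (auto simp: atLeast0LessThan)
  also have "\<dots> \<le> norm (\<sigma> y) + norm (\<sigma> y - \<sigma> d)"
    using norm_triangle_ineq4[of "\<sigma> y" "\<sigma> y - \<sigma> d"] by simp
  also have "norm (\<sigma> y - \<sigma> d) \<le> K * \<epsilon>"
    unfolding diff[OF yd(1,2), symmetric]
    using K(2)[OF Z3_diff(1)[OF yd(1,2)]] mult_left_mono[OF yd(7), of K] K(1) by linarith
  finally have "c / 2 \<le> (1 + K) * \<epsilon>" using yd(6) by (simp add: algebra_simps)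
  also have "\<dots> \<le> (1 + K) * (c / (4 * (1 + K)))" using K(1) by (intro mult_left_mono) (auto simp: \<epsilon>_def)
  also have "\<dots> = c / 4" using K(1) by (simp add: field_simps)
  finally show False using c by simp
qed

section \<open>Complemented copies of the whole space and the dichotomy\<close>

lemma complemented_copy:
  assumes R: "bounded_op Z3 Z3_norm Z3 Z3_norm R" "\<And>x. x \<in> Z3 \<Longrightarrow> Z3_norm (R x) \<le> Z3_norm x"
    and L: "bounded_op Z3 Z3_norm Z3 Z3_norm L" "\<And>x. x \<in> Z3 \<Longrightarrow> Z3_norm (L x) \<le> Z3_norm x"
    and LR: "\<And>x. x \<in> Z3 \<Longrightarrow> L (R x) = x"
  shows "complex_vector.subspace (R ` Z3)" "complemented_subspace Z3 Z3_norm (R ` Z3)"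
    "isomorphic_spaces (R ` Z3) Z3_norm Z3 Z3_norm"
proof -
  have RZ: "R x \<in> Z3" and LZ: "L x \<in> Z3" if "x \<in> Z3" for x
    using that bounded_opD(1)[OF R(1)] bounded_opD(1)[OF L(1)] by auto
  have sub: "R ` Z3 \<subseteq> Z3" using RZ by auto
  show ss: "complex_vector.subspace (R ` Z3)"
    unfolding complex_vector.subspace_def
  proof (intro conjI ballI allI)
    have "R (0 *\<^sub>C 0) = 0 *\<^sub>C R 0" by (rule bounded_opD(3)[OF R(1) Z3_zero(1)])
    then have "R 0 = 0" by simp
    then show "0 \<in> R ` Z3" using Z3_zero(1) by force
    fix u assume u: "u \<in> R ` Z3"
    then obtain x where x: "x \<in> Z3" "u = R x" by auto
    show "c *\<^sub>C u \<in> R ` Z3" for c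
      using bounded_opD(3)[OF R(1) x(1), of c] Z3_scaleC(1)[OF x(1), of c] x(2) by force
    fix v assume "v \<in> R ` Z3"
    then obtain y where y: "y \<in> Z3" "v = R y" by auto
    show "u + v \<in> R ` Z3"
      using bounded_opD(2)[OF R(1) x(1) y(1)] Z3_add(1)[OF x(1) y(1)] x(2) y(2) by force
  qed
  \<comment> \<open>\<open>L R = id\<close> makes \<open>R L\<close> a projection onto the range of
    \<open>R\<close>; being contractive, it also shows that the range is closed.\<close>
  define P where "P x = R (L x)" for x
  have Pop: "bounded_op Z3 Z3_norm Z3 Z3_norm P"
    unfolding P_def by (rule bounded_op_compose[OF L(1) R(1) Z3_norm_nonneg])
  have PZ: "P x \<in> Z3" "Z3_norm (P x) \<le> Z3_norm x" "P x \<in> R ` Z3" if "x \<in> Z3" for x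
    unfolding P_def using RZ LZ that order_trans[OF R(2)[OF LZ[OF that]] L(2)[OF that]] by auto
  have Pfix: "P y = y" if "y \<in> R ` Z3" for y
    using that LR by (auto simp: P_def)
  have closed: "x \<in> R ` Z3" if x: "x \<in> Z3" and near: "\<forall>e>0. \<exists>y\<in>R ` Z3. Z3_norm (x - y) < e" for x
  proof -
    have "Z3_norm (x - P x) \<le> 0 + e" if "e > 0" for e
    proof -
      have "e / 2 > 0" using that by simp
      then obtain y where y: "y \<in> R ` Z3" "Z3_norm (x - y) < e / 2" using near by blast
      have yZ: "y \<in> Z3" using y sub by blast
      have d: "x - y \<in> Z3" using x yZ by (rule Z3_diff)
      have eq: "x - P x = (x - y) - P (x - y)"
        unfolding bounded_op_diff[OF Pop Z3_subspace x yZ] Pfix[OF y(1)] by simp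
      have "Z3_norm (x - P x) \<le> Z3_norm (x - y) + Z3_norm (P (x - y))"
        unfolding eq by (rule Z3_diff(2)[OF d PZ(1)[OF d]])
      then show ?thesis using PZ(2)[OF d] y(2) by simp
    qed
    then have "Z3_norm (x - P x) \<le> 0" by (rule field_le_epsilon)
    moreover have "x - P x \<in> Z3" by (intro Z3_diff x PZ)
    ultimately have "x - P x = 0" using Z3_norm_nonneg[of "x - P x"] by (intro Z3_norm_eq_0) auto
    then show ?thesis using PZ(3)[OF x] by simp
  qed
  have "P ` Z3 = R ` Z3"
  proof
    show "P ` Z3 \<subseteq> R ` Z3" using PZ(3) by blast
    show "R ` Z3 \<subseteq> P ` Z3" using Pfix sub by force
  qed
  then show "complemented_subspace Z3 Z3_norm (R ` Z3)"
    unfolding complemented_subspace_def closed_subspace_def using ss sub closed Pop Pfix by blast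
  have "L ` R ` Z3 = Z3" using LR by force
  moreover have "isomorphism (R ` Z3) Z3_norm (L ` R ` Z3) Z3_norm L"
  proof (rule isomorphism_onto_image[where C = 1 and W = Z3])
    show "bounded_op (R ` Z3) Z3_norm Z3 Z3_norm L"
      by (rule bounded_op_restrict[OF L(1) sub]) (use sub LZ in blast)
    show "Z3_norm x \<le> 1 * Z3_norm (L x)" if "x \<in> R ` Z3" for x
      using that R(2) LR by auto
    show "x = 0" if "x \<in> R ` Z3" "Z3_norm x \<le> 0" for x
    proof -
      have "x \<in> Z3" using that(1) sub by blast
      then show ?thesis using that(2) Z3_norm_nonneg[of x] by (intro Z3_norm_eq_0) auto
    qed
  qed (simp_all add: ss Z3_zero)
  ultimately show "isomorphic_spaces (R ` Z3) Z3_norm Z3 Z3_norm"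
    unfolding isomorphic_spaces_def by auto
qed

lemma shift_exists:
  obtains S S' where "bounded_op Z3 Z3_norm Z3 Z3_norm S" "bounded_op Z3 Z3_norm Z3 Z3_norm S'"
    "\<And>x. x \<in> Z3 \<Longrightarrow> Z3_norm (S x) \<le> Z3_norm x" "\<And>x. x \<in> Z3 \<Longrightarrow> Z3_norm (S' x) \<le> Z3_norm x"
    "\<And>x. x \<in> Z3 \<Longrightarrow> S' (S x) = x" "\<And>x. x \<in> Z3 \<Longrightarrow> supported (S x) {m..}"
proof -
  define V where "V j = (if m \<le> j then 1 else 0 :: complex)" for j
  \<comment> \<open>Truncated subtraction sends every \<open>j < m\<close> to 0 as well, but
    \<open>V\<close> vanishes there, so the block over \<open>n\<close> is exactly
    \<open>{n + m}\<close>.\<close>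
  define \<mu> where "\<mu> j = j - m" for j
  have eq: "{j. \<mu> j = n \<and> V j \<noteq> 0} = {n + m}" for n by (auto simp: V_def \<mu>_def)
  have one: "(\<Sum>j | \<mu> j = n \<and> V j \<noteq> 0. (cmod (V j))\<^sup>2) = 1" for n
    unfolding eq by (simp add: V_def)
  then have bl: "blocks V \<mu>" by (simp add: blocks_def eq)
  have "supported (block_op V \<mu> x) {m..}" if "x \<in> Z3" for x
    unfolding supported_def by (simp add: coef_block_op[OF bl that] V_def)
  then show thesis
    using that[of "block_op V \<mu>" "block_adj V \<mu>"] block_op_bounded_op[OF bl] block_adj_bounded_op[OF bl]
      block_op_Z3(2)[OF bl] block_adj_Z3(2)[OF bl] block_adj_block_op[OF bl _ one] by blast
qed

theorem proposition7p6:
  fixes \<tau> :: "ell_inf \<times> ell_inf \<times> ell_inf \<Rightarrow> 'x::complex_banach"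
  assumes "bounded_op Z3 Z3_norm (UNIV :: 'x set) norm \<tau>"
  shows "strictly_singular Z3 Z3_norm norm \<tau> \<or>
    (\<exists>Y. complemented_subspace Z3 Z3_norm Y \<and>
         isomorphic_spaces Y Z3_norm Z3 Z3_norm \<and>
         isomorphism Y Z3_norm (\<tau> ` Y) norm \<tau>)"
proof (rule disjCI)
  assume no: "\<not> (\<exists>Y. complemented_subspace Z3 Z3_norm Y \<and>
         isomorphic_spaces Y Z3_norm Z3 Z3_norm \<and>
         isomorphism Y Z3_norm (\<tau> ` Y) norm \<tau>)"
  show "strictly_singular Z3 Z3_norm norm \<tau>"
  proof (rule ccontr)
    assume "\<not> strictly_singular Z3 Z3_norm norm \<tau>"
    then obtain Y where cl: "closed_subspace Z3 Z3_norm Y" and inf: "infinite_dimensional Y"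
      and iso: "isomorphism Y Z3_norm (\<tau> ` Y) norm \<tau>"
      unfolding strictly_singular_def by blast
    have Y: "complex_vector.subspace Y" "Y \<subseteq> Z3" using cl by (auto simp: closed_subspace_def)
    obtain C where C: "C > 0" "\<And>y. y \<in> Y \<Longrightarrow> Z3_norm y \<le> C * norm (\<tau> y)"
      using isomorphism_lower_bound[OF iso] by auto
    obtain K where K: "K > 0" "\<And>x. x \<in> Z3 \<Longrightarrow> norm (\<tau> x) \<le> K * Z3_norm x"
      using bounded_op_bound[OF assms Z3_norm_nonneg] by blast
    \<comment> \<open>Makes \<open>(1 + C * K) * \<theta> = 1/2\<close>, so that half of
      \<open>Z3_norm x\<close> absorbs the error of approximating \<open>T x\<close> from
      \<open>Y\<close>.\<close>
    define \<theta> where "\<theta> = 1 / (2 * (1 + C * K))"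
    have CK: "C * K > 0" using C K by simp
    have \<theta>: "\<theta> > 0" using CK by (simp add: \<theta>_def)
    obtain U \<nu> where bl: "blocks U \<nu>" and one: "\<And>n. (\<Sum>j | \<nu> j = n \<and> U j \<noteq> 0. (cmod (U j))\<^sup>2) = 1"
      and near: "\<And>x N. x \<in> Z3 \<Longrightarrow> supported x {..<N} \<Longrightarrow> (\<And>j. coef 0 x j = 0 \<and> coef 1 x j = 0) \<Longrightarrow>
        \<exists>y\<in>Y. Z3_norm (y - block_op U \<nu> x) \<le> \<theta> * Z3_norm x"
      using block_map_near_subspace[OF Y inf \<theta>] by blast
    define T where "T = block_op U \<nu>"
    define T' where "T' = block_adj U \<nu>"
    have T: "bounded_op Z3 Z3_norm Z3 Z3_norm T" "\<And>x. x \<in> Z3 \<Longrightarrow> Z3_norm (T x) \<le> Z3_norm x"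
      and T': "bounded_op Z3 Z3_norm Z3 Z3_norm T'" "\<And>x. x \<in> Z3 \<Longrightarrow> Z3_norm (T' x) \<le> Z3_norm x"
      and T'T: "\<And>x. x \<in> Z3 \<Longrightarrow> T' (T x) = x"
      unfolding T_def T'_def
      using block_op_bounded_op[OF bl] block_adj_bounded_op[OF bl] block_op_Z3(2)[OF bl] block_adj_Z3(2)[OF bl]
        block_adj_block_op[OF bl _ one] by auto
    have TZ: "T x \<in> Z3" and T'Z: "T' x \<in> Z3" if "x \<in> Z3" for x
      using that bounded_opD(1)[OF T(1)] bounded_opD(1)[OF T'(1)] by auto
    have lower: "1 / (2 * C) * Z3_norm x \<le> norm (\<tau> (T x))"
      if x: "x \<in> Z3" "supported x {..<N}" "\<And>j. coef 0 x j = 0 \<and> coef 1 x j = 0" for x N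
    proof -
      obtain y where y: "y \<in> Y" "Z3_norm (y - T x) \<le> \<theta> * Z3_norm x" using near[OF x] by (auto simp: T_def)
      have yZ: "y \<in> Z3" using y Y by blast
      have d: "y - T x \<in> Z3" by (intro Z3_diff yZ TZ x)
      have "Z3_norm x \<le> Z3_norm (T x)" using T'(2)[OF TZ[OF x(1)]] T'T[OF x(1)] by simp
      also have "\<dots> \<le> Z3_norm y + Z3_norm (y - T x)" using Z3_diff(2)[OF yZ d] by simp
      also have "Z3_norm y \<le> C * norm (\<tau> y)" by (rule C(2)[OF y(1)])
      also have "C * norm (\<tau> y) \<le> C * (norm (\<tau> (T x)) + K * Z3_norm (y - T x))"
      proof (rule mult_left_mono)
        have "norm (\<tau> y) \<le> norm (\<tau> (T x)) + norm (\<tau> y - \<tau> (T x))"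
          using norm_triangle_ineq[of "\<tau> (T x)" "\<tau> y - \<tau> (T x)"] by simp
        also have "norm (\<tau> y - \<tau> (T x)) \<le> K * Z3_norm (y - T x)"
          unfolding bounded_op_diff[OF assms Z3_subspace yZ TZ[OF x(1)], symmetric] by (rule K(2)[OF d])
        finally show "norm (\<tau> y) \<le> norm (\<tau> (T x)) + K * Z3_norm (y - T x)" by simp
      qed (use C in simp)
      finally have "Z3_norm x \<le> C * norm (\<tau> (T x)) + (1 + C * K) * Z3_norm (y - T x)"
        by (simp add: algebra_simps)
      also have "(1 + C * K) * Z3_norm (y - T x) \<le> (1 + C * K) * (\<theta> * Z3_norm x)"
        using y(2) CK by (intro mult_left_mono) auto
      also have "\<dots> = Z3_norm x / 2" using CK by (simp add: \<theta>_def field_simps)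
      finally have "Z3_norm x / 2 \<le> C * norm (\<tau> (T x))" by simp
      then show ?thesis using C(1) by (simp add: field_simps)
    qed
    have "bounded_op Z3 Z3_norm (UNIV :: 'x set) norm (\<lambda>x. \<tau> (T x))"
      by (rule bounded_op_compose[OF T(1) assms Z3_norm_nonneg])
    moreover have "1 / (2 * C) > 0" using C(1) by simp
    ultimately have "\<exists>m. \<exists>a>0. \<forall>x\<in>Z3. supported x {m..} \<longrightarrow> a * Z3_norm x \<le> norm (\<tau> (T x))"
      using lower by (rule bounded_below_on_tail)
    then obtain m a where a: "a > 0"
      "\<And>x. x \<in> Z3 \<Longrightarrow> supported x {m..} \<Longrightarrow> a * Z3_norm x \<le> norm (\<tau> (T x))" by blast
    obtain S S' where S: "bounded_op Z3 Z3_norm Z3 Z3_norm S" "bounded_op Z3 Z3_norm Z3 Z3_norm S'"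
      "\<And>x. x \<in> Z3 \<Longrightarrow> Z3_norm (S x) \<le> Z3_norm x" "\<And>x. x \<in> Z3 \<Longrightarrow> Z3_norm (S' x) \<le> Z3_norm x"
      "\<And>x. x \<in> Z3 \<Longrightarrow> S' (S x) = x" "\<And>x. x \<in> Z3 \<Longrightarrow> supported (S x) {m..}"
      using shift_exists[of m] by blast
    have SZ: "S x \<in> Z3" if "x \<in> Z3" for x using that bounded_opD(1)[OF S(1)] by auto
    \<comment> \<open>The shift moves all of \<open>Z3\<close> into the tail where \<tau> composed
      with \<open>T\<close> is bounded below; the left inverses compose in reverse order.\<close>
    define R where "R x = T (S x)" for x
    define L where "L x = S' (T' x)" for x
    have R: "bounded_op Z3 Z3_norm Z3 Z3_norm R" "bounded_op Z3 Z3_norm Z3 Z3_norm L"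
      unfolding R_def L_def
      using bounded_op_compose[OF S(1) T(1) Z3_norm_nonneg] bounded_op_compose[OF T'(1) S(2) Z3_norm_nonneg] by auto
    have Rn: "Z3_norm (R x) \<le> Z3_norm x" "Z3_norm (L x) \<le> Z3_norm x" "L (R x) = x" if "x \<in> Z3" for x
      unfolding R_def L_def
      using order_trans[OF T(2)[OF SZ[OF that]] S(3)[OF that]] order_trans[OF S(4)[OF T'Z[OF that]] T'(2)[OF that]]
        T'T[OF SZ[OF that]] S(5)[OF that] by auto
    note copy = complemented_copy[OF R(1) Rn(1) R(2) Rn(2) Rn(3)]
    have sub: "R ` Z3 \<subseteq> Z3" using bounded_opD(1)[OF R(1)] by auto
    have "isomorphism (R ` Z3) Z3_norm (\<tau> ` R ` Z3) norm \<tau>"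
    proof (rule isomorphism_onto_image[where C = "1 / a" and W = UNIV])
      show "bounded_op (R ` Z3) Z3_norm (UNIV :: 'x set) norm \<tau>"
        using sub by (intro bounded_op_restrict[OF assms]) auto
      show "Z3_norm y \<le> 1 / a * norm (\<tau> y)" if y: "y \<in> R ` Z3" for y
      proof -
        obtain x where x: "x \<in> Z3" "y = R x" using y by blast
        have "a * Z3_norm y \<le> a * Z3_norm (S x)"
          unfolding x(2) R_def using T(2)[OF SZ[OF x(1)]] a(1) by simp
        also have "\<dots> \<le> norm (\<tau> y)" unfolding x(2) R_def by (rule a(2)[OF SZ[OF x(1)] S(6)[OF x(1)]])
        finally show ?thesis using a(1) by (simp add: field_simps)
      qed
      show "x = 0" if "x \<in> R ` Z3" "Z3_norm x \<le> 0" for x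
      proof -
        have "x \<in> Z3" using that(1) sub by blast
        then show ?thesis using that(2) Z3_norm_nonneg[of x] by (intro Z3_norm_eq_0) auto
      qed
    qed (simp_all add: copy(1))
    with copy no show False by blast
  qed
qed

end
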